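(* Let $p\in(2,6)$, $\mu>0$, and let $\mathcal{G}$ be a metric graph not homeomorphic to $\mathbb{R}$ in which $N\ge2$ half-lines emanate from the same vertex $v$. Let $u$ be a ground state of mass $\mu$ on $\mathcal{G}$ with $u>0$. Then there exist $m>0$ and $y\ge0$ such that on each of these $N$ half-lines (with coordinate $x\ge0$, $x=0$ at $v$) one has $u(x)=\phi_m(x+y)$ for all $x\ge0$, with the same $y$ for all $N$ half-lines.
   Context: A metric graph $\mathcal{G}$ is a connected graph with finitely many edges, each identified with a bounded interval $[0,\ell_e]$ or a half-line $[0,+\infty)$ (attached at $0$), glued at vertices. $H^1(\mathcal{G})$ consists of real continuous functions which are $H^1$ on each edge with finite $H^1$ norm; $E(u,\mathcal{G})=\frac12\int_{\mathcal{G}}|u'|^2-\frac1p\int_{\mathcal{G}}|u|^p$; $H^1_\mu(\mathcal{G})=\{u\in H^1(\mathcal{G}):\|u\|_{L^2}^2=\mu\}$; a ground state of mass $\mu$ is a minimizer of $E$ on $H^1_\mu(\mathcal{G})$. $\phi_m$ is the soliton of mass $m$: $\phi_m(x)=m^\alpha\phi_1(m^\beta x)$, $\alpha=\frac2{6-p}$, $\beta=\frac{p-2}{6-p}$, $\phi_1(x)=C\,\mathrm{sech}(cx)^{\alpha/\beta}$ with constants $C,c>0$ depending on $p$, the positive even minimizer of $E(\cdot,\mathbb{R})$ on $H^1_m(\mathbb{R})$. *)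

theory Defs
  imports "HOL-Analysis.Analysis"
begin

section \<open>Metric graphs\<close>

text \<open>A metric graph: finitely many vertices and edges. Each edge e is identified with
  the interval [0, len e] (bounded edge, len e a positive real) or with [0,+inf)
  (half-line, len e = infinity). The point 0 of edge e is the vertex src e; for a
  bounded edge, the point len e is the vertex tgt e (tgt is irrelevant for half-lines).\<close>

record ('v, 'e) mgraph =
  verts :: "'v set"
  edges :: "'e set"
  src   :: "'e \<Rightarrow> 'v"
  tgt   :: "'e \<Rightarrow> 'v"
  len   :: "'e \<Rightarrow> ereal"

definition wf_mgraph :: "('v, 'e) mgraph \<Rightarrow> bool" where
  "wf_mgraph G \<longleftrightarrow> finite (verts G) \<and> finite (edges G) \<and>
     (\<forall>e\<in>edges G. src G e \<in> verts G \<and> 0 < len G e \<and>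
        (len G e \<noteq> \<infinity> \<longrightarrow> tgt G e \<in> verts G))"

definition is_halfline :: "('v, 'e) mgraph \<Rightarrow> 'e \<Rightarrow> bool" where
  "is_halfline G e \<longleftrightarrow> len G e = \<infinity>"

text \<open>The parameter interval of an edge: [0, len e] or [0, +inf).\<close>
definition edom :: "('v, 'e) mgraph \<Rightarrow> 'e \<Rightarrow> real set" where
  "edom G e = {t. 0 \<le> t \<and> ereal t \<le> len G e}"

text \<open>The vertex sitting at parameter t of edge e (if any).\<close>
definition vpt :: "('v, 'e) mgraph \<Rightarrow> 'e \<Rightarrow> real \<Rightarrow> 'v option" where
  "vpt G e t = (if t = 0 then Some (src G e)
                else if ereal t = len G e then Some (tgt G e) else None)"

text \<open>Two parameter points (e,t), (e',t') represent the same point of the graph.\<close>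
definition same_pt :: "('v, 'e) mgraph \<Rightarrow> 'e \<Rightarrow> real \<Rightarrow> 'e \<Rightarrow> real \<Rightarrow> bool" where
  "same_pt G e t e' t' \<longleftrightarrow> (e = e' \<and> t = t') \<or> (vpt G e t \<noteq> None \<and> vpt G e t = vpt G e' t')"

definition adj :: "('v, 'e) mgraph \<Rightarrow> ('v \<times> 'v) set" where
  "adj G = {(src G e, tgt G e) | e. e \<in> edges G \<and> \<not> is_halfline G e}
         \<union> {(tgt G e, src G e) | e. e \<in> edges G \<and> \<not> is_halfline G e}"

definition connected_mgraph :: "('v, 'e) mgraph \<Rightarrow> bool" where
  "connected_mgraph G \<longleftrightarrow> (\<forall>a\<in>verts G. \<forall>b\<in>verts G. (a, b) \<in> (adj G)\<^sup>*)"

text \<open>The metric graph (with the quotient topology of the disjoint union of its edge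
  intervals) is homeomorphic to the real line: there is a map h on parameter points
  inducing a bijection from the graph onto R such that a set S of reals is open iff
  all its preimages in the edge intervals are relatively open.\<close>
definition homeomorphic_to_R :: "('v, 'e) mgraph \<Rightarrow> bool" where
  "homeomorphic_to_R G \<longleftrightarrow> (\<exists>h :: 'e \<Rightarrow> real \<Rightarrow> real.
     (\<forall>e\<in>edges G. \<forall>t\<in>edom G e. \<forall>e'\<in>edges G. \<forall>t'\<in>edom G e'.
         h e t = h e' t' \<longleftrightarrow> same_pt G e t e' t') \<and>
     (\<forall>r. \<exists>e\<in>edges G. \<exists>t\<in>edom G e. h e t = r) \<and>
     (\<forall>S. open S \<longleftrightarrow>
         (\<forall>e\<in>edges G. openin (top_of_set (edom G e)) {t \<in> edom G e. h e t \<in> S})))"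

section \<open>H^1 functions, energy, ground states on a metric graph\<close>

text \<open>g is a (weak) derivative of f on an interval I starting at 0:
  f(x) = f(0) + integral of g over [0,x] for all x in I (absolute continuity).\<close>
definition is_wderiv :: "real set \<Rightarrow> (real \<Rightarrow> real) \<Rightarrow> (real \<Rightarrow> real) \<Rightarrow> bool" where
  "is_wderiv I f g \<longleftrightarrow>
     (\<forall>x\<in>I. set_integrable lborel {0..x} g \<and> f x = f 0 + (LBINT s:{0..x}. g s))"

definition H1_edge :: "real set \<Rightarrow> (real \<Rightarrow> real) \<Rightarrow> (real \<Rightarrow> real) \<Rightarrow> bool" where
  "H1_edge I f g \<longleftrightarrow> is_wderiv I f g \<and> set_integrable lborel I (\<lambda>s. (g s)\<^sup>2)
                        \<and> set_integrable lborel I (\<lambda>s. (f s)\<^sup>2)"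

text \<open>A function on the graph is a family of functions u e on the edge intervals.\<close>
definition H1 :: "('v, 'e) mgraph \<Rightarrow> ('e \<Rightarrow> real \<Rightarrow> real) \<Rightarrow> bool" where
  "H1 G u \<longleftrightarrow> (\<forall>e\<in>edges G. \<exists>g. H1_edge (edom G e) (u e) g) \<and>
     (\<forall>e\<in>edges G. \<forall>t\<in>edom G e. \<forall>e'\<in>edges G. \<forall>t'\<in>edom G e'.
         same_pt G e t e' t' \<longrightarrow> u e t = u e' t')"

definition dG :: "('v, 'e) mgraph \<Rightarrow> ('e \<Rightarrow> real \<Rightarrow> real) \<Rightarrow> 'e \<Rightarrow> real \<Rightarrow> real" where
  "dG G u e = (SOME g. H1_edge (edom G e) (u e) g)"

definition mass :: "('v, 'e) mgraph \<Rightarrow> ('e \<Rightarrow> real \<Rightarrow> real) \<Rightarrow> real" where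
  "mass G u = (\<Sum>e\<in>edges G. LBINT x:edom G e. (u e x)\<^sup>2)"

definition energy :: "('v, 'e) mgraph \<Rightarrow> real \<Rightarrow> ('e \<Rightarrow> real \<Rightarrow> real) \<Rightarrow> real" where
  "energy G p u = 1/2 * (\<Sum>e\<in>edges G. LBINT x:edom G e. (dG G u e x)\<^sup>2)
                  - 1/p * (\<Sum>e\<in>edges G. LBINT x:edom G e. \<bar>u e x\<bar> powr p)"

definition ground_state :: "('v, 'e) mgraph \<Rightarrow> real \<Rightarrow> real \<Rightarrow> ('e \<Rightarrow> real \<Rightarrow> real) \<Rightarrow> bool" where
  "ground_state G p \<mu> u \<longleftrightarrow> H1 G u \<and> mass G u = \<mu> \<and>
     (\<forall>w. H1 G w \<and> mass G w = \<mu> \<longrightarrow> energy G p u \<le> energy G p w)"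

section \<open>The soliton on the real line\<close>

definition H1R_wd :: "(real \<Rightarrow> real) \<Rightarrow> (real \<Rightarrow> real) \<Rightarrow> bool" where
  "H1R_wd f g \<longleftrightarrow> (\<forall>a b. a \<le> b \<longrightarrow> set_integrable lborel {a..b} g \<and>
                        f b - f a = (LBINT s:{a..b}. g s)) \<and>
                   integrable lborel (\<lambda>s. (g s)\<^sup>2) \<and> integrable lborel (\<lambda>s. (f s)\<^sup>2)"

definition H1R :: "(real \<Rightarrow> real) \<Rightarrow> bool" where
  "H1R f \<longleftrightarrow> (\<exists>g. H1R_wd f g)"

definition dR :: "(real \<Rightarrow> real) \<Rightarrow> real \<Rightarrow> real" where
  "dR f = (SOME g. H1R_wd f g)"

definition massR :: "(real \<Rightarrow> real) \<Rightarrow> real" where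
  "massR f = (LINT x|lborel. (f x)\<^sup>2)"

definition energyR :: "real \<Rightarrow> (real \<Rightarrow> real) \<Rightarrow> real" where
  "energyR p f = 1/2 * (LINT x|lborel. (dR f x)\<^sup>2) - 1/p * (LINT x|lborel. \<bar>f x\<bar> powr p)"

text \<open>phi_1: the positive even minimizer of E(.,R) on H^1_1(R).\<close>
definition phi1 :: "real \<Rightarrow> real \<Rightarrow> real" where
  "phi1 p = (THE f. (\<forall>x. 0 < f x) \<and> (\<forall>x. f (- x) = f x) \<and> H1R f \<and> massR f = 1 \<and>
                    (\<forall>w. H1R w \<and> massR w = 1 \<longrightarrow> energyR p f \<le> energyR p w))"

text \<open>phi_m(x) = m^alpha phi_1(m^beta x), alpha = 2/(6-p), beta = (p-2)/(6-p).\<close>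
definition soliton :: "real \<Rightarrow> real \<Rightarrow> real \<Rightarrow> real" where
  "soliton p m x = m powr (2 / (6 - p)) * phi1 p (m powr ((p - 2) / (6 - p)) * x)"

end

theory Submission
  imports Defs
begin

text \<open>
  Write \<open>Q\<^sub>a\<close> for the profile solving \<open>Q'' = a\<^sup>2 Q - Q powr (p - 1)\<close> on the line and \<open>A(a) = \<integral> Q\<^sub>a'\<^sup>2\<close>. A calibration
  argument gives \<open>E(f) \<ge> A(a) - a\<^sup>2/2 \<integral> f\<^sup>2\<close> on the line, where \<open>a\<close> is the frequency with \<open>max Q\<^sub>a = max \<bar>f\<bar>\<close>; the
  right-hand side is at least its value at the \<open>b\<close> for which \<open>Q\<^sub>b\<close> has the mass of \<open>f\<close>, so the solitons are the \<open>Q\<^sub>b\<close>.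

  On every half-line a ground state \<open>u\<close> of mass \<open>\<mu>\<close> is \<open>x \<mapsto> Q\<^sub>a(x + y)\<close>, with \<open>a\<^sup>2\<close> the Lagrange multiplier, and continuity at
  \<open>v\<close> fixes \<open>\<bar>y\<bar>\<close>. If two shifts had sum \<open>\<le> 0\<close>, the two half-lines would carry at least the \<open>L\<^sup>p\<close> content of a full soliton
  \<open>Q\<^sub>a\<close>, and a further edge (\<open>G\<close> is not a line) adds to it, so \<open>E(u) = (1/2 - 1/p) \<integral> u\<^sup>p - a\<^sup>2 \<mu>/2 > A(a) - a\<^sup>2 \<mu>/2\<close>. That exceeds
  the energy of the soliton of mass \<open>\<mu>\<close>, which can be approximated on a half-line of \<open>G\<close>. Hence all shifts agree and are
  positive.
\<close>

section \<open>Weak derivatives on intervals\<close>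

text \<open>The obstacle is that functions have only weak derivatives, so neither the chain rule nor
  the differential equation can be used pointwise at the start. Two devices replace them. The
  calibration bound is proved on small intervals with an error proportional to their length and
  summed by bisection. The equation is tested only against tents inside a half-line: pairing a weak
  derivative with the derivative of a tent gives a second difference of \<open>f\<close>, so after
  adding a double antiderivative of the nonlinearity a continuous midpoint-affine function is left,
  and \<open>f\<close> turns out to be C^2. Such tests vanish at the vertex and affect the other
  edges only through the rescaling that restores the mass. The resulting multiplier is a ratio of
  integrals over the whole graph, which is why every half-line yields the same frequency
  \<open>a\<close>. This \<open>a\<close> need not be the frequency of the soliton of mass \<mu>;
  the two are compared by a tangent-line inequality for a power with exponent (p + 2)/(2 (p - 2)),
  which is at least 1 exactly when p \<le> 6.\<close>

definition wderiv_on :: "real set \<Rightarrow> (real \<Rightarrow> real) \<Rightarrow> (real \<Rightarrow> real) \<Rightarrow> bool" where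
  "wderiv_on I f g \<longleftrightarrow> (\<forall>a b. a \<le> b \<longrightarrow> {a..b} \<subseteq> I \<longrightarrow>
     set_integrable lborel {a..b} g \<and> f b - f a = (LBINT s:{a..b}. g s))"

lemma set_integral_Icc_split:
  fixes g :: "real \<Rightarrow> real"
  assumes "set_integrable lborel {a..c} g" "a \<le> b" "b \<le> c"
  shows "(LBINT s:{a..c}. g s) = (LBINT s:{a..b}. g s) + (LBINT s:{b..c}. g s)"
proof -
  have i: "set_integrable lborel {a..b} g" "set_integrable lborel {b..c} g"
    by (rule set_integrable_subset[OF assms(1)]; use assms in auto)+
  have "(LBINT s:{a..b}\<union>{b..c}. g s) = (LBINT s:{a..b}. g s) + (LBINT s:{b..c}. g s)"
  proof (rule set_integral_Un_AE[OF _ _ _ i])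
    have "AE x in lborel. x \<noteq> b" by (rule AE_lborel_singleton)
    then show "AE x in lborel. \<not> (x \<in> {a..b} \<and> x \<in> {b..c})" by eventually_elim auto
  qed auto
  moreover have "{a..b}\<union>{b..c} = {a..c}" using assms by auto
  ultimately show ?thesis by simp
qed

text \<open>\<open>is_wderiv\<close> compares only with the endpoint 0, whereas the two-point form
  makes sense on the line as well and passes to subintervals. On an interval that starts at 0 the
  latter follows by subtracting the identities at \<open>b\<close> and \<open>a\<close>.\<close>

lemma is_wderiv_imp_wderiv_on:
  assumes "is_wderiv I f g" "I \<subseteq> {0..}" "\<And>x. x \<in> I \<Longrightarrow> {0..x} \<subseteq> I"
  shows "wderiv_on I f g"
  unfolding wderiv_on_def
proof (intro allI impI)
  fix a b :: real assume ab: "a \<le> b" "{a..b} \<subseteq> I"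
  then have "a \<in> I" "b \<in> I" by auto
  with assms have 0: "0 \<le> a" and ib: "set_integrable lborel {0..b} g"
    and f: "f b = f 0 + (LBINT s:{0..b}. g s)" "f a = f 0 + (LBINT s:{0..a}. g s)"
    unfolding is_wderiv_def by auto
  have "set_integrable lborel {a..b} g" by (rule set_integrable_subset[OF ib]) (use 0 in auto)
  moreover have "f b - f a = (LBINT s:{a..b}. g s)"
    using set_integral_Icc_split[OF ib 0 ab(1)] f by simp
  ultimately show "set_integrable lborel {a..b} g \<and> f b - f a = (LBINT s:{a..b}. g s)" by simp
qed

lemma wderiv_on_imp_is_wderiv:
  assumes "wderiv_on I f g" "I \<subseteq> {0..}" "\<And>x. x \<in> I \<Longrightarrow> {0..x} \<subseteq> I"
  shows "is_wderiv I f g"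
  unfolding is_wderiv_def
proof
  fix x assume x: "x \<in> I"
  then have "0 \<le> x" "{0..x} \<subseteq> I" using assms by auto
  with assms(1) have "set_integrable lborel {0..x} g" "f x - f 0 = (LBINT s:{0..x}. g s)"
    unfolding wderiv_on_def by auto
  then show "set_integrable lborel {0..x} g \<and> f x = f 0 + (LBINT s:{0..x}. g s)" by simp
qed

lemma wderiv_on_subset: "wderiv_on I f g \<Longrightarrow> J \<subseteq> I \<Longrightarrow> wderiv_on J f g"
  unfolding wderiv_on_def by (meson subset_trans)

lemma wderiv_on_add_scaled:
  assumes "wderiv_on I f g" "wderiv_on I f' g'"
  shows "wderiv_on I (\<lambda>x. c * f x + d * f' x) (\<lambda>x. c * g x + d * g' x)"
  unfolding wderiv_on_def
proof (intro allI impI)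
  fix a b :: real assume ab: "a \<le> b" "{a..b} \<subseteq> I"
  with assms have *: "set_integrable lborel {a..b} g" "f b - f a = (LBINT s:{a..b}. g s)"
     "set_integrable lborel {a..b} g'" "f' b - f' a = (LBINT s:{a..b}. g' s)"
    unfolding wderiv_on_def by auto
  have "(LBINT s:{a..b}. c * g s + d * g' s) = c * (f b - f a) + d * (f' b - f' a)"
    using * by (subst set_integral_add(2)) auto
  with * show "set_integrable lborel {a..b} (\<lambda>x. c * g x + d * g' x) \<and>
       c * f b + d * f' b - (c * f a + d * f' a) = (LBINT s:{a..b}. c * g s + d * g' s)"
    by (auto simp: algebra_simps)
qed

lemma wderiv_on_scale:
  assumes "wderiv_on I f g" shows "wderiv_on I (\<lambda>x. c * f x) (\<lambda>x. c * g x)"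
  using wderiv_on_add_scaled[OF assms assms, of c 0] by simp

lemma wderiv_on_continuous_Icc:
  assumes "wderiv_on {a..b} f g"
  shows "continuous_on {a..b} f"
proof (cases "a \<le> b")
  case True
  then have i: "set_integrable lborel {a..b} g" using assms unfolding wderiv_on_def by auto
  then have i2: "g integrable_on {a..b}" by (rule set_borel_integral_eq_integral)
  have "continuous_on {a..b} (\<lambda>x. f a + integral {a..x} g)"
    by (intro continuous_intros indefinite_integral_continuous_1 i2)
  moreover have "f x = f a + integral {a..x} g" if "x \<in> {a..b}" for x
  proof -
    have "f x - f a = (LBINT s:{a..x}. g s)" 
      using assms that unfolding wderiv_on_def by auto
    moreover have "set_integrable lborel {a..x} g" 
      using assms that unfolding wderiv_on_def by auto
    ultimately show ?thesis using set_borel_integral_eq_integral(2)[of "{a..x}" g] by simp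
  qed
  ultimately show ?thesis by (metis (no_types, lifting) continuous_on_cong)
qed auto

lemma wderiv_on_continuous:
  assumes "wderiv_on I f g" "is_interval I"
  shows "continuous_on I f"
  unfolding continuous_on_eq_continuous_within
proof
  fix x assume x: "x \<in> I"
  \<comment> \<open>The defaults \<open>a = x\<close> and \<open>b = x\<close> treat the endpoints
    of \<open>I\<close>: there the compact interval around \<open>x\<close> extends to one side
    only.\<close>
  define a where "a = (if \<exists>y\<in>I. y < x then SOME y. y \<in> I \<and> y < x else x)"
  define b where "b = (if \<exists>y\<in>I. y > x then SOME y. y \<in> I \<and> y > x else x)"
  have a: "a \<in> I \<and> a < x \<or> a = x \<and> (\<forall>y\<in>I. y \<ge> x)"
    unfolding a_def using someI_ex[of "\<lambda>y. y \<in> I \<and> y < x"] by (auto simp: not_less)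
  have b: "b \<in> I \<and> b > x \<or> b = x \<and> (\<forall>y\<in>I. y \<le> x)"
    unfolding b_def using someI_ex[of "\<lambda>y. y \<in> I \<and> y > x"] by (auto simp: not_less)
  have abI: "{a..b} \<subseteq> I"
    using a b x assms(2) unfolding is_interval_1 by (meson atLeastAtMost_iff subsetI)
  have "continuous_on {a..b} f"
    using wderiv_on_continuous_Icc wderiv_on_subset[OF assms(1) abI] by blast
  then have c: "continuous (at x within {a..b}) f"
    using a b unfolding continuous_on_eq_continuous_within by force
  define S where "S = {(if a < x then a else x - 1)<..<(if b > x then b else x + 1)}"
  have "at x within I = at x within {a..b}"
  proof (rule at_within_nhd)
    show "x \<in> S" "open S" by (auto simp: S_def)
    have "y \<in> {a..b}" if "y \<in> I" "y \<in> S" for y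
    proof -
      have "a \<le> y" 
      proof (cases "a < x")
        case True then show ?thesis using that(2) by (simp add: S_def)
      next
        case False then show ?thesis using a that(1) by blast
      qed
      moreover have "y \<le> b" 
      proof (cases "x < b")
        case True then show ?thesis using that(2) by (simp add: S_def)
      next
        case False then show ?thesis using b that(1) by blast
      qed
      ultimately show ?thesis by simp
    qed
    with abI show "I \<inter> S - {x} = {a..b} \<inter> S - {x}" by blast
  qed
  then show "continuous (at x within I) f" using c by (simp only:)
qed

section \<open>Uniqueness and measurability of weak derivatives\<close>

lemma integrable_eq_zero_if_Ioi_integrals_zero:
  fixes h :: "real \<Rightarrow> real"
  assumes i: "integrable lborel h" and z: "\<And>x. (LBINT s:{x<..}. h s) = 0"
  shows "AE x in lborel. h x = 0"
proof -
  define f where "f = (\<lambda>x. max 0 (h x))"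
  define f' where "f' = (\<lambda>x. max 0 (- h x))"
  have ii: "integrable lborel f" "integrable lborel f'"
    unfolding f_def f'_def using i by auto
  have nn: "0 \<le> f x" "0 \<le> f' x" for x by (auto simp: f_def f'_def)
  have si: "set_integrable lborel A f" "set_integrable lborel A f'" if "A \<in> sets lborel" for A
    unfolding set_integrable_def
    by (rule integrable_mult_indicator[OF that ii(1)], rule integrable_mult_indicator[OF that ii(2)])
  have em: "emeasure (density lborel f) A = ennreal (LBINT s:A. f s)"
       "emeasure (density lborel f') A = ennreal (LBINT s:A. f' s)"
    if A: "A \<in> sets lborel" for A
  proof -
    have "emeasure (density lborel f) A = (\<integral>\<^sup>+x. ennreal (indicator A x *\<^sub>R f x) \<partial>lborel)"
      using A borel_measurable_integrable[OF ii(1)] borel_measurable_integrable[OF ii(2)]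
      by (subst emeasure_density) (auto intro!: nn_integral_cong split: split_indicator)
    also have "\<dots> = ennreal (LBINT s:A. f s)"
      unfolding set_lebesgue_integral_def
      using si(1)[OF A] nn by (subst nn_integral_eq_integral) (auto simp: set_integrable_def)
    finally show "emeasure (density lborel f) A = ennreal (LBINT s:A. f s)" .
    have "emeasure (density lborel f') A = (\<integral>\<^sup>+x. ennreal (indicator A x *\<^sub>R f' x) \<partial>lborel)"
      using A borel_measurable_integrable[OF ii(1)] borel_measurable_integrable[OF ii(2)]
      by (subst emeasure_density) (auto intro!: nn_integral_cong split: split_indicator)
    also have "\<dots> = ennreal (LBINT s:A. f' s)"
      unfolding set_lebesgue_integral_def
      using si(2)[OF A] nn by (subst nn_integral_eq_integral) (auto simp: set_integrable_def)
    finally show "emeasure (density lborel f') A = ennreal (LBINT s:A. f' s)" .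
  qed
  \<comment> \<open>The positive and negative parts of \<open>h\<close> are densities of finite
    measures; agreeing on all rays, these measures are equal.\<close>
  have eq: "density lborel f = density lborel f'"
  proof (rule measure_eqI_lessThan)
    fix x :: real
    have "(LBINT s:{x<..}. f s) - (LBINT s:{x<..}. f' s) = (LBINT s:{x<..}. f s - f' s)"
      using si by (subst set_integral_diff(2)) auto
    also have "\<dots> = (LBINT s:{x<..}. h s)"
      by (rule set_lebesgue_integral_cong) (auto simp: f_def f'_def max_def)
    finally have "(LBINT s:{x<..}. f s) = (LBINT s:{x<..}. f' s)" using z by simp
    then show "emeasure (density lborel f) {x<..} = emeasure (density lborel f') {x<..}"
      by (simp add: em)
    show "emeasure (density lborel f) {x<..} < \<infinity>"
      by (simp add: em)
  qed auto
  have "AE x in lborel. f x = f' x"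
  proof (rule density_unique_real[OF ii])
    fix A :: "real set" assume A: "A \<in> sets lborel"
    have "ennreal (LBINT s:A. f s) = ennreal (LBINT s:A. f' s)" using em[OF A] eq by simp
    moreover have "(LBINT s:A. f s) \<ge> 0" "(LBINT s:A. f' s) \<ge> 0"
      unfolding set_lebesgue_integral_def using nn by (auto intro!: integral_nonneg_AE)
    ultimately show "(LBINT s:A. f s) = (LBINT s:A. f' s)" by simp
  qed
  then show ?thesis by eventually_elim (auto simp: f_def f'_def max_def split: if_splits)
qed

lemma wderiv_on_unique_Icc:
  assumes "wderiv_on {a..b} f g" "wderiv_on {a..b} f g'"
  shows "AE x in lborel. x \<in> {a..b} \<longrightarrow> g x = g' x"
proof (cases "a \<le> b")
  case True
  define h where "h = (\<lambda>x. indicator {a..b} x *\<^sub>R (g x - g' x))"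
  have i: "set_integrable lborel {a..b} (\<lambda>x. g x - g' x)"
    using assms True unfolding wderiv_on_def by auto
  then have "integrable lborel h" unfolding h_def set_integrable_def .
  moreover have "(LBINT s:{x<..}. h s) = 0" for x
  proof -
    \<comment> \<open>The ray beyond \<open>x\<close> meets \<open>{a..b}\<close> in
      \<open>{y..b}\<close> up to the null set \<open>{x}\<close>, and there both \<open>g\<close>
      and \<open>g'\<close> integrate to the same difference of values of \<open>f\<close>.\<close>
    define y where "y = max a x"
    have "(LBINT s:{x<..}. h s) = (LBINT s:{y..b}. g s - g' s)"
      unfolding set_lebesgue_integral_def h_def
    proof (rule integral_cong_AE)
      have "AE t in lborel. t \<noteq> x" by (rule AE_lborel_singleton)
      then show "AE t in lborel. indicat_real {x<..} t *\<^sub>R indicat_real {a..b} t *\<^sub>R (g t - g' t) =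
                     indicat_real {y..b} t *\<^sub>R (g t - g' t)"
        by eventually_elim (auto simp: y_def split: split_indicator)
      have m: "(\<lambda>t. indicat_real {a..b} t *\<^sub>R (g t - g' t)) \<in> borel_measurable lborel"
        using i unfolding set_integrable_def by simp
      then show "(\<lambda>t. indicat_real {x<..} t *\<^sub>R indicat_real {a..b} t *\<^sub>R (g t - g' t)) \<in> borel_measurable lborel"
        by simp
      have "(\<lambda>t. indicat_real {y..b} t *\<^sub>R indicat_real {a..b} t *\<^sub>R (g t - g' t)) \<in> borel_measurable lborel"
        using m by simp
      also have "(\<lambda>t. indicat_real {y..b} t *\<^sub>R indicat_real {a..b} t *\<^sub>R (g t - g' t)) = (\<lambda>t. indicat_real {y..b} t *\<^sub>R (g t - g' t))"
        by (auto simp: y_def split: split_indicator)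
      finally show "(\<lambda>t. indicat_real {y..b} t *\<^sub>R (g t - g' t)) \<in> borel_measurable lborel" .
    qed
    also have "\<dots> = 0"
    proof (cases "y \<le> b")
      case True
      have "{y..b} \<subseteq> {a..b}" by (auto simp: y_def)
      then have "set_integrable lborel {y..b} g" "f b - f y = (LBINT s:{y..b}. g s)"
        "set_integrable lborel {y..b} g'" "f b - f y = (LBINT s:{y..b}. g' s)"
        using assms True unfolding wderiv_on_def by blast+
      then show ?thesis by simp
    qed (auto simp: set_lebesgue_integral_def)
    finally show ?thesis .
  qed
  ultimately have "AE x in lborel. h x = 0" by (rule integrable_eq_zero_if_Ioi_integrals_zero)
  then show ?thesis by eventually_elim (auto simp: h_def)
qed auto

lemma closed_interval_Int_Icc:
  fixes I :: "real set"
  assumes "closed I" "is_interval I"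
  shows "\<exists>a b. I \<inter> {- r..r} = {a..b}"
proof -
  have "compact (I \<inter> {- r..r})" using assms by (simp add: closed_Int_compact)
  moreover have "connected (I \<inter> {- r..r})"
    using assms by (metis is_interval_Int is_interval_cc is_interval_connected_1)
  ultimately show ?thesis using connected_compact_interval_1 by auto
qed

lemma wderiv_on_unique:
  assumes "wderiv_on I f g" "wderiv_on I f g'" "closed I" "is_interval I"
  shows "AE x in lborel. x \<in> I \<longrightarrow> g x = g' x"
proof -
  have "AE x in lborel. x \<in> I \<inter> {- real n..real n} \<longrightarrow> g x = g' x" for n
  proof -
    obtain a b where ab: "I \<inter> {- real n..real n} = {a..b}" using closed_interval_Int_Icc assms by blast
    then have "{a..b} \<subseteq> I" by auto
    then show ?thesis unfolding ab using wderiv_on_unique_Icc wderiv_on_subset assms by blast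
  qed
  then have "AE x in lborel. \<forall>n. x \<in> I \<inter> {- real n..real n} \<longrightarrow> g x = g' x"
    by (subst AE_all_countable) blast
  then show ?thesis
  proof eventually_elim
    case (elim x)
    obtain n where "\<bar>x\<bar> \<le> real n" using real_arch_simple by blast
    then have "x \<in> {- real n..real n}" by auto
    with elim show ?case by blast
  qed
qed

text \<open>Integrability of \<open>g\<close> is known on compact pieces only, so measurability on
  an unbounded interval comes from a pointwise limit of truncations.\<close>

lemma wderiv_on_measurable:
  assumes "wderiv_on I f g" "closed I" "is_interval I"
  shows "set_borel_measurable lborel I g"
  unfolding set_borel_measurable_def
proof (rule borel_measurable_LIMSEQ_metric)
  fix n :: nat
  obtain a b where ab: "I \<inter> {- real n..real n} = {a..b}" using closed_interval_Int_Icc assms by blast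
  then have "{a..b} \<subseteq> I" by auto
  then have "set_integrable lborel {a..b} g" 
    by (cases "a \<le> b") (use assms in \<open>auto simp: wderiv_on_def\<close>)
  then show "(\<lambda>x. indicator (I \<inter> {- real n..real n}) x *\<^sub>R g x) \<in> borel_measurable lborel"
    unfolding ab set_integrable_def by simp
next
  fix x :: real
  obtain N where N: "\<bar>x\<bar> \<le> real N" using real_arch_simple by blast
  have "\<forall>\<^sub>F n in sequentially. indicat_real (I \<inter> {- real n..real n}) x *\<^sub>R g x = indicat_real I x *\<^sub>R g x"
    unfolding eventually_sequentially
    by (rule exI[of _ N]) (use N in \<open>auto split: split_indicator\<close>)
  then show "(\<lambda>n. indicat_real (I \<inter> {- real n..real n}) x *\<^sub>R g x) \<longlonglongrightarrow> indicat_real I x *\<^sub>R g x"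
    by (rule tendsto_eventually)
qed

lemma continuous_on_set_borel_measurable:
  fixes f :: "real \<Rightarrow> real"
  assumes "continuous_on I f" "I \<in> sets borel"
  shows "set_borel_measurable lborel I f"
  using borel_measurable_continuous_on_indicator[OF assms(2,1)]
  unfolding set_borel_measurable_def by simp

lemma set_borel_measurable_compose:
  fixes f h :: "real \<Rightarrow> real"
  assumes "set_borel_measurable lborel I f" "h \<in> borel_measurable borel" "I \<in> sets borel"
  shows "set_borel_measurable lborel I (\<lambda>x. h (f x))"
proof -
  have [measurable]: "(\<lambda>x. indicator I x *\<^sub>R f x) \<in> borel_measurable borel" "h \<in> borel_measurable borel" "I \<in> sets borel"
    using assms unfolding set_borel_measurable_def by simp_all
  have m: "(\<lambda>x. h (indicator I x *\<^sub>R f x)) \<in> borel_measurable borel"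
    by (rule measurable_compose[of _ _ borel]) fact+
  have "(\<lambda>x. indicator I x *\<^sub>R h (indicator I x *\<^sub>R f x)) \<in> borel_measurable borel"
    by (rule borel_measurable_scaleR[OF borel_measurable_indicator m]) (use assms in simp)
  moreover have "(\<lambda>x. indicator I x *\<^sub>R h (indicator I x *\<^sub>R f x)) = (\<lambda>x. indicator I x *\<^sub>R h (f x) :: real)"
    by (auto split: split_indicator)
  ultimately show ?thesis unfolding set_borel_measurable_def by simp
qed

text \<open>\<open>dG\<close> and \<open>dR\<close> pick a weak derivative by Hilbert choice.
  Uniqueness almost everywhere makes the kinetic energy independent of that pick, so any explicit
  derivative may be used to compute it.\<close>

lemma wderiv_on_integral_square_eq:
  assumes "wderiv_on I f g" "wderiv_on I f g'" "closed I" "is_interval I"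
  shows "(LBINT x:I. (g x)\<^sup>2) = (LBINT x:I. (g' x)\<^sup>2)"
proof -
  have I: "I \<in> sets borel" using assms by auto
  have m: "(\<lambda>x. indicator I x *\<^sub>R (g x)\<^sup>2) \<in> borel_measurable lborel"
          "(\<lambda>x. indicator I x *\<^sub>R (g' x)\<^sup>2) \<in> borel_measurable lborel"
    using set_borel_measurable_compose[OF wderiv_on_measurable[OF assms(1,3,4)], of "\<lambda>x. x\<^sup>2"]
     set_borel_measurable_compose[OF wderiv_on_measurable[OF assms(2,3,4)], of "\<lambda>x. x\<^sup>2"] I
    unfolding set_borel_measurable_def by auto
  have ae: "AE x in lborel. indicator I x *\<^sub>R (g x)\<^sup>2 = indicator I x *\<^sub>R (g' x)\<^sup>2"
    using wderiv_on_unique[OF assms] by eventually_elim (auto split: split_indicator)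
  show "(LBINT x:I. (g x)\<^sup>2) = (LBINT x:I. (g' x)\<^sup>2)"
    unfolding set_lebesgue_integral_def by (rule integral_cong_AE[OF m ae])
qed

section \<open>The calibration inequality\<close>

lemma connected_image_Icc_contains:
  fixes f :: "real \<Rightarrow> real"
  assumes "continuous_on {x..y} f" "x \<le> y" "min (f x) (f y) \<le> t" "t \<le> max (f x) (f y)"
  obtains z where "z \<in> {x..y}" "f z = t"
proof -
  have "connected (f ` {x..y})" using assms(1) connected_continuous_image connected_Icc by blast
  moreover have "f x \<in> f ` {x..y}" "f y \<in> f ` {x..y}" using assms by auto
  ultimately have "t \<in> f ` {x..y}" 
    using assms(3,4) unfolding connected_iff_interval min_def max_def by (auto split: if_splits)
  then show thesis using that by auto
qed

lemma MVT_unordered: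
  fixes P P' :: "real \<Rightarrow> real"
  assumes "\<And>t. (P has_real_derivative P' t) (at t)"
  obtains z where "min u w \<le> z" "z \<le> max u w" "P w - P u = (w - u) * P' z"
proof -
  consider "u = w" | "u < w" | "w < u" by linarith
  then show thesis
  proof cases
    case 1 then show ?thesis using that[of u] by simp
  next
    case 2
    then show ?thesis using MVT2[of u w P P'] assms that by (metis max.absorb2 min.absorb1 less_imp_le)
  next
    case 3
    then obtain z where z: "z > w" "z < u" "P u - P w = (u - w) * P' z" using MVT2[of w u P P'] assms by blast
    then show ?thesis using 3 by (intro that[of z]) (auto simp: algebra_simps)
  qed
qed

text \<open>The Bogomolny-type bound \<open>(P \<circ> f)' = P'(f) f' \<le> f'\<^sup>2/2 + P'(f)\<^sup>2/2\<close>, in integrated form; bisection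
  avoids the chain rule for absolutely continuous functions.\<close>
lemma wderiv_on_compose_diff_le:
  assumes w: "wderiv_on {a..b} f g" and "a \<le> b"
    and g2: "set_integrable lborel {a..b} (\<lambda>x. (g x)\<^sup>2)"
    and P: "\<And>t. (P has_real_derivative P' t) (at t)"
    and H: "continuous_on UNIV H" and PH: "\<And>t. (P' t)\<^sup>2 \<le> 2 * H t"
  shows "P (f b) - P (f a) \<le> (LBINT x:{a..b}. (g x)\<^sup>2 / 2 + H (f x))"
proof -
  have cf: "continuous_on {a..b} f" by (rule wderiv_on_continuous_Icc[OF w])
  have cH: "continuous_on {a..b} (\<lambda>x. H (f x))"
    using continuous_on_compose2[OF H cf] by auto
  have int: "set_integrable lborel {x..y} (\<lambda>x. (g x)\<^sup>2 / 2 + H (f x))" 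
     "set_integrable lborel {x..y} (\<lambda>x. H (f x))" "set_integrable lborel {x..y} g"
     "set_integrable lborel {x..y} (\<lambda>x. (g x)\<^sup>2)" "f y - f x = (LBINT s:{x..y}. g s)"
    if "a \<le> x" "x \<le> y" "y \<le> b" for x y
  proof -
    have s: "{x..y} \<subseteq> {a..b}" using that by auto
    show 1: "set_integrable lborel {x..y} (\<lambda>x. H (f x))"
      by (rule borel_integrable_atLeastAtMost') (rule continuous_on_subset[OF cH s])
    show 2: "set_integrable lborel {x..y} (\<lambda>x. (g x)\<^sup>2)"
      by (rule set_integrable_subset[OF g2]) (use s in auto)
    show "set_integrable lborel {x..y} (\<lambda>x. (g x)\<^sup>2 / 2 + H (f x))"
      using 1 2 by auto
    show "set_integrable lborel {x..y} g" "f y - f x = (LBINT s:{x..y}. g s)"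
      using w s that unfolding wderiv_on_def by auto
  qed
  have "P (f b) - P (f a) \<le> (LBINT x:{a..b}. (g x)\<^sup>2 / 2 + H (f x)) + e * (b - a)" if e: "e > 0" for e
  proof -
    \<comment> \<open>With an error proportional to the length the claim is additive under
      concatenation, so bisection reduces it to intervals shrinking to a point.\<close>
    define R where "R = (\<lambda>x y. a \<le> x \<longrightarrow> x \<le> y \<longrightarrow> y \<le> b \<longrightarrow>
        P (f y) - P (f x) \<le> (LBINT x:{x..y}. (g x)\<^sup>2 / 2 + H (f x)) + e * (y - x))"
    have "R a b"
      using \<open>a \<le> b\<close>
    proof (induct rule: Bolzano)
      case (trans x y z)
      show ?case unfolding R_def
      proof (intro impI)
        assume *: "a \<le> x" "x \<le> z" "z \<le> b"
        have "(LBINT x:{x..z}. (g x)\<^sup>2 / 2 + H (f x)) =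
          (LBINT x:{x..y}. (g x)\<^sup>2 / 2 + H (f x)) + (LBINT x:{y..z}. (g x)\<^sup>2 / 2 + H (f x))"
          by (rule set_integral_Icc_split) (use * trans int in auto)
        then show "P (f z) - P (f x) \<le> (LBINT x:{x..z}. (g x)\<^sup>2 / 2 + H (f x)) + e * (z - x)"
          using * trans unfolding R_def by (auto simp: algebra_simps)
      qed
    next
      case (local x0)
      have "\<exists>d>0. \<forall>z\<in>{a..b}. dist z x0 < d \<longrightarrow> dist (H (f z)) (H (f x0)) < e / 2"
      proof -
        have "x0 \<in> {a..b}" "e / 2 > 0" using local e by auto
        then show ?thesis using cH unfolding continuous_on_iff by blast
      qed
      then obtain d where d: "d > 0" "\<And>z. z \<in> {a..b} \<Longrightarrow> \<bar>z - x0\<bar> < d \<Longrightarrow> \<bar>H (f z) - H (f x0)\<bar> < e / 2"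
        by (auto simp: dist_real_def)
      show ?case
      proof (intro exI[of _ d] conjI allI impI d(1))
        fix x y assume xy: "x \<le> x0 \<and> x0 \<le> y \<and> y - x < d"
        show "R x y" unfolding R_def
        proof (intro impI)
          assume *: "a \<le> x" "x \<le> y" "y \<le> b"
          \<comment> \<open>The mean value theorem is applied to \<open>P\<close>, not to the
            composition. The continuous \<open>f\<close> takes the intermediate value
            \<open>t\<close> at some \<open>z\<close> in \<open>{x..y}\<close>, hence
            \<open>H t\<close> is within \<open>e\<close> of every \<open>H (f s)\<close>.\<close>
          obtain t where t: "min (f x) (f y) \<le> t" "t \<le> max (f x) (f y)" "P (f y) - P (f x) = (f y - f x) * P' t"
            using MVT_unordered[OF P] by blast
          have "continuous_on {x..y} f" by (rule continuous_on_subset[OF cf]) (use * in auto)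
          then obtain z where z: "z \<in> {x..y}" "f z = t"
            using connected_image_Icc_contains *(2) t(1,2) by blast
          have near: "H t \<le> H (f s) + e" if "s \<in> {x..y}" for s
          proof -
            have "z \<in> {a..b}" "s \<in> {a..b}" "\<bar>z - x0\<bar> < d" "\<bar>s - x0\<bar> < d" using that z xy * by auto
            then have "\<bar>H t - H (f x0)\<bar> < e / 2" "\<bar>H (f s) - H (f x0)\<bar> < e / 2" using d(2) z(2) by blast+
            then show ?thesis by linarith
          qed
          note i = int[OF *]
          have "P (f y) - P (f x) = (LBINT s:{x..y}. g s * P' t)"
            unfolding t(3) i(5) by simp
          also have "\<dots> \<le> (LBINT s:{x..y}. ((g s)\<^sup>2 / 2 + H (f s)) + e)"
          proof (rule set_integral_mono)
            show "set_integrable lborel {x..y} (\<lambda>s. g s * P' t)" using i by auto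
            show "set_integrable lborel {x..y} (\<lambda>s. (g s)\<^sup>2 / 2 + H (f s) + e)"
              using i borel_integrable_atLeastAtMost'[of x y "\<lambda>_. e"] by auto
            fix s assume s: "s \<in> {x..y}"
            \<comment> \<open>Young's inequality; in the application its equality case is the
              first-order equation of the soliton, Q' = sqrt(2 F(Q)) up to sign.\<close>
            have "0 \<le> (g s - P' t)\<^sup>2" by simp
            then have "g s * P' t \<le> (g s)\<^sup>2 / 2 + (P' t)\<^sup>2 / 2" by (simp add: power2_diff)
            then show "g s * P' t \<le> (g s)\<^sup>2 / 2 + H (f s) + e" using near[OF s] PH[of t] by linarith
          qed
          also have "\<dots> = (LBINT s:{x..y}. ((g s)\<^sup>2 / 2 + H (f s))) + (LBINT s:{x..y}. e)"
            by (rule set_integral_add(2)) (use i borel_integrable_atLeastAtMost'[of x y "\<lambda>_. e"] in auto)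
          also have "(LBINT s:{x..y}. e) = e * (y - x)"
            using * by (simp add: set_lebesgue_integral_def)
          finally show "P (f y) - P (f x) \<le> (LBINT x:{x..y}. (g x)\<^sup>2 / 2 + H (f x)) + e * (y - x)" .
        qed
      qed
    qed
    then show ?thesis using \<open>a \<le> b\<close> unfolding R_def by simp
  qed
  note * = this
  show ?thesis
  proof (rule field_le_epsilon)
    fix e :: real assume e: "e > 0"
    \<comment> \<open>The denominator \<open>b - a + 1\<close> instead of \<open>b - a\<close>
      covers the degenerate interval \<open>a = b\<close>.\<close>
    have "e / (b - a + 1) * (b - a) \<le> e" using e \<open>a \<le> b\<close> by (simp add: field_simps)
    then show "P (f b) - P (f a) \<le> (LBINT x:{a..b}. (g x)\<^sup>2 / 2 + H (f x)) + e"
      using *[of "e / (b - a + 1)"] e \<open>a \<le> b\<close> by (smt (verit) divide_pos_pos)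
  qed
qed

section \<open>H^1 functions on an interval: bounds, integrability and decay\<close>

definition h1_on :: "real set \<Rightarrow> (real \<Rightarrow> real) \<Rightarrow> (real \<Rightarrow> real) \<Rightarrow> bool" where
  "h1_on I f g \<longleftrightarrow> wderiv_on I f g \<and> set_integrable lborel I (\<lambda>x. (g x)\<^sup>2) \<and> set_integrable lborel I (\<lambda>x. (f x)\<^sup>2)"

lemma h1_on_subset: "h1_on I f g \<Longrightarrow> J \<subseteq> I \<Longrightarrow> J \<in> sets borel \<Longrightarrow> h1_on J f g"
  unfolding h1_on_def using wderiv_on_subset set_integrable_subset[of lborel I _ J] by auto

lemma set_integral_mono_set:
  fixes f :: "real \<Rightarrow> real"
  assumes "set_integrable lborel I f" "J \<subseteq> I" "J \<in> sets borel" "\<And>x. x \<in> I \<Longrightarrow> 0 \<le> f x"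
  shows "(LBINT x:J. f x) \<le> (LBINT x:I. f x)"
proof -
  have "set_integrable lborel J f" by (rule set_integrable_subset[OF assms(1)]) (use assms in auto)
  with assms show ?thesis 
    unfolding set_lebesgue_integral_def set_integrable_def
    by (intro integral_mono) (auto split: split_indicator)
qed

text \<open>On an interval of length 1 the average of f^2 is its integral, and the calibration
  inequality with P(t) = t^2 and P(t) = -t^2 bounds the oscillation of f^2. Since (2 t)^2 = 2 (2
  t^2), one may take H(t) = 2 t^2; adding the average gives the factor 3 = 2 + 1.\<close>

lemma h1_on_square_le:
  assumes h: "h1_on {a..a+1} f g" and x: "x \<in> {a..a+1}"
  shows "(f x)\<^sup>2 \<le> (LBINT t:{a..a+1}. (g t)\<^sup>2 / 2 + 3 * (f t)\<^sup>2)"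
proof -
  let ?C = "LBINT t:{a..a+1}. (g t)\<^sup>2 / 2 + 2 * (f t)\<^sup>2"
  have i: "set_integrable lborel {a..a+1} (\<lambda>x. (g x)\<^sup>2)" "set_integrable lborel {a..a+1} (\<lambda>x. (f x)\<^sup>2)"
    using h by (auto simp: h1_on_def)
  have le: "\<bar>(f s)\<^sup>2 - (f t)\<^sup>2\<bar> \<le> ?C" if "a \<le> s" "s \<le> t" "t \<le> a+1" for s t
  proof -
    have sub: "{s..t} \<subseteq> {a..a+1}" using that by auto
    have w: "wderiv_on {s..t} f g" "set_integrable lborel {s..t} (\<lambda>x. (g x)\<^sup>2)"
      using h1_on_subset[OF h sub] unfolding h1_on_def by auto
    have "(f t)\<^sup>2 - (f s)\<^sup>2 \<le> (LBINT x:{s..t}. (g x)\<^sup>2 / 2 + 2 * (f x)\<^sup>2)"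
      by (rule wderiv_on_compose_diff_le[OF w(1) that(2) w(2), of "\<lambda>x. x\<^sup>2" "\<lambda>x. 2 * x" "\<lambda>x. 2 * x\<^sup>2"])
         (auto intro!: derivative_eq_intros continuous_intros simp: power_mult_distrib)
    moreover have "- (f t)\<^sup>2 - - (f s)\<^sup>2 \<le> (LBINT x:{s..t}. (g x)\<^sup>2 / 2 + 2 * (f x)\<^sup>2)"
      by (rule wderiv_on_compose_diff_le[OF w(1) that(2) w(2), of "\<lambda>x. -(x\<^sup>2)" "\<lambda>x. - (2 * x)" "\<lambda>x. 2 * x\<^sup>2"])
         (auto intro!: derivative_eq_intros continuous_intros simp: power_mult_distrib)
    moreover have "(LBINT x:{s..t}. (g x)\<^sup>2 / 2 + 2 * (f x)\<^sup>2) \<le> ?C"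
      by (rule set_integral_mono_set) (use i sub in auto)
    ultimately show ?thesis by (auto simp: abs_le_iff)
  qed
  have "(f x)\<^sup>2 \<le> (f t)\<^sup>2 + ?C" if "t \<in> {a..a+1}" for t
    using le[of x t] le[of t x] x that by (cases "x \<le> t") (auto simp: abs_le_iff)
  then have "(LBINT t:{a..a+1}. (f x)\<^sup>2) \<le> (LBINT t:{a..a+1}. (f t)\<^sup>2 + ?C)"
    by (intro set_integral_mono set_integral_add(1) i(2) borel_integrable_atLeastAtMost') auto
  also have "\<dots> = (LBINT t:{a..a+1}. (f t)\<^sup>2) + (LBINT t:{a..a+1}. ?C)"
    by (intro set_integral_add(2) i(2) borel_integrable_atLeastAtMost') auto
  also have "\<dots> = (LBINT t:{a..a+1}. (f t)\<^sup>2) + ?C" by (simp add: set_lebesgue_integral_def)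
  also have "\<dots> = (LBINT t:{a..a+1}. (f t)\<^sup>2 + ((g t)\<^sup>2 / 2 + 2 * (f t)\<^sup>2))"
    using i by (intro set_integral_add(2)[symmetric]) auto
  finally show ?thesis by (simp add: set_lebesgue_integral_def algebra_simps)
qed

text \<open>The bound on a unit interval is dominated by the same integral over all of
  \<open>I\<close>, hence uniform. The line and half-lines supply such intervals; bounded edges,
  which may be shorter than 1, are handled by compactness in
  \<open>powr_integrable_edge\<close>.\<close>

lemma h1_on_bounded:
  assumes h: "h1_on I f g" and I: "\<And>x. x \<in> I \<Longrightarrow> \<exists>a. x \<in> {a..a+1} \<and> {a..a+1} \<subseteq> I"
  shows "\<exists>B. \<forall>x\<in>I. \<bar>f x\<bar> \<le> B"
proof (intro exI ballI)
  fix x assume "x \<in> I"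
  then obtain a where a: "x \<in> {a..a+1}" "{a..a+1} \<subseteq> I" using I by blast
  have "(f x)\<^sup>2 \<le> (LBINT t:{a..a+1}. (g t)\<^sup>2 / 2 + 3 * (f t)\<^sup>2)"
    by (rule h1_on_square_le[OF h1_on_subset[OF h a(2)] a(1)]) simp
  also have "\<dots> \<le> (LBINT t:I. (g t)\<^sup>2 / 2 + 3 * (f t)\<^sup>2)"
    by (rule set_integral_mono_set) (use h a in \<open>auto simp: h1_on_def\<close>)
  finally show "\<bar>f x\<bar> \<le> sqrt (LBINT t:I. (g t)\<^sup>2 / 2 + 3 * (f t)\<^sup>2)"
    using real_le_rsqrt by (metis abs_ge_zero power2_abs)
qed

lemma h1_on_powr_integrable:
  assumes h: "h1_on I f g" and B: "\<And>x. x \<in> I \<Longrightarrow> \<bar>f x\<bar> \<le> B" and I: "closed I" "is_interval I" and p: "2 \<le> p"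
  shows "set_integrable lborel I (\<lambda>x. \<bar>f x\<bar> powr p)"
proof (rule set_integrable_bound)
  show "set_integrable lborel I (\<lambda>x. B powr (p - 2) * (f x)\<^sup>2)"
    using h unfolding h1_on_def by auto
  have "continuous_on I f" using h wderiv_on_continuous I unfolding h1_on_def by blast
  then have "set_borel_measurable lborel I f" using continuous_on_set_borel_measurable I by auto
  then show "set_borel_measurable lborel I (\<lambda>x. \<bar>f x\<bar> powr p)"
    using set_borel_measurable_compose[of I f "\<lambda>x. \<bar>x\<bar> powr p"] I by auto
  have "\<bar>f x\<bar> powr p \<le> B powr (p - 2) * (f x)\<^sup>2" if "x \<in> I" for x
  proof (cases "f x = 0")
    case False
    then have "\<bar>f x\<bar> powr p = \<bar>f x\<bar> powr (p - 2) * \<bar>f x\<bar> powr 2" by (metis add.commute diff_add_cancel powr_add)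
    also have "\<bar>f x\<bar> powr 2 = (f x)\<^sup>2" using False by (simp add: powr_numeral)
    finally show ?thesis using B[OF that] p by (auto intro!: mult_right_mono powr_mono2)
  qed (use p in auto)
  then show "AE x in lborel. x \<in> I \<longrightarrow> norm (\<bar>f x\<bar> powr p) \<le> norm (B powr (p - 2) * (f x)\<^sup>2)"
    by (auto simp: abs_mult)
qed

text \<open>The integral over \<open>{b..b+1}\<close> that controls the square of \<open>f b\<close>
  is a difference of two integrals with the same limit.\<close>

lemma h1_on_tendsto_0:
  assumes h: "h1_on {c..} f g"
  shows "(f \<longlongrightarrow> 0) at_top"
proof -
  let ?q = "\<lambda>t. (g t)\<^sup>2 / 2 + 3 * (f t)\<^sup>2"
  have i: "set_integrable lborel {c..} ?q" using h unfolding h1_on_def by auto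
  have lim: "((\<lambda>b. LBINT t:{c..b}. ?q t) \<longlongrightarrow> (LBINT t:{c..}. ?q t)) at_top"
    by (rule tendsto_set_lebesgue_integral_at_top[OF _ i]) auto
  have sh: "filterlim (\<lambda>b::real. b + 1) at_top at_top"
    using filterlim_tendsto_add_at_top[OF tendsto_const[of 1] filterlim_ident] by (simp add: add.commute)
  have "((\<lambda>b. LBINT t:{c..b+1}. ?q t) \<longlongrightarrow> (LBINT t:{c..}. ?q t)) at_top"
    by (rule filterlim_compose[OF lim sh])
  from tendsto_diff[OF this lim]
  have lim0: "((\<lambda>b. (LBINT t:{c..b+1}. ?q t) - (LBINT t:{c..b}. ?q t)) \<longlongrightarrow> 0) at_top" by simp
  have "((\<lambda>b. (f b)\<^sup>2) \<longlongrightarrow> 0) at_top"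
  proof (rule tendsto_sandwich[OF _ _ tendsto_const lim0])
    show "\<forall>\<^sub>F b in at_top. (f b)\<^sup>2 \<le> (LBINT t:{c..b+1}. ?q t) - (LBINT t:{c..b}. ?q t)"
      using eventually_ge_at_top[of c]
    proof eventually_elim
      case (elim b)
      have "(f b)\<^sup>2 \<le> (LBINT t:{b..b+1}. ?q t)"
        by (rule h1_on_square_le[OF h1_on_subset[OF h]]) (use elim in auto)
      moreover have "set_integrable lborel {c..b+1} ?q"
        by (rule set_integrable_subset[OF i]) auto
      ultimately show ?case using set_integral_Icc_split[of c "b+1" ?q b] elim by simp
    qed
  qed simp
  then have "((\<lambda>b. sqrt ((f b)\<^sup>2)) \<longlongrightarrow> sqrt 0) at_top" by (rule tendsto_real_sqrt)
  then show ?thesis by (simp add: tendsto_rabs_zero_iff)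
qed

text \<open>The finite set \<open>S\<close> collects kinks: tents and truncated solitons fail to be
  differentiable at a few points, which the fundamental theorem of calculus tolerates for a
  continuous function.\<close>

lemma piecewise_C1_wderiv_on:
  assumes I: "is_interval I" and S: "finite S" and f: "continuous_on I f"
    and d: "\<And>x. x \<in> I - S \<Longrightarrow> (f has_real_derivative g x) (at x)"
    and g: "g \<in> borel_measurable borel" and b: "\<And>a b. \<exists>B. \<forall>x\<in>{a..b}. \<bar>g x\<bar> \<le> B"
  shows "wderiv_on I f g"
  unfolding wderiv_on_def
proof (intro allI impI)
  fix a b assume ab: "a \<le> b" "{a..b} \<subseteq> I"
  obtain B where B: "\<And>x. x \<in> {a..b} \<Longrightarrow> \<bar>g x\<bar> \<le> B" using assms(6)[of a b] by blast
  have i: "set_integrable lborel {a..b} g"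
  proof (rule set_integrable_bound)
    show "set_integrable lborel {a..b} (\<lambda>_. B)" by (rule borel_integrable_atLeastAtMost') auto
    show "set_borel_measurable lborel {a..b} g" using g unfolding set_borel_measurable_def by auto
    show "AE x in lborel. x \<in> {a..b} \<longrightarrow> norm (g x) \<le> norm B" using B by (intro AE_I2) force
  qed
  have "(g has_integral (f b - f a)) {a..b}"
  proof (rule fundamental_theorem_of_calculus_interior_strong[OF S ab(1)])
    show "continuous_on {a..b} f" using f ab continuous_on_subset by blast
    fix x assume "x \<in> {a<..<b} - S"
    then have "x \<in> I - S" using ab by auto
    then show "(f has_vector_derivative g x) (at x)" using d has_real_derivative_iff_has_vector_derivative by blast
  qed
  then have "f b - f a = (LBINT s:{a..b}. g s)"
    using set_borel_integral_eq_integral(2)[OF i] by (simp add: integral_unique)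
  with i show "set_integrable lborel {a..b} g \<and> f b - f a = (LBINT s:{a..b}. g s)" by simp
qed

lemma continuous_antiderivative:
  fixes k :: "real \<Rightarrow> real"
  assumes "continuous_on UNIV k"
  obtains K where "\<And>x. (K has_real_derivative k x) (at x)"
proof -
  have "\<exists>K. \<forall>x::real. - \<infinity> < ereal x \<longrightarrow> ereal x < \<infinity> \<longrightarrow> (K has_vector_derivative k x) (at x)"
    by (rule einterval_antiderivative) (use assms in \<open>auto simp: continuous_on_eq_continuous_at\<close>)
  then show thesis using that unfolding has_real_derivative_iff_has_vector_derivative by auto
qed

section \<open>The soliton profiles\<close>

text \<open>The sech soliton as a negative power of cosh. On the zero level of the first integral,
  which decay at infinity selects, w = Q^(-(p-2)/2) solves the linear equation w'' = ((p-2) a/2)^2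
  w. Its even solution is a multiple of cosh, and the amplitude sqrt(2/p)/a puts it on that
  level.\<close>

definition prof :: "real \<Rightarrow> real \<Rightarrow> real \<Rightarrow> real" where
  "prof p a x = (sqrt (2 / p) / a * cosh ((p - 2) / 2 * a * x)) powr (- 2 / (p - 2))"

definition dprof :: "real \<Rightarrow> real \<Rightarrow> real \<Rightarrow> real" where
  "dprof p a x = - a * tanh ((p - 2) / 2 * a * x) * prof p a x"

lemma prof_pos: "2 < p \<Longrightarrow> 0 < a \<Longrightarrow> 0 < prof p a x"
  unfolding prof_def using cosh_real_pos[of "(p - 2) / 2 * a * x"]
  by (metis divide_pos_pos less_trans mult_pos_pos powr_gt_zero real_sqrt_gt_zero zero_less_numeral less_irrefl)

lemma prof_even: "prof p a (- x) = prof p a x"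
  unfolding prof_def by simp

lemma prof_base_pos: "2 < p \<Longrightarrow> 0 < a \<Longrightarrow> 0 < sqrt (2 / p) / a * cosh ((p - 2) / 2 * a * x)"
  using cosh_real_pos[of "(p - 2) / 2 * a * x"] by (intro mult_pos_pos divide_pos_pos) auto

lemma prof_powr:
  assumes "2 < p" "0 < a"
  shows "prof p a x powr (p - 2) = p / 2 * a\<^sup>2 / (cosh ((p - 2) / 2 * a * x))\<^sup>2"
proof -
  let ?b = "sqrt (2 / p) / a * cosh ((p - 2) / 2 * a * x)"
  have b: "?b > 0" using prof_base_pos assms by blast
  have "prof p a x powr (p - 2) = ?b powr (- 2)"
  proof -
    have "- 2 / (p - 2) * (p - 2) = - 2"
      using nonzero_eq_divide_eq[of "p - 2" "- 2 / (p - 2)" "- 2"] assms by simp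
    then show ?thesis unfolding prof_def powr_powr by (simp only:)
  qed
  also have "\<dots> = 1 / ?b\<^sup>2" using b by (simp add: powr_minus powr_numeral inverse_eq_divide)
  also have "\<dots> = p / 2 * a\<^sup>2 / (cosh ((p - 2) / 2 * a * x))\<^sup>2"
    using assms by (simp add: power_mult_distrib power_divide)
  finally show ?thesis .
qed

lemma prof_powr_p:
  assumes "2 < p" "0 < a"
  shows "prof p a x powr p = (prof p a x)\<^sup>2 * (p / 2 * a\<^sup>2 / (cosh ((p - 2) / 2 * a * x))\<^sup>2)"
    and "prof p a x powr (p - 1) = prof p a x * (p / 2 * a\<^sup>2 / (cosh ((p - 2) / 2 * a * x))\<^sup>2)"
proof -
  have pos: "prof p a x > 0" using prof_pos assms by blast
  have "prof p a x powr p = prof p a x powr 2 * prof p a x powr (p - 2)"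
    by (simp flip: powr_add)
  then show "prof p a x powr p = (prof p a x)\<^sup>2 * (p / 2 * a\<^sup>2 / (cosh ((p - 2) / 2 * a * x))\<^sup>2)"
    using pos prof_powr[OF assms] by (simp add: powr_numeral)
  have "prof p a x powr (p - 1) = prof p a x powr 1 * prof p a x powr (p - 2)"
    unfolding powr_add[symmetric] by simp
  then show "prof p a x powr (p - 1) = prof p a x * (p / 2 * a\<^sup>2 / (cosh ((p - 2) / 2 * a * x))\<^sup>2)"
    using pos prof_powr[OF assms] by simp
qed

lemma tanh_square_real: "(tanh x)\<^sup>2 = 1 - 1 / (cosh x)\<^sup>2" for x :: real
proof -
  have "cosh x \<noteq> 0" by (metis cosh_real_pos less_irrefl)
  then have "1 - 1 / (cosh x)\<^sup>2 = ((cosh x)\<^sup>2 - 1) / (cosh x)\<^sup>2" by (simp add: diff_divide_distrib)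
  then show ?thesis using cosh_square_eq[of x] by (simp add: tanh_def power_divide)
qed

text \<open>This is the first integral of the stationary equation at level zero. It supplies the
  equality case of the calibration and, integrated, one of the two relations among the three
  integrals of the profile.\<close>

lemma dprof_square:
  assumes "2 < p" "0 < a"
  shows "(dprof p a x)\<^sup>2 = a\<^sup>2 * (prof p a x)\<^sup>2 - 2 / p * prof p a x powr p"
  unfolding dprof_def prof_powr_p[OF assms] power_mult_distrib tanh_square_real
  using assms by (simp add: algebra_simps)

lemma prof_deriv:
  assumes "2 < p" "0 < a"
  shows "(prof p a has_real_derivative dprof p a x) (at x)"
proof -
  let ?k = "(p - 2) / 2 * a"
  let ?b = "\<lambda>x. sqrt (2 / p) / a * cosh (?k * x)"
  have b: "?b x > 0" using prof_base_pos assms by blast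
  have c: "cosh (?k * x) \<noteq> 0" by (metis cosh_real_pos less_irrefl)
  have 1: "(?b has_real_derivative sqrt (2 / p) / a * (sinh (?k * x) * ?k)) (at x)"
    by (auto intro!: derivative_eq_intros)
  have 2: "((\<lambda>x. ?b x powr (- 2 / (p - 2))) has_real_derivative
     (- 2 / (p - 2)) * ?b x powr (- 2 / (p - 2) - of_nat 1) * (sqrt (2 / p) / a * (sinh (?k * x) * ?k))) (at x)"
    by (rule DERIV_fun_powr[OF 1 b])
  have 3: "?b x powr (- 2 / (p - 2)) = ?b x powr (- 2 / (p - 2) - of_nat 1) * ?b x"
  proof -
    have "y powr r = y powr (r - of_nat 1) * y" if "y > 0" for y r :: real using that by (simp add: powr_diff)
    from this[OF b] show ?thesis .
  qed
  have "(- 2 / (p - 2)) * ?b x powr (- 2 / (p - 2) - of_nat 1) * (sqrt (2 / p) / a * (sinh (?k * x) * ?k))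
     = dprof p a x"
    unfolding dprof_def prof_def 3 tanh_def using assms c by (simp add: field_simps)
  with 2 show ?thesis unfolding prof_def[abs_def] by simp
qed

lemma dprof_deriv:
  assumes "2 < p" "0 < a"
  shows "(dprof p a has_real_derivative (a\<^sup>2 * prof p a x - prof p a x powr (p - 1))) (at x)"
proof -
  let ?k = "(p - 2) / 2 * a"
  have c: "cosh (?k * x) \<noteq> 0" by (metis cosh_real_pos less_irrefl)
  have t: "((\<lambda>x. tanh (?k * x)) has_real_derivative (1 - (tanh (?k * x))\<^sup>2) * ?k) (at x)"
    using c by (auto intro!: derivative_eq_intros)
  have dprof_fun: "dprof p a = (\<lambda>x. - a * tanh (?k * x) * prof p a x)" by (simp add: dprof_def fun_eq_iff)
  have "(dprof p a has_real_derivative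
     (- a * ((1 - (tanh (?k * x))\<^sup>2) * ?k) * prof p a x + - a * tanh (?k * x) * dprof p a x)) (at x)"
    unfolding dprof_fun
    using t prof_deriv[OF assms] by (auto intro!: derivative_eq_intros simp: dprof_def)
  also have "(- a * ((1 - (tanh (?k * x))\<^sup>2) * ?k) * prof p a x + - a * tanh (?k * x) * dprof p a x)
    = (a * (tanh (?k * x))\<^sup>2 - (1 - (tanh (?k * x))\<^sup>2) * ?k) * a * prof p a x"
  proof -
    have "- a * ((1 - t\<^sup>2) * k) * q + - a * t * (- a * t * q) = (a * t\<^sup>2 - (1 - t\<^sup>2) * k) * a * q" for t k q
      by (simp add: power2_eq_square algebra_simps)
    then show ?thesis unfolding dprof_def .
  qed
  also have "\<dots> = a\<^sup>2 * prof p a x - prof p a x powr (p - 1)"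
    unfolding prof_powr_p[OF assms] tanh_square_real using c
    by (simp add: power2_eq_square field_simps)
  finally show ?thesis .
qed

section \<open>Monotonicity and decay of the profile\<close>

lemma prof_less_iff:
  assumes "2 < p" "0 < a"
  shows "prof p a x < prof p a y \<longleftrightarrow> \<bar>y\<bar> < \<bar>x\<bar>"
proof -
  have less: "prof p a x < prof p a y" if "\<bar>y\<bar> < \<bar>x\<bar>" for x y
  proof -
    have k: "(p - 2) / 2 * a > 0" using assms by simp
    have "(p - 2) / 2 * a * \<bar>y\<bar> < (p - 2) / 2 * a * \<bar>x\<bar>" 
      by (rule mult_strict_left_mono[OF that k])
    then have "\<bar>(p - 2) / 2 * a * y\<bar> < \<bar>(p - 2) / 2 * a * x\<bar>" 
      using abs_of_pos[OF k] by (simp only: abs_mult[of "(p - 2) / 2 * a"])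
    then have "cosh ((p - 2) / 2 * a * y) < cosh ((p - 2) / 2 * a * x)"
      by (metis cosh_real_abs cosh_real_nonneg_less_iff abs_ge_zero)
    then show ?thesis unfolding prof_def
      by (intro powr_less_mono2_neg prof_base_pos assms mult_strict_left_mono) (use assms in auto)
  qed
  have eq: "prof p a x = prof p a y" if "\<bar>x\<bar> = \<bar>y\<bar>"
    using that prof_even by (metis abs_eq_iff)
  show ?thesis using less[of x y] less[of y x] eq by linarith
qed

lemma prof_eq_iff: "2 < p \<Longrightarrow> 0 < a \<Longrightarrow> prof p a x = prof p a y \<longleftrightarrow> \<bar>x\<bar> = \<bar>y\<bar>"
  using prof_less_iff[of p a x y] prof_less_iff[of p a y x] by linarith

lemma prof_le_iff: "2 < p \<Longrightarrow> 0 < a \<Longrightarrow> prof p a x \<le> prof p a y \<longleftrightarrow> \<bar>y\<bar> \<le> \<bar>x\<bar>"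
  using prof_less_iff[of p a y x] by linarith

text \<open>Since cosh z is at least exp |z| / 2 and the power is negative, the growth rate (p-2)
  a/2 of cosh is multiplied by 2/(p-2) and becomes the decay rate \<open>a\<close>.\<close>

lemma prof_le_exp:
  assumes "2 < p" "0 < a"
  shows "prof p a x \<le> (sqrt (2 / p) / (2 * a)) powr (- 2 / (p - 2)) * exp (- a * \<bar>x\<bar>)"
proof -
  let ?z = "(p - 2) / 2 * a * x"
  have z: "\<bar>?z\<bar> = (p - 2) / 2 * a * \<bar>x\<bar>" using assms by (simp add: abs_mult)
  have "exp \<bar>?z\<bar> / 2 \<le> cosh ?z" by (auto simp: cosh_def abs_if)
  then have "sqrt (2 / p) / a * (exp \<bar>?z\<bar> / 2) \<le> sqrt (2 / p) / a * cosh ?z"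
    using assms by (intro mult_left_mono) auto
  then have "prof p a x \<le> (sqrt (2 / p) / a * (exp \<bar>?z\<bar> / 2)) powr (- 2 / (p - 2))"
    unfolding prof_def using assms by (intro powr_mono2') auto
  also have "\<dots> = (sqrt (2 / p) / (2 * a)) powr (- 2 / (p - 2)) * exp \<bar>?z\<bar> powr (- 2 / (p - 2))"
    by (subst powr_mult[symmetric]) (use assms in \<open>auto simp: field_simps\<close>)
  also have "exp \<bar>?z\<bar> powr (- 2 / (p - 2)) = exp (- a * \<bar>x\<bar>)"
    unfolding z powr_def using assms by (simp add: field_simps)
  finally show ?thesis .
qed

lemma integrable_exp_neg_abs:
  assumes "0 < b"
  shows "integrable lborel (\<lambda>x::real. exp (- b * \<bar>x\<bar>))"
proof -
  have "set_integrable lebesgue {0..} (\<lambda>x::real. exp (- b * x))"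
    by (rule nonnegative_absolutely_integrable_1) (use assms integrable_on_exp_minus_to_infinity in auto)
  then have 1: "integrable lborel (\<lambda>x::real. indicator {0..} x * exp (- b * x))"
    unfolding set_integrable_def by (subst (asm) integrable_completion) auto
  have "integrable lborel (\<lambda>x::real. indicator {0..} (0 + - 1 * x) * exp (- b * (0 + - 1 * x)))"
    by (rule lborel_integrable_real_affine[OF 1]) simp
  from Bochner_Integration.integrable_add[OF 1 this]
  show ?thesis
    by (rule Bochner_Integration.integrable_bound) (auto split: split_indicator)
qed

lemma dprof_abs_le: "2 < p \<Longrightarrow> 0 < a \<Longrightarrow> \<bar>dprof p a x\<bar> \<le> a * prof p a x"
  unfolding dprof_def abs_mult using prof_pos[of p a x] tanh_real_bounds[of "(p - 2) / 2 * a * x"]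
  by (auto intro!: mult_right_mono simp: abs_le_iff less_imp_le)

lemma continuous_prof: "2 < p \<Longrightarrow> 0 < a \<Longrightarrow> continuous_on S (prof p a)"
  using prof_deriv by (meson DERIV_isCont continuous_at_imp_continuous_on)

lemma continuous_dprof: "2 < p \<Longrightarrow> 0 < a \<Longrightarrow> continuous_on S (dprof p a)"
  using dprof_deriv by (meson DERIV_isCont continuous_at_imp_continuous_on)

lemma prof_borel_measurable: "2 < p \<Longrightarrow> 0 < a \<Longrightarrow> prof p a \<in> borel_measurable borel"
   "2 < p \<Longrightarrow> 0 < a \<Longrightarrow> dprof p a \<in> borel_measurable borel"
  using continuous_prof continuous_dprof borel_measurable_continuous_onI by blast+

lemma prof_tendsto_0:
  assumes "2 < p" "0 < a"
  shows "(prof p a \<longlongrightarrow> 0) at_top" "(prof p a \<longlongrightarrow> 0) at_bot"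
proof -
  let ?C = "(sqrt (2 / p) / (2 * a)) powr (- 2 / (p - 2))"
  show "(prof p a \<longlongrightarrow> 0) at_top"
  proof (rule tendsto_sandwich[OF _ _ tendsto_const])
    show "\<forall>\<^sub>F x in at_top. 0 \<le> prof p a x" using prof_pos[OF assms] by (auto intro!: always_eventually less_imp_le)
    show "\<forall>\<^sub>F x in at_top. prof p a x \<le> ?C * exp (- a * \<bar>x\<bar>)" using prof_le_exp[OF assms] by (auto intro!: always_eventually)
    have "filterlim (\<lambda>x. - a * x) at_bot at_top"
      by (rule filterlim_tendsto_neg_mult_at_bot[OF tendsto_const _ filterlim_ident]) (use assms in simp)
    then have "((\<lambda>x. ?C * exp (- a * x)) \<longlongrightarrow> 0) at_top"
      by (intro tendsto_mult_right_zero filterlim_compose[OF exp_at_bot])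
    moreover have "\<forall>\<^sub>F x in at_top. ?C * exp (- a * x) = ?C * exp (- a * \<bar>x\<bar>)"
      using eventually_ge_at_top[of 0] by eventually_elim simp
    ultimately show "((\<lambda>x. ?C * exp (- a * \<bar>x\<bar>)) \<longlongrightarrow> 0) at_top" by (rule Lim_transform_eventually)
  qed
  then have "((\<lambda>x. prof p a (- x)) \<longlongrightarrow> 0) at_bot"
    by (rule filterlim_compose) (rule filterlim_uminus_at_top_at_bot)
  then show "(prof p a \<longlongrightarrow> 0) at_bot" by (simp add: prof_even)
qed

lemma dprof_tendsto_0:
  assumes "2 < p" "0 < a"
  shows "(dprof p a \<longlongrightarrow> 0) at_top" "(dprof p a \<longlongrightarrow> 0) at_bot"
  using prof_tendsto_0[OF assms, THEN tendsto_mult_right_zero, of a] 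
  by (auto intro!: Lim_null_comparison[of "dprof p a" "\<lambda>x. a * prof p a x"] always_eventually
       simp: dprof_abs_le assms)

lemma integrable_prof:
  assumes "2 < p" "0 < a"
  shows "integrable lborel (\<lambda>x. (prof p a x)\<^sup>2)" "integrable lborel (\<lambda>x. (dprof p a x)\<^sup>2)"
    "integrable lborel (\<lambda>x. prof p a x powr p)"
proof -
  note [measurable] = prof_borel_measurable[OF assms]
  let ?C = "(sqrt (2 / p) / (2 * a)) powr (- 2 / (p - 2))"
  have i: "integrable lborel (\<lambda>x. ?C\<^sup>2 * exp (- (2 * a) * \<bar>x\<bar>))"
    using integrable_exp_neg_abs[of "2 * a"] assms by auto
  have b: "(prof p a x)\<^sup>2 \<le> ?C\<^sup>2 * exp (- (2 * a) * \<bar>x\<bar>)" for x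
  proof -
    have "(prof p a x)\<^sup>2 \<le> (?C * exp (- a * \<bar>x\<bar>))\<^sup>2"
      by (rule power_mono[OF prof_le_exp[OF assms]]) (use prof_pos[OF assms] less_imp_le in blast)
    also have "\<dots> = ?C\<^sup>2 * exp (- (2 * a) * \<bar>x\<bar>)"
      by (simp add: power_mult_distrib flip: exp_double)
    finally show ?thesis .
  qed
  show 1: "integrable lborel (\<lambda>x. (prof p a x)\<^sup>2)"
    by (rule Bochner_Integration.integrable_bound[OF i]) (use b in auto)
  have "integrable lborel (\<lambda>x. a\<^sup>2 * (prof p a x)\<^sup>2)" using 1 by auto
  then show "integrable lborel (\<lambda>x. (dprof p a x)\<^sup>2)"
  proof (rule Bochner_Integration.integrable_bound)
    show "AE x in lborel. norm ((dprof p a x)\<^sup>2) \<le> norm (a\<^sup>2 * (prof p a x)\<^sup>2)"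
      using dprof_abs_le[OF assms] by (intro AE_I2) (metis (no_types) abs_ge_zero norm_ge_zero power2_abs power_mono power_mult_distrib real_norm_def abs_of_nonneg zero_le_power2)
  qed simp
  have "integrable lborel (\<lambda>x. p / 2 * a\<^sup>2 * (prof p a x)\<^sup>2)" using 1 by auto
  then show "integrable lborel (\<lambda>x. prof p a x powr p)"
  proof (rule Bochner_Integration.integrable_bound)
    have "prof p a x powr p \<le> p / 2 * a\<^sup>2 * (prof p a x)\<^sup>2" for x
    proof -
      have c: "1 \<le> (cosh ((p - 2) / 2 * a * x))\<^sup>2" using cosh_real_ge_1[of "(p - 2) / 2 * a * x"] by (simp add: one_le_power)
      have "(prof p a x)\<^sup>2 * (p / 2 * a\<^sup>2) / (cosh ((p - 2) / 2 * a * x))\<^sup>2 \<le> (prof p a x)\<^sup>2 * (p / 2 * a\<^sup>2) / 1"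
        using assms c by (intro divide_left_mono) auto
      then show ?thesis unfolding prof_powr_p[OF assms] by (simp add: mult_ac)
    qed
    then show "AE x in lborel. norm (prof p a x powr p) \<le> norm (p / 2 * a\<^sup>2 * (prof p a x)\<^sup>2)"
      using assms by auto
  qed simp
qed

lemma h1_on_prof:
  assumes "2 < p" "0 < a"
  shows "h1_on UNIV (prof p a) (dprof p a)"
proof -
  have "wderiv_on UNIV (prof p a) (dprof p a)"
  proof (rule piecewise_C1_wderiv_on[of _ "{}"])
    fix c d :: real
    have "bounded (dprof p a ` {c..d})"
      by (intro compact_imp_bounded compact_continuous_image continuous_dprof assms compact_Icc)
    then show "\<exists>B. \<forall>x\<in>{c..d}. \<bar>dprof p a x\<bar> \<le> B" unfolding bounded_iff by auto
  qed (use assms continuous_prof prof_deriv prof_borel_measurable in auto)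
  with integrable_prof[OF assms] show ?thesis unfolding h1_on_def set_integrable_def by simp
qed

section \<open>Integral identities and scaling of the profile\<close>

definition prof_mass :: "real \<Rightarrow> real \<Rightarrow> real" where
  "prof_mass p a = (LINT x|lborel. (prof p a x)\<^sup>2)"

text \<open>Integrate (Q Q')' = Q'^2 + Q Q'' over the line: the boundary terms vanish by decay, and
  the equation replaces Q''.\<close>

lemma prof_nehari:
  assumes "2 < p" "0 < a"
  shows "(LINT x|lborel. (dprof p a x)\<^sup>2) + a\<^sup>2 * prof_mass p a = (LINT x|lborel. prof p a x powr p)"
proof -
  note i = integrable_prof[OF assms]
  let ?f = "\<lambda>x. (dprof p a x)\<^sup>2 + a\<^sup>2 * (prof p a x)\<^sup>2 - prof p a x powr p"
  have int: "integrable lborel ?f" using i by auto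
  have pw: "prof p a x powr p = prof p a x * prof p a x powr (p - 1)" for x
    unfolding prof_powr_p[OF assms] by (simp add: power2_eq_square)
  have "(LBINT x=-\<infinity>..\<infinity>. ?f x) = 0 - 0"
  proof (rule interval_integral_FTC_integrable[where F="\<lambda>x. prof p a x * dprof p a x"])
    show "((\<lambda>x. prof p a x * dprof p a x) has_vector_derivative ?f x) (at x)" for x
      unfolding has_real_derivative_iff_has_vector_derivative[symmetric]
      by (auto intro!: derivative_eq_intros prof_deriv[OF assms] dprof_deriv[OF assms] simp: power2_eq_square pw algebra_simps)
    have "continuous_on UNIV ?f"
      using prof_pos[OF assms] by (intro continuous_intros continuous_prof continuous_dprof assms) (auto simp: less_imp_neq[symmetric])
    then show "isCont ?f x" for x by (simp add: continuous_on_eq_continuous_at)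
    show "set_integrable lborel (einterval (-\<infinity>) \<infinity>) ?f"
      using int by (simp add: set_integrable_def)
    show "(((\<lambda>x. prof p a x * dprof p a x) \<circ> real_of_ereal) \<longlongrightarrow> 0) (at_right (- \<infinity>))"
      "(((\<lambda>x. prof p a x * dprof p a x) \<circ> real_of_ereal) \<longlongrightarrow> 0) (at_left \<infinity>)"
      unfolding ereal_tendsto_simps
      using tendsto_mult[OF prof_tendsto_0(1)[OF assms] dprof_tendsto_0(1)[OF assms]]
        tendsto_mult[OF prof_tendsto_0(2)[OF assms] dprof_tendsto_0(2)[OF assms]] by simp_all
  qed simp
  then have "(LINT x|lborel. ?f x) = 0"
    by (simp add: interval_lebesgue_integral_def set_lebesgue_integral_def)
  moreover have "(LINT x|lborel. ?f x) = (LINT x|lborel. (dprof p a x)\<^sup>2) + a\<^sup>2 * prof_mass p a - (LINT x|lborel. prof p a x powr p)"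
    unfolding prof_mass_def using i by simp
  ultimately show ?thesis by simp
qed

text \<open>The integrated first integral and \<open>prof_nehari\<close> are two linear relations
  among the integrals of Q'^2, Q^2 and Q^p, so all three are proportional. The factor 1/2 - 1/p in
  the second identity is the one in the energy formula of a ground state, which makes the two
  comparable.\<close>

lemma prof_integrals:
  assumes "2 < p" "0 < a"
  shows "(LINT x|lborel. (dprof p a x)\<^sup>2) = a\<^sup>2 * prof_mass p a * ((p - 2) / (p + 2))"
    and "(LINT x|lborel. prof p a x powr p) = (LINT x|lborel. (dprof p a x)\<^sup>2) / (1/2 - 1/p)"
proof -
  note i = integrable_prof[OF assms]
  let ?A = "LINT x|lborel. (dprof p a x)\<^sup>2" and ?B = "LINT x|lborel. prof p a x powr p"
  have 1: "?A = a\<^sup>2 * prof_mass p a - 2 / p * ?B"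
    unfolding dprof_square[OF assms] prof_mass_def using i by simp
  note 2 = prof_nehari[OF assms]
  have "p * ?A = p * (a\<^sup>2 * prof_mass p a) - 2 * ?B" using assms by (subst 1) (simp add: field_simps)
  then have 3: "(p + 2) * ?A = (p - 2) * (a\<^sup>2 * prof_mass p a)" using 2 by (simp add: algebra_simps)
  then show A: "?A = a\<^sup>2 * prof_mass p a * ((p - 2) / (p + 2))" using assms by (simp add: field_simps)
  have "(p - 2) * ?B = (p - 2) * ?A + (p - 2) * (a\<^sup>2 * prof_mass p a)" 
    unfolding 2[symmetric] by (simp add: algebra_simps)
  then have "(p - 2) * ?B = 2 * p * ?A" unfolding 3[symmetric] by (simp add: algebra_simps)
  then show "?B = ?A / (1/2 - 1/p)" using assms by (simp add: field_simps)
qed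

lemma prof_scale:
  assumes "2 < p" "0 < a" "0 < b"
  shows "prof p (a * b) x = a powr (2 / (p - 2)) * prof p b (a * x)"
proof -
  have "sqrt (2 / p) / (a * b) * cosh ((p - 2) / 2 * (a * b) * x)
    = inverse a * (sqrt (2 / p) / b * cosh ((p - 2) / 2 * b * (a * x)))" using assms by (simp add: field_simps)
  then have "prof p (a * b) x = inverse a powr (- 2 / (p - 2)) * prof p b (a * x)"
    unfolding prof_def by (simp only: powr_mult)
  also have "inverse a powr (- 2 / (p - 2)) = a powr (2 / (p - 2))"
    using assms by (simp add: powr_def ln_inverse)
  finally show ?thesis .
qed

text \<open>The squared amplitude gives a^(4/(p-2)) and the change of variable divides by
  \<open>a\<close>, whence the exponent 4/(p-2) - 1 = (6-p)/(p-2). It is positive for p < 6, and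
  then mass and frequency determine each other.\<close>

lemma prof_mass_scale:
  assumes "2 < p" "0 < a"
  shows "prof_mass p a = prof_mass p 1 * a powr ((6 - p) / (p - 2))"
proof -
  have "prof_mass p a = (LINT x|lborel. (a powr (2 / (p - 2)))\<^sup>2 * (prof p 1 (a * x))\<^sup>2)"
    unfolding prof_mass_def using prof_scale[OF assms, of 1] by (simp add: power_mult_distrib)
  also have "\<dots> = (a powr (2 / (p - 2)))\<^sup>2 * (LINT x|lborel. (prof p 1 (0 + a * x))\<^sup>2)" by simp
  also have "(LINT x|lborel. (prof p 1 (0 + a * x))\<^sup>2) = prof_mass p 1 / a"
    unfolding prof_mass_def using lborel_integral_real_affine[of a "\<lambda>x. (prof p 1 x)\<^sup>2" 0] assms by simp
  also have "(a powr (2 / (p - 2)))\<^sup>2 * (prof_mass p 1 / a) = prof_mass p 1 * (a powr (4 / (p - 2)) / a powr 1)"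
    using assms by (simp add: power2_eq_square flip: powr_add)
  also have "a powr (4 / (p - 2)) / a powr 1 = a powr ((6 - p) / (p - 2))"
    unfolding powr_diff[symmetric] using assms by (simp add: field_simps)
  finally show ?thesis .
qed

lemma prof_mass_pos: 
  assumes "2 < p" "0 < a" shows "0 < prof_mass p a"
proof -
  have "prof_mass p a \<noteq> 0"
  proof
    assume "prof_mass p a = 0"
    then have "AE x in lborel. (prof p a x)\<^sup>2 = 0"
      unfolding prof_mass_def using integral_nonneg_eq_0_iff_AE[OF integrable_prof(1)[OF assms]] by simp
    moreover have "(prof p a x)\<^sup>2 \<noteq> 0" for x using prof_pos[OF assms, of x] by simp
    ultimately have "AE x in (lborel :: real measure). False" by simp
    then have "ae_filter (lborel :: real measure) = bot" by (simp only: eventually_False)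
    then show False using ae_filter_eq_bot_iff[of "lborel :: real measure"] by simp
  qed
  moreover have "prof_mass p a \<ge> 0" unfolding prof_mass_def by simp
  ultimately show ?thesis by simp
qed

section \<open>Minimality of the profiles on the line\<close>

lemma set_integral_split_at:
  fixes f :: "real \<Rightarrow> real"
  assumes "integrable lborel f"
  shows "(LINT x|lborel. f x) = (LBINT x:{c..}. f x) + (LBINT x:{..c}. f x)"
proof -
  have i: "set_integrable lborel A f" if "A \<in> sets borel" for A
    unfolding set_integrable_def by (rule integrable_mult_indicator) (use that assms in auto)
  have "(LBINT x:{c..} \<union> {..c}. f x) = (LBINT x:{c..}. f x) + (LBINT x:{..c}. f x)"
  proof (rule set_integral_Un_AE)
    have "AE x in lborel. x \<noteq> c" by (rule AE_lborel_singleton)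
    then show "AE x in lborel. \<not> (x \<in> {c..} \<and> x \<in> {..c})" by eventually_elim auto
  qed (auto intro: i)
  moreover have "{c..} \<union> {..c} = (UNIV :: real set)" by auto
  ultimately show ?thesis by (simp add: set_lebesgue_integral_def)
qed

lemma set_integral_reflect:
  fixes f :: "real \<Rightarrow> real"
  shows "(LBINT x:{..c}. f x) = (LBINT x:{-c..}. f (- x))"
proof -
  have "(LBINT x:{..c}. f x) = (LINT x|lborel. indicator {..c} (0 + - 1 * x) *\<^sub>R f (0 + - 1 * x))"
    unfolding set_lebesgue_integral_def
    by (subst lborel_integral_real_affine[of "-1" _ 0]) auto
  also have "\<dots> = (LBINT x:{-c..}. f (- x))"
    unfolding set_lebesgue_integral_def
    by (rule Bochner_Integration.integral_cong) (auto split: split_indicator)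
  finally show ?thesis .
qed

lemma set_integral_shift:
  fixes f :: "real \<Rightarrow> real"
  shows "(LBINT x:{c..}. f (x + t)) = (LBINT x:{c + t..}. f x)"
proof -
  have "(LBINT x:{c+t..}. f x) = (LINT x|lborel. indicator {c+t..} (t + 1 * x) *\<^sub>R f (t + 1 * x))"
    unfolding set_lebesgue_integral_def
    by (subst lborel_integral_real_affine[of 1 _ t]) auto
  also have "\<dots> = (LBINT x:{c..}. f (x + t))"
    unfolding set_lebesgue_integral_def
    by (rule Bochner_Integration.integral_cong) (auto simp: add.commute split: split_indicator)
  finally show ?thesis by simp
qed

lemma wderiv_on_UNIV_reflect:
  assumes "wderiv_on UNIV f g"
  shows "wderiv_on UNIV (\<lambda>x. f (- x)) (\<lambda>x. - g (- x))"
  unfolding wderiv_on_def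
proof (intro allI impI)
  fix a b :: real assume ab: "a \<le> b"
  have *: "set_integrable lborel {-b..-a} g" "f (-a) - f (-b) = (LBINT s:{-b..-a}. g s)"
    using assms ab unfolding wderiv_on_def by auto
  have e: "(\<lambda>x. indicator {-b..-a} (0 + - 1 * x) *\<^sub>R g (0 + - 1 * x)) = (\<lambda>x. indicator {a..b} x *\<^sub>R g (- x))"
    by (auto split: split_indicator)
  have "integrable lborel (\<lambda>x. indicator {-b..-a} (0 + - 1 * x) *\<^sub>R g (0 + - 1 * x))"
    by (rule lborel_integrable_real_affine) (use * in \<open>auto simp: set_integrable_def\<close>)
  then have i: "set_integrable lborel {a..b} (\<lambda>x. g (- x))" unfolding e set_integrable_def .
  have "(LBINT s:{-b..-a}. g s) = (LINT x|lborel. indicator {-b..-a} (0 + - 1 * x) *\<^sub>R g (0 + - 1 * x))"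
    unfolding set_lebesgue_integral_def
    by (subst lborel_integral_real_affine[of "-1" _ 0]) auto
  then have "(LBINT s:{-b..-a}. g s) = (LBINT s:{a..b}. g (- s))" unfolding e set_lebesgue_integral_def .
  then show "set_integrable lborel {a..b} (\<lambda>x. - g (- x)) \<and> f (- b) - f (- a) = (LBINT x:{a..b}. - g (- x))"
    using * set_integrable_mult_right[OF i, of "-1"] set_integral_uminus[OF i] by simp
qed

lemma integrable_reflect_UNIV:
  fixes f :: "real \<Rightarrow> real"
  assumes "set_integrable lborel UNIV f" shows "set_integrable lborel UNIV (\<lambda>x. f (- x))"
  using lborel_integrable_real_affine[of f "-1" 0] assms by (simp add: set_integrable_def)

lemma h1_on_UNIV_reflect:
  assumes "h1_on UNIV f g"
  shows "h1_on UNIV (\<lambda>x. f (- x)) (\<lambda>x. - g (- x))"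
  using assms wderiv_on_UNIV_reflect integrable_reflect_UNIV[of "\<lambda>x. (g x)\<^sup>2"] integrable_reflect_UNIV[of "\<lambda>x. (f x)\<^sup>2"]
  unfolding h1_on_def by simp

lemma h1_on_UNIV_tendsto_0:
  assumes "h1_on UNIV f g"
  shows "(f \<longlongrightarrow> 0) at_top" "(f \<longlongrightarrow> 0) at_bot"
proof -
  show "(f \<longlongrightarrow> 0) at_top" 
    by (rule h1_on_tendsto_0[OF h1_on_subset[OF assms, of "{0..}"]]) auto
  have "((\<lambda>x. f (- x)) \<longlongrightarrow> 0) at_top"
    by (rule h1_on_tendsto_0[OF h1_on_subset[OF h1_on_UNIV_reflect[OF assms], of "{0..}"]]) auto
  then have "((\<lambda>x. f (- (- x))) \<longlongrightarrow> 0) at_bot"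
    by (rule filterlim_compose) (rule filterlim_uminus_at_top_at_bot)
  then show "(f \<longlongrightarrow> 0) at_bot" by simp
qed

section \<open>The calibration lower bound on the line\<close>

lemma attains_abs_max:
  fixes f :: "real \<Rightarrow> real"
  assumes f: "continuous_on UNIV f" and l: "(f \<longlongrightarrow> 0) at_top" "(f \<longlongrightarrow> 0) at_bot" and n: "f x1 \<noteq> 0"
  obtains x0 where "f x0 \<noteq> 0" "\<And>x. \<bar>f x\<bar> \<le> \<bar>f x0\<bar>"
proof -
  have "\<forall>\<^sub>F x in at_top. \<bar>f x\<bar> < \<bar>f x1\<bar>" "\<forall>\<^sub>F x in at_bot. \<bar>f x\<bar> < \<bar>f x1\<bar>"
    using tendstoD[OF l(1), of "\<bar>f x1\<bar>"] tendstoD[OF l(2), of "\<bar>f x1\<bar>"] n by auto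
  then obtain u v where uv: "\<And>x. x \<ge> u \<Longrightarrow> \<bar>f x\<bar> < \<bar>f x1\<bar>" "\<And>x. x \<le> v \<Longrightarrow> \<bar>f x\<bar> < \<bar>f x1\<bar>"
    unfolding eventually_at_top_linorder eventually_at_bot_linorder by blast
  have x1: "x1 \<in> {v..u}" using uv(1)[of x1] uv(2)[of x1] by (cases "v \<le> x1"; cases "x1 \<le> u") auto
  have "\<exists>x0\<in>{v..u}. \<forall>y\<in>{v..u}. \<bar>f y\<bar> \<le> \<bar>f x0\<bar>"
    by (rule continuous_attains_sup) (use x1 in \<open>auto intro!: continuous_intros continuous_on_subset[OF f]\<close>)
  then obtain x0 where x0: "\<And>y. y \<in> {v..u} \<Longrightarrow> \<bar>f y\<bar> \<le> \<bar>f x0\<bar>" by blast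
  have "\<bar>f y\<bar> \<le> \<bar>f x0\<bar>" for y
  proof (cases "y \<in> {v..u}")
    case False
    then have "\<bar>f y\<bar> < \<bar>f x1\<bar>" using uv by auto
    with x0[OF x1] show ?thesis by linarith
  qed (rule x0)
  moreover have "f x0 \<noteq> 0" using x0[OF x1] n by auto
  ultimately show thesis using that by blast
qed

text \<open>The peak satisfies Q(0)^(p-2) = p a^2/2; solving for \<open>a\<close> fits a profile to
  a prescribed maximum.\<close>

lemma prof_at_0:
  assumes "2 < p" "0 < M"
  shows "prof p (sqrt (2 / p * M powr (p - 2))) 0 = M"
proof -
  let ?a = "sqrt (2 / p * M powr (p - 2))"
  have a: "?a > 0" "?a\<^sup>2 = 2 / p * M powr (p - 2)" using assms by auto
  have "prof p ?a 0 powr (p - 2) = M powr (p - 2)"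
    using prof_powr[OF assms(1) a(1), of 0] a(2) assms by simp
  then have "(prof p ?a 0 powr (p - 2)) powr (1 / (p - 2)) = (M powr (p - 2)) powr (1 / (p - 2))" by simp
  then show ?thesis unfolding powr_powr using assms prof_pos[OF assms(1) a(1), of 0] by simp
qed

text \<open>Choosing the frequency \<open>a\<close> so that the soliton and \<open>f\<close> have the same maximum \<open>M\<close> makes
  \<open>F(t) = a\<^sup>2 t\<^sup>2/2 - t\<^sup>p/p\<close> nonnegative on \<open>[0, M]\<close>; then \<open>\<integral> f'\<^sup>2/2 + F(f) \<ge> 2 \<integral>\<^sub>0\<^sup>M \<surd>(2 F)\<close>,
  with equality for the soliton.\<close>
lemma energy_ge_prof:
  assumes p: "2 < p" and h: "h1_on UNIV f g" and n: "f x1 \<noteq> 0"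
  shows "\<exists>a>0. (LINT x|lborel. (dprof p a x)\<^sup>2) - a\<^sup>2 / 2 * (LINT x|lborel. (f x)\<^sup>2)
     \<le> 1/2 * (LINT x|lborel. (g x)\<^sup>2) - 1/p * (LINT x|lborel. \<bar>f x\<bar> powr p)"
proof -
  have w: "wderiv_on UNIV f g" and ig: "integrable lborel (\<lambda>x. (g x)\<^sup>2)" and i_f: "integrable lborel (\<lambda>x. (f x)\<^sup>2)"
    using h unfolding h1_on_def set_integrable_def by auto
  have cf: "continuous_on UNIV f" by (rule wderiv_on_continuous[OF w]) simp
  note lim = h1_on_UNIV_tendsto_0[OF h]
  obtain x0 where x0: "f x0 \<noteq> 0" "\<And>x. \<bar>f x\<bar> \<le> \<bar>f x0\<bar>" using attains_abs_max[OF cf lim n] by blast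
  define M where "M = \<bar>f x0\<bar>"
  have M: "M > 0" "\<And>x. \<bar>f x\<bar> \<le> M" using x0 by (auto simp: M_def)
  define a where "a = sqrt (2 / p * M powr (p - 2))"
  have a: "a > 0" "a\<^sup>2 = 2 / p * M powr (p - 2)" using M p by (auto simp: a_def)
  have p0: "prof p a 0 = M" unfolding a_def by (rule prof_at_0[OF p M(1)])
  have if_p: "integrable lborel (\<lambda>x. \<bar>f x\<bar> powr p)"
    using h1_on_powr_integrable[OF h M(2)] p by (simp add: set_integrable_def)
  define F where "F = (\<lambda>t. a\<^sup>2 / 2 * t\<^sup>2 - \<bar>t\<bar> powr p / p)"
  \<comment> \<open>F(t) = t^2 (a^2/2 - |t|^(p-2)/p), and by the choice of \<open>a\<close> the
    bracket decreases to 0 at |t| = M.\<close>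
  have Fnn: "0 \<le> F t" if "\<bar>t\<bar> \<le> M" for t
  proof (cases "t = 0")
    case False
    have "\<bar>t\<bar> powr p = \<bar>t\<bar> powr 2 * \<bar>t\<bar> powr (p - 2)" by (metis add.commute diff_add_cancel powr_add)
    also have "\<dots> = t\<^sup>2 * \<bar>t\<bar> powr (p - 2)" using False by (simp add: powr_numeral)
    also have "\<dots> \<le> t\<^sup>2 * M powr (p - 2)" using that p by (intro mult_left_mono powr_mono2) auto
    finally have "\<bar>t\<bar> powr p / p \<le> t\<^sup>2 * M powr (p - 2) / p" using p by (intro divide_right_mono) auto
    moreover have "a\<^sup>2 / 2 * t\<^sup>2 = t\<^sup>2 * M powr (p - 2) / p" unfolding a(2) by simp
    ultimately show ?thesis unfolding F_def by linarith
  qed (simp add: F_def)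
  \<comment> \<open>Beyond \<open>M\<close> the function F is negative. The truncation makes the
    square root global and agrees with F on all values of \<open>f\<close> and of the
    profile.\<close>
  define H where "H = (\<lambda>t. max 0 (F t))"
  have "continuous_on UNIV (\<lambda>t::real. \<bar>t\<bar> powr p)"
    by (rule continuous_on_powr') (use p in \<open>auto intro!: continuous_intros\<close>)
  then have cH: "continuous_on UNIV H" unfolding H_def F_def using p by (auto intro!: continuous_intros)
  have HF: "H t = F t" if "\<bar>t\<bar> \<le> M" for t using Fnn[OF that] by (simp add: H_def)
  have Heven: "H (- t) = H t" for t by (simp add: H_def F_def)
  have "continuous_on UNIV (\<lambda>t. sqrt (2 * H t))" by (intro continuous_intros cH)
  then obtain P where P: "\<And>t. (P has_real_derivative sqrt (2 * H t)) (at t)"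
    using continuous_antiderivative by blast
  have PH: "(sqrt (2 * H t))\<^sup>2 \<le> 2 * H t" for t by (simp add: H_def)
  have cP: "continuous_on UNIV P" using P by (meson DERIV_isCont continuous_at_imp_continuous_on)
  then have isP: "isCont P t" for t by (simp add: continuous_on_eq_continuous_at)
  \<comment> \<open>\<open>f\<close> may change sign and its extreme value may be
    \<open>- M\<close>; oddness of \<open>P - P 0\<close> makes the cost of reaching 0 the same from
    either sign.\<close>
  have Podd: "P (- t) - P 0 = - (P t - P 0)" for t
  proof -
    have "((\<lambda>t. P t + P (- t)) has_real_derivative 0) (at t)" for t
    proof -
      have "((\<lambda>t. P (- t)) has_real_derivative - sqrt (2 * H t)) (at t)"
        using DERIV_mirror[of P "sqrt (2 * H t)" t] P[of "- t"] by (simp add: Heven)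
      from DERIV_add[OF P[of t] this] show ?thesis by simp
    qed
    then have "P t + P (- t) = P 0 + P (- 0)"
      using DERIV_isconst_all[of "\<lambda>t. P t + P (- t)"] by blast
    then show ?thesis by simp
  qed
  have PM: "\<bar>P (f x0) - P 0\<bar> = \<bar>P M - P 0\<bar>"
    using Podd[of "f x0"] unfolding M_def by (cases "f x0 \<ge> 0") auto
  let ?q = "\<lambda>x. (g x)\<^sup>2 / 2 + H (f x)"
  have Hf: "H (f x) = a\<^sup>2 / 2 * (f x)\<^sup>2 - \<bar>f x\<bar> powr p / p" for x using HF[OF M(2)] by (simp add: F_def)
  have iq: "integrable lborel ?q" unfolding Hf using ig i_f if_p by auto
  have siq: "set_integrable lborel A ?q" if "A \<in> sets borel" for A
    unfolding set_integrable_def by (rule integrable_mult_indicator) (use that iq in auto)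
  have chain: "\<bar>P (f d) - P (f c)\<bar> \<le> (LBINT x:{c..d}. ?q x)" if "c \<le> d" for c d
  proof -
    have wc: "wderiv_on {c..d} f g" "set_integrable lborel {c..d} (\<lambda>x. (g x)\<^sup>2)"
      using h1_on_subset[OF h, of "{c..d}"] unfolding h1_on_def by auto
    have "P (f d) - P (f c) \<le> (LBINT x:{c..d}. ?q x)"
      by (rule wderiv_on_compose_diff_le[OF wc(1) that wc(2) P cH PH])
    moreover have "(- P (f d)) - (- P (f c)) \<le> (LBINT x:{c..d}. ?q x)"
      by (rule wderiv_on_compose_diff_le[OF wc(1) that wc(2), where P="\<lambda>x. - P x", OF DERIV_minus[OF P] cH]) (use PH in simp)
    ultimately show ?thesis by (simp add: abs_le_iff)
  qed
  \<comment> \<open>To the right of the peak \<open>f\<close> travels from M or -M to its limit 0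
    and pays at least the variation of \<open>P\<close> between them.\<close>
  have right: "\<bar>P M - P 0\<bar> \<le> (LBINT x:{x0..}. ?q x)"
  proof (rule tendsto_le[OF trivial_limit_at_top_linorder])
    show "((\<lambda>b. LBINT x:{x0..b}. ?q x) \<longlongrightarrow> (LBINT x:{x0..}. ?q x)) at_top"
      by (rule tendsto_set_lebesgue_integral_at_top) (auto intro: siq)
    have "((\<lambda>b. \<bar>P (f b) - P (f x0)\<bar>) \<longlongrightarrow> \<bar>P 0 - P (f x0)\<bar>) at_top"
      by (intro tendsto_intros isCont_tendsto_compose[OF isP] lim)
    then show "((\<lambda>b. \<bar>P (f b) - P (f x0)\<bar>) \<longlongrightarrow> \<bar>P M - P 0\<bar>) at_top"
      using PM by (simp add: abs_minus_commute)
    show "\<forall>\<^sub>F b in at_top. \<bar>P (f b) - P (f x0)\<bar> \<le> (LBINT x:{x0..b}. ?q x)"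
      using eventually_ge_at_top[of x0] by eventually_elim (rule chain)
  qed
  have left: "\<bar>P M - P 0\<bar> \<le> (LBINT x:{..x0}. ?q x)"
  proof (rule tendsto_le[OF trivial_limit_at_bot_linorder])
    show "((\<lambda>b. LBINT x:{b..x0}. ?q x) \<longlongrightarrow> (LBINT x:{..x0}. ?q x)) at_bot"
      by (rule tendsto_set_lebesgue_integral_at_bot) (auto intro: siq)
    have "((\<lambda>b. \<bar>P (f x0) - P (f b)\<bar>) \<longlongrightarrow> \<bar>P (f x0) - P 0\<bar>) at_bot"
      by (intro tendsto_intros isCont_tendsto_compose[OF isP] lim)
    then show "((\<lambda>b. \<bar>P (f x0) - P (f b)\<bar>) \<longlongrightarrow> \<bar>P M - P 0\<bar>) at_bot"
      using PM by simp
    show "\<forall>\<^sub>F b in at_bot. \<bar>P (f x0) - P (f b)\<bar> \<le> (LBINT x:{b..x0}. ?q x)"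
      using eventually_le_at_bot[of x0] by eventually_elim (rule chain)
  qed
  have "2 * \<bar>P M - P 0\<bar> \<le> (LINT x|lborel. ?q x)"
    unfolding set_integral_split_at[OF iq, of x0] using add_mono[OF right left] by (simp only: mult_2)
  also have "\<dots> = 1/2 * (LINT x|lborel. (g x)\<^sup>2) + a\<^sup>2 / 2 * (LINT x|lborel. (f x)\<^sup>2) - 1/p * (LINT x|lborel. \<bar>f x\<bar> powr p)"
    unfolding Hf using ig i_f if_p by simp
  finally have le: "2 * \<bar>P M - P 0\<bar> \<le> \<dots>" .
  note ip = integrable_prof(2)[OF p a(1)]
  have sip: "set_integrable lborel A (\<lambda>x. (dprof p a x)\<^sup>2)" if "A \<in> sets borel" for A
    unfolding set_integrable_def by (rule integrable_mult_indicator) (use that ip in auto)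
  \<comment> \<open>On \<open>{0..}\<close> the profile decreases with Q' = -sqrt(2 F(Q)), so P(Q)
    has derivative -Q'^2 and the bound just shown for \<open>f\<close> is attained.\<close>
  have half: "(LBINT x:{0..}. (dprof p a x)\<^sup>2) = P M - P 0"
  proof -
    have dP: "((P \<circ> prof p a) has_real_derivative - (dprof p a x)\<^sup>2) (at x)" if "x \<ge> 0" for x
    proof -
      have pm: "\<bar>prof p a x\<bar> \<le> M" using prof_le_iff[OF p a(1), of x 0] prof_pos[OF p a(1), of x] p0 by simp
      have "2 * F (prof p a x) = (dprof p a x)\<^sup>2"
        unfolding dprof_square[OF p a(1)] F_def using prof_pos[OF p a(1), of x] by (simp add: field_simps)
      then have "sqrt (2 * H (prof p a x)) = \<bar>dprof p a x\<bar>" using HF[OF pm] by simp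
      also have "\<dots> = - dprof p a x"
        unfolding dprof_def using that a p prof_pos[OF p a(1), of x] by (simp add: abs_mult)
      finally have "sqrt (2 * H (prof p a x)) * dprof p a x = - (dprof p a x)\<^sup>2"
        by (simp add: power2_eq_square)
      with DERIV_chain[OF P prof_deriv[OF p a(1)], of x] show ?thesis by simp
    qed
    have "(P \<circ> prof p a) b - (P \<circ> prof p a) 0 = (LBINT x:{0..b}. - (dprof p a x)\<^sup>2)" if "b \<ge> 0" for b
    proof -
      have "wderiv_on {0..} (P \<circ> prof p a) (\<lambda>x. - (dprof p a x)\<^sup>2)"
      proof (rule piecewise_C1_wderiv_on[of _ "{}"])
        show "continuous_on {0..} (P \<circ> prof p a)"
          by (intro continuous_on_compose continuous_prof p a continuous_on_subset[OF cP]) simp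
        fix c d :: real
        have "bounded ((\<lambda>x. - (dprof p a x)\<^sup>2) ` {c..d})"
          by (intro compact_imp_bounded compact_continuous_image continuous_intros continuous_dprof p a compact_Icc)
        then show "\<exists>B. \<forall>x\<in>{c..d}. \<bar>- (dprof p a x)\<^sup>2\<bar> \<le> B" unfolding bounded_iff by auto
      qed (use dP prof_borel_measurable[OF p a(1)] in \<open>auto intro!: is_interval_ci\<close>)
      then show ?thesis using that unfolding wderiv_on_def by auto
    qed
    then have eq: "P M - P (prof p a b) = (LBINT x:{0..b}. (dprof p a x)\<^sup>2)" if "b \<ge> 0" for b
      using that p0 set_integral_uminus[OF sip, of "{0..b}"] by force
    have "((\<lambda>b. LBINT x:{0..b}. (dprof p a x)\<^sup>2) \<longlongrightarrow> P M - P 0) at_top"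
    proof (rule Lim_transform_eventually)
      show "((\<lambda>b. P M - P (prof p a b)) \<longlongrightarrow> P M - P 0) at_top"
        by (intro tendsto_intros isCont_tendsto_compose[OF isP] prof_tendsto_0 p a)
      show "\<forall>\<^sub>F b in at_top. P M - P (prof p a b) = (LBINT x:{0..b}. (dprof p a x)\<^sup>2)"
        using eventually_ge_at_top[of 0] by eventually_elim (rule eq)
    qed
    moreover have "((\<lambda>b. LBINT x:{0..b}. (dprof p a x)\<^sup>2) \<longlongrightarrow> (LBINT x:{0..}. (dprof p a x)\<^sup>2)) at_top"
      by (rule tendsto_set_lebesgue_integral_at_top) (auto intro: sip)
    ultimately show ?thesis using tendsto_unique[OF trivial_limit_at_top_linorder] by blast
  qed
  have "(LBINT x:{..0}. (dprof p a x)\<^sup>2) = (LBINT x:{0..}. (dprof p a x)\<^sup>2)"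
    using set_integral_reflect[of 0 "\<lambda>x. (dprof p a x)\<^sup>2"] by (simp add: dprof_def prof_even power_mult_distrib)
  then have "(LINT x|lborel. (dprof p a x)\<^sup>2) = 2 * (P M - P 0)"
    using set_integral_split_at[OF ip, of 0] half by simp
  also have "\<dots> \<le> 2 * \<bar>P M - P 0\<bar>" by (intro mult_left_mono abs_ge_self) simp
  finally have "(LINT x|lborel. (dprof p a x)\<^sup>2) \<le> 2 * \<bar>P M - P 0\<bar>" .
  with le have "(LINT x|lborel. (dprof p a x)\<^sup>2) - a\<^sup>2 / 2 * (LINT x|lborel. (f x)\<^sup>2)
     \<le> 1/2 * (LINT x|lborel. (g x)\<^sup>2) - 1/p * (LINT x|lborel. \<bar>f x\<bar> powr p)" by linarith
  with a(1) show ?thesis by blast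
qed

section \<open>Optimisation in the frequency\<close>

lemma Bernoulli_powr:
  fixes t s :: real
  assumes "0 < t" "1 \<le> s"
  shows "1 + s * (t - 1) \<le> t powr s"
proof -
  \<comment> \<open>Tangent line at 1 of the convex function x^s.\<close>
  have "s * 1 powr (s - 1) * (t - 1) \<le> t powr s - 1 powr s"
  proof (rule f''_imp_f'[where C="{0<..}" and f="\<lambda>x. x powr s" and f'="\<lambda>x. s * x powr (s - 1)" and f''="\<lambda>x. s * ((s - 1) * x powr (s - 2))"])
    show "((\<lambda>x. x powr s) has_real_derivative s * x powr (s - 1)) (at x)" if "x \<in> {0<..}" for x
      using that by (auto intro!: derivative_eq_intros)
    show "((\<lambda>x. s * x powr (s - 1)) has_real_derivative s * ((s - 1) * x powr (s - 2))) (at x)" if "x \<in> {0<..}" for x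
      using that by (auto intro!: derivative_eq_intros)
  qed (use assms in auto)
  then show ?thesis by simp
qed

text \<open>The aim is the form in which the lower bound of \<open>energy_ge_prof\<close> appears,
  so that the two differ only in the frequency.\<close>

lemma prof_energy:
  assumes "2 < p" "0 < b"
  shows "1/2 * (LINT x|lborel. (dprof p b x)\<^sup>2) - 1/p * (LINT x|lborel. prof p b x powr p)
    = (LINT x|lborel. (dprof p b x)\<^sup>2) - b\<^sup>2 / 2 * prof_mass p b"
proof -
  let ?A = "LINT x|lborel. (dprof p b x)\<^sup>2" and ?B = "LINT x|lborel. prof p b x powr p"
  have "(1/2 - 1/p) * ?B = ?A" using prof_integrals(2)[OF assms] assms by (simp add: field_simps)
  then have "1/p * ?B = 1/2 * ?B - ?A" by (simp add: left_diff_distrib)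
  then show ?thesis using prof_nehari[OF assms] by (simp add: algebra_simps)
qed

text \<open>By scaling, the integral of Q'^2 is \<kappa> a^2 \<open>prof_mass p a\<close>, a pure
  power of \<open>a\<close>. Dividing by b^2 \<open>prof_mass p b\<close> and setting t = (a/b)^2
  turns the right-hand side into \<kappa> t^(1/(2 \<kappa>)) - t/2, whose derivative vanishes at t =
  1. For p < 6 the exponent 1/(2 \<kappa>) = (p+2)/(2 (p-2)) exceeds 1, so this function is convex
  and t = 1 is its minimum.\<close>

lemma prof_energy_min_frequency:
  assumes p: "2 < p" "p < 6" and "0 < a" "0 < b"
  shows "(LINT x|lborel. (dprof p b x)\<^sup>2) - b\<^sup>2 / 2 * prof_mass p b
     \<le> (LINT x|lborel. (dprof p a x)\<^sup>2) - a\<^sup>2 / 2 * prof_mass p b"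
proof -
  define \<tau> where "\<tau> = (6 - p) / (p - 2)"
  define \<kappa> where "\<kappa> = (p - 2) / (p + 2)"
  define t where "t = (a / b)\<^sup>2"
  have t: "t > 0" using assms by (simp add: t_def)
  have \<kappa>: "\<kappa> > 0" using p by (simp add: \<kappa>_def)
  have s: "(\<tau> + 2) / 2 = 1 / (2 * \<kappa>)" using p by (simp add: \<tau>_def \<kappa>_def field_simps)
  have s1: "1 \<le> 1 / (2 * \<kappa>)" using p by (simp add: \<kappa>_def field_simps)
  have "1 + 1 / (2 * \<kappa>) * (t - 1) \<le> t powr (1 / (2 * \<kappa>))" by (rule Bernoulli_powr[OF t s1])
  then have "\<kappa> * (1 + 1 / (2 * \<kappa>) * (t - 1)) \<le> \<kappa> * t powr (1 / (2 * \<kappa>))" using \<kappa> by (intro mult_left_mono) auto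
  moreover have "\<kappa> * (1 + 1 / (2 * \<kappa>) * (t - 1)) = \<kappa> + (t - 1) / 2" using \<kappa> by (simp add: distrib_left)
  ultimately have key: "\<kappa> - 1/2 \<le> \<kappa> * t powr (1 / (2 * \<kappa>)) - t / 2" by argo
  have "t powr (1 / (2 * \<kappa>)) = (a / b) powr (\<tau> + 2)"
  proof -
    have "t = (a / b) powr 2" using assms by (simp add: t_def powr_numeral)
    moreover have "2 * ((\<tau> + 2) / 2) = \<tau> + 2" by simp
    ultimately show ?thesis unfolding s[symmetric] by (simp only: powr_powr)
  qed
  also have "\<dots> = (a / b) powr \<tau> * (a / b)\<^sup>2" using assms by (simp add: powr_add powr_numeral)
  also have "(a / b) powr \<tau> = prof_mass p a / prof_mass p b"
  proof -
    have "prof_mass p a = prof_mass p 1 * a powr \<tau>" "prof_mass p b = prof_mass p 1 * b powr \<tau>"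
      unfolding \<tau>_def by (rule prof_mass_scale; use assms in simp)+
    moreover have "prof_mass p 1 \<noteq> 0" using prof_mass_pos[OF p(1), of 1] by simp
    ultimately show ?thesis by (simp only: powr_divide) simp
  qed
  finally have tp: "t powr (1 / (2 * \<kappa>)) = prof_mass p a / prof_mass p b * (a / b)\<^sup>2" .
  have m: "prof_mass p b > 0" using prof_mass_pos p assms by blast
  have "(\<kappa> - 1/2) * (b\<^sup>2 * prof_mass p b) \<le> (\<kappa> * t powr (1 / (2 * \<kappa>)) - t / 2) * (b\<^sup>2 * prof_mass p b)"
    using key m by (intro mult_right_mono) auto
  also have "\<dots> = \<kappa> * (a\<^sup>2 * prof_mass p a) - a\<^sup>2 / 2 * prof_mass p b"
    unfolding tp unfolding t_def using m assms by (simp add: field_simps power_divide)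
  finally show ?thesis unfolding prof_integrals(1)[OF p(1) assms(3)] prof_integrals(1)[OF p(1) assms(4)] \<kappa>_def[symmetric]
    by (simp add: algebra_simps)
qed

text \<open>The calibration yields a frequency dictated by the maximum of \<open>f\<close>;
  \<open>prof_energy_min_frequency\<close> trades it for the frequency \<open>b\<close> dictated by
  the mass.\<close>

lemma prof_minimizer:
  assumes p: "2 < p" "p < 6" and b: "0 < b" and h: "h1_on UNIV f g" 
    and m: "(LINT x|lborel. (f x)\<^sup>2) = prof_mass p b"
  shows "1/2 * (LINT x|lborel. (dprof p b x)\<^sup>2) - 1/p * (LINT x|lborel. prof p b x powr p)
     \<le> 1/2 * (LINT x|lborel. (g x)\<^sup>2) - 1/p * (LINT x|lborel. \<bar>f x\<bar> powr p)"
proof -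
  have "\<exists>x. f x \<noteq> 0"
  proof (rule ccontr)
    assume "\<not> ?thesis"
    then have "(LINT x|lborel. (f x)\<^sup>2) = 0" by simp
    then show False using m prof_mass_pos[OF p(1) b] by simp
  qed
  then obtain a where a: "a > 0" "(LINT x|lborel. (dprof p a x)\<^sup>2) - a\<^sup>2 / 2 * prof_mass p b
     \<le> 1/2 * (LINT x|lborel. (g x)\<^sup>2) - 1/p * (LINT x|lborel. \<bar>f x\<bar> powr p)"
    using energy_ge_prof[OF p(1) h] unfolding m by blast
  then show ?thesis using prof_energy_min_frequency[OF p a(1) b] prof_energy[OF p(1) b] by linarith
qed

lemma prof_mass_surj:
  assumes p: "2 < p" "p < 6" and "0 < \<mu>"
  obtains b where "0 < b" "prof_mass p b = \<mu>"
proof -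
  let ?m = "prof_mass p 1"
  define b where "b = (\<mu> / ?m) powr ((p - 2) / (6 - p))"
  have m: "?m > 0" by (rule prof_mass_pos[OF p(1)]) simp
  have b: "b > 0" using assms m by (simp add: b_def)
  have "b powr ((6 - p) / (p - 2)) = \<mu> / ?m"
    unfolding b_def powr_powr using p assms(3) m by simp
  then have "prof_mass p b = \<mu>" using prof_mass_scale[OF p(1) b] m by simp
  with b that show thesis by blast
qed

section \<open>Positive weak solutions on a half-line\<close>

lemma midpoint_max_principle:
  fixes e :: "real \<Rightarrow> real"
  assumes c: "continuous_on {a..b} e" 
    and mid: "\<And>m d. 0 < d \<Longrightarrow> a \<le> m - d \<Longrightarrow> m + d \<le> b \<Longrightarrow> e (m - d) + e (m + d) = 2 * e m"
    and "e a \<le> 0" "e b \<le> 0" and x: "x \<in> {a..b}"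
  shows "e x \<le> 0"
proof (rule ccontr)
  assume "\<not> e x \<le> 0"
  obtain z where z: "z \<in> {a..b}" "\<And>y. y \<in> {a..b} \<Longrightarrow> e y \<le> e z"
    using continuous_attains_sup[OF compact_Icc _ c] x by blast
  then have pos: "e z > 0" using x \<open>\<not> e x \<le> 0\<close> by force
  let ?S = "{y \<in> {a..b}. e y = e z}"
  have "closed ?S" by (rule continuous_closed_preimage_constant[OF c]) simp
  then have "compact ({a..b} \<inter> ?S)" by (intro compact_Int_closed) auto
  moreover have "{a..b} \<inter> ?S = ?S" by auto
  ultimately have "compact ?S" by simp
  \<comment> \<open>The leftmost maximiser is interior; the midpoint identity around it, with
    \<open>d\<close> reaching the nearer endpoint, involves a strictly smaller value on its
    left.\<close>
  then obtain y where y: "y \<in> ?S" "\<And>t. t \<in> ?S \<Longrightarrow> y \<le> t"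
    using compact_attains_inf[of ?S] z by blast
  have ne: "y \<noteq> a" "y \<noteq> b" using y(1) pos assms by auto
  define d where "d = min (y - a) (b - y)"
  have d: "d > 0" "a \<le> y - d" "y + d \<le> b" using ne y(1) by (auto simp: d_def min_def)
  have "y - d \<in> {a..b}" "y + d \<in> {a..b}" using d by auto
  then have "e (y - d) \<le> e z" "e (y + d) \<le> e z" "e (y - d) \<noteq> e z"
    using z(2) y(2)[of "y - d"] d by auto
  moreover have "e (y - d) + e (y + d) = 2 * e z" using mid[OF d] y(1) by simp
  ultimately show False by linarith
qed

text \<open>Subtract the chord and apply the maximum principle to the difference and to its
  negative.\<close>

lemma midpoint_affine_Icc:
  fixes e :: "real \<Rightarrow> real"
  assumes c: "continuous_on {a..b} e" and ab: "a < b"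
    and mid: "\<And>m d. 0 < d \<Longrightarrow> a \<le> m - d \<Longrightarrow> m + d \<le> b \<Longrightarrow> e (m - d) + e (m + d) = 2 * e m"
    and x: "x \<in> {a..b}"
  shows "e x = e a + (e b - e a) / (b - a) * (x - a)"
proof -
  define s where "s = (e b - e a) / (b - a)"
  have s: "s * (b - a) = e b - e a" using ab by (simp add: s_def)
  define l where "l = (\<lambda>x. e a + s * (x - a))"
  have l: "l a = e a" "l b = e b" "continuous_on {a..b} l" "l (m - d) + l (m + d) = 2 * l m" for m d
    using s by (auto simp: l_def algebra_simps intro!: continuous_intros)
  have "e x - l x \<le> 0"
  proof (rule midpoint_max_principle[of a b "\<lambda>x. e x - l x"])
    show "e (m - d) - l (m - d) + (e (m + d) - l (m + d)) = 2 * (e m - l m)"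
      if "0 < d" "a \<le> m - d" "m + d \<le> b" for m d using mid[OF that] l(4)[of m d] unfolding right_diff_distrib by linarith
  qed (use l x c in \<open>auto intro!: continuous_intros\<close>)
  moreover have "l x - e x \<le> 0"
  proof (rule midpoint_max_principle[of a b "\<lambda>x. l x - e x"])
    show "l (m - d) - e (m - d) + (l (m + d) - e (m + d)) = 2 * (l m - e m)"
      if "0 < d" "a \<le> m - d" "m + d \<le> b" for m d using mid[OF that] l(4)[of m d] unfolding right_diff_distrib by linarith
  qed (use l x c in \<open>auto intro!: continuous_intros\<close>)
  ultimately show ?thesis unfolding l_def s_def by linarith
qed

lemma midpoint_affine_halfline:
  fixes e :: "real \<Rightarrow> real"
  assumes c: "continuous_on {a..} e" 
    and mid: "\<And>m d. 0 < d \<Longrightarrow> a \<le> m - d \<Longrightarrow> e (m - d) + e (m + d) = 2 * e m"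
    and x: "a \<le> x"
  shows "e x = e a + (e (a + 1) - e a) * (x - a)"
proof -
  define b where "b = max x (a + 1)"
  have b: "a < b" "x \<in> {a..b}" "a + 1 \<in> {a..b}" using x by (auto simp: b_def)
  have cb: "continuous_on {a..b} e" by (rule continuous_on_subset[OF c]) auto
  show ?thesis
    using midpoint_affine_Icc[OF cb b(1) mid b(2)] midpoint_affine_Icc[OF cb b(1) mid b(3)] by simp
qed

text \<open>A tent of height \<open>d\<close> at \<open>m\<close> with slopes 1 and -1. It is the
  Peano kernel of the central second difference and thus turns the weak equation into an identity
  between values of functions.\<close>

definition hat :: "real \<Rightarrow> real \<Rightarrow> real \<Rightarrow> real" where
  "hat m d x = max 0 (d - \<bar>x - m\<bar>)"

definition dhat :: "real \<Rightarrow> real \<Rightarrow> real \<Rightarrow> real" where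
  "dhat m d x = (if x \<in> {m - d..m} then 1 else if x \<in> {m<..m + d} then - 1 else 0)"

lemma integral_Icc_FTC:
  fixes k :: "real \<Rightarrow> real"
  assumes "a \<le> b" "continuous_on {a..b} k" "\<And>x. x \<in> {a..b} \<Longrightarrow> (K has_real_derivative k x) (at x)"
  shows "(LBINT x:{a..b}. k x) = K b - K a"
proof -
  have "(k has_integral (K b - K a)) {a..b}"
    by (rule fundamental_theorem_of_calculus[OF assms(1)])
       (use assms(3) in \<open>auto intro: has_field_derivative_at_within simp: has_real_derivative_iff_has_vector_derivative[symmetric]\<close>)
  then show ?thesis
    using set_borel_integral_eq_integral(2)[OF borel_integrable_atLeastAtMost'[OF assms(2)]] integral_unique by metis
qed

text \<open>Integrate by parts twice on each side of the kink: the terms in \<open>K m\<close>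
  cancel, those at the ends of the support vanish, and a second difference of \<open>V\<close>
  remains.\<close>

lemma integral_hat:
  fixes k K V :: "real \<Rightarrow> real"
  assumes "continuous_on UNIV k" "\<And>x. (K has_real_derivative k x) (at x)"
     "\<And>x. (V has_real_derivative K x) (at x)" "d > 0"
  shows "(LBINT x:{m - d..m + d}. k x * hat m d x) = V (m - d) + V (m + d) - 2 * V m"
proof -
  have ch: "continuous_on S (\<lambda>x. k x * hat m d x)" for S
    unfolding hat_def by (intro continuous_intros continuous_on_subset[OF assms(1)]) auto
  have "(LBINT x:{m - d..m + d}. k x * hat m d x) =
     (LBINT x:{m - d..m}. k x * hat m d x) + (LBINT x:{m..m + d}. k x * hat m d x)"
    by (rule set_integral_Icc_split[OF borel_integrable_atLeastAtMost'[OF ch]]) (use assms in auto)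
  also have "(LBINT x:{m - d..m}. k x * hat m d x) = (LBINT x:{m - d..m}. k x * (x - m + d))"
    by (rule set_lebesgue_integral_cong) (auto simp: hat_def max_def)
  also have "\<dots> = ((m - m + d) * K m - V m) - ((m - d - m + d) * K (m - d) - V (m - d))"
    by (rule integral_Icc_FTC[where K="\<lambda>x. (x - m + d) * K x - V x"])
       (use assms in \<open>auto intro!: derivative_eq_intros continuous_intros continuous_on_subset[OF assms(1)]\<close>)
  also have "(LBINT x:{m..m + d}. k x * hat m d x) = (LBINT x:{m..m + d}. k x * (m + d - x))"
    by (rule set_lebesgue_integral_cong) (auto simp: hat_def max_def)
  also have "\<dots> = ((m + d - (m + d)) * K (m + d) + V (m + d)) - ((m + d - m) * K m + V m)"
    by (rule integral_Icc_FTC[where K="\<lambda>x. (m + d - x) * K x + V x"])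
       (use assms in \<open>auto intro!: derivative_eq_intros continuous_intros continuous_on_subset[OF assms(1)]\<close>)
  finally show ?thesis by simp
qed

section \<open>Explicit integration of the stationary equation\<close>

lemma exp_growth_unique:
  fixes z :: "real \<Rightarrow> real"
  assumes "\<And>x. c \<le> x \<Longrightarrow> (z has_real_derivative \<theta> * z x) (at x)"
  obtains C where "\<And>x. c \<le> x \<Longrightarrow> z x = C * exp (\<theta> * x)"
proof -
  have "\<exists>C. \<forall>x\<in>{c..}. z x * exp (- \<theta> * x) = C"
  proof (rule has_field_derivative_zero_constant)
    fix x assume x: "x \<in> {c..}"
    have "((\<lambda>x. z x * exp (- \<theta> * x)) has_real_derivative \<theta> * z x * exp (- \<theta> * x) + z x * (exp (- \<theta> * x) * (- \<theta>))) (at x)"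
      using assms[of x] x by (auto intro!: derivative_eq_intros)
    then have "((\<lambda>x. z x * exp (- \<theta> * x)) has_real_derivative 0) (at x)" by simp
    then show "((\<lambda>x. z x * exp (- \<theta> * x)) has_real_derivative 0) (at x within {c..})"
      by (rule has_field_derivative_at_within)
  qed simp
  then obtain C where C: "\<And>x. c \<le> x \<Longrightarrow> z x * exp (- \<theta> * x) = C" by auto
  have "z x = C * exp (\<theta> * x)" if "c \<le> x" for x
    using C[OF that] by (simp add: exp_minus field_simps)
  then show thesis using that by blast
qed

text \<open>The substitution \<open>w = f powr (- (p - 2) / 2)\<close> linearises the equation to \<open>w'' = \<theta>\<^sup>2 w\<close>.\<close>
lemma ode_solution_prof:
  fixes f f1 :: "real \<Rightarrow> real"
  assumes p: "2 < p" and pos: "\<And>x. c \<le> x \<Longrightarrow> 0 < f x"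
    and d: "\<And>x. c \<le> x \<Longrightarrow> (f has_real_derivative f1 x) (at x)"
    and d1: "\<And>x. c \<le> x \<Longrightarrow> (f1 has_real_derivative \<omega> * f x - f x powr (p - 1)) (at x)"
    and fi: "\<And>x. c \<le> x \<Longrightarrow> (f1 x)\<^sup>2 = \<omega> * (f x)\<^sup>2 - 2 / p * f x powr p"
  obtains a y where "0 < a" "a\<^sup>2 = \<omega>" "\<And>x. c \<le> x \<Longrightarrow> f x = prof p a (x + y)"
proof -
  \<comment> \<open>The first integral reads f1^2 = \<omega> f^2 - 2/p f^p with f > 0; a nonpositive
    \<omega> would make the square negative.\<close>
  have lam: "\<omega> > 0"
  proof (rule ccontr)
    assume "\<not> \<omega> > 0"
    then have "\<omega> * (f c)\<^sup>2 \<le> 0" by (simp add: mult_nonpos_nonneg)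
    moreover have "2 / p * f c powr p > 0" using p pos[of c] by simp
    ultimately have "(f1 c)\<^sup>2 < 0" using fi[of c] by simp
    then show False by (simp add: not_less[symmetric])
  qed
  define a where "a = sqrt \<omega>"
  have a: "a > 0" "a\<^sup>2 = \<omega>" using lam by (auto simp: a_def)
  define \<kappa> where "\<kappa> = (p - 2) / 2"
  have \<kappa>: "\<kappa> > 0" "(\<kappa> + 1) * (2 / p) = 1" using p by (auto simp: \<kappa>_def field_simps)
  define \<theta> where "\<theta> = \<kappa> * a"
  have \<theta>: "\<theta> > 0" using \<kappa> a by (simp add: \<theta>_def)
  define w where "w = (\<lambda>x. f x powr (- \<kappa>))"
  define w1 where "w1 = (\<lambda>x. - \<kappa> * f x powr (- \<kappa> - 1) * f1 x)"
  have dw: "(w has_real_derivative w1 x) (at x)" if "c \<le> x" for x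
    unfolding w_def w1_def using DERIV_fun_powr[OF d[OF that] pos[OF that], of "- \<kappa>"] by simp
  have pw: "f x powr (- \<kappa> - 2) * (f x)\<^sup>2 = w x" "f x powr (- \<kappa> - 1) * f x = w x"
    "f x powr (- \<kappa> - 2) * f x powr p = f x powr \<kappa>"
    "f x powr (- \<kappa> - 1) * f x powr (p - 1) = f x powr \<kappa>" if "c \<le> x" for x
  proof -
    have "f x powr (- \<kappa> - 2) * f x powr 2 = f x powr (- \<kappa>)" "f x powr (- \<kappa> - 1) * f x powr 1 = f x powr (- \<kappa>)"
      unfolding powr_add[symmetric] by simp_all
    then show "f x powr (- \<kappa> - 2) * (f x)\<^sup>2 = w x" "f x powr (- \<kappa> - 1) * f x = w x"
      using pos[OF that] by (simp_all add: w_def powr_numeral)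
    have "- \<kappa> - 2 + p = \<kappa>" "- \<kappa> - 1 + (p - 1) = \<kappa>" by (auto simp: \<kappa>_def field_simps)
    then show "f x powr (- \<kappa> - 2) * f x powr p = f x powr \<kappa>"
      "f x powr (- \<kappa> - 1) * f x powr (p - 1) = f x powr \<kappa>"
      unfolding powr_add[symmetric] by (simp_all only:)
  qed
  have dw1: "(w1 has_real_derivative \<theta>\<^sup>2 * w x) (at x)" if x: "c \<le> x" for x
  proof -
    have 1: "((\<lambda>x. f x powr (- \<kappa> - 1)) has_real_derivative (- \<kappa> - 1) * f x powr (- \<kappa> - 1 - of_nat 1) * f1 x) (at x)"
      by (rule DERIV_fun_powr[OF d[OF x] pos[OF x]])
    have "(w1 has_real_derivative (- \<kappa> * f x powr (- \<kappa> - 1)) * (\<omega> * f x - f x powr (p - 1)) +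
       - \<kappa> * ((- \<kappa> - 1) * f x powr (- \<kappa> - 2) * f1 x) * f1 x) (at x)"
      unfolding w1_def
      using DERIV_mult[OF DERIV_cmult[OF 1, of "- \<kappa>"] d1[OF x]] by (simp add: algebra_simps)
    also have "(- \<kappa> * f x powr (- \<kappa> - 1)) * (\<omega> * f x - f x powr (p - 1)) +
       - \<kappa> * ((- \<kappa> - 1) * f x powr (- \<kappa> - 2) * f1 x) * f1 x
      = - \<kappa> * (\<omega> * (f x powr (- \<kappa> - 1) * f x) - f x powr (- \<kappa> - 1) * f x powr (p - 1)) +
       \<kappa> * (\<kappa> + 1) * (f x powr (- \<kappa> - 2) * (f1 x)\<^sup>2)"
      by (simp add: power2_eq_square algebra_simps)
    also have "f x powr (- \<kappa> - 2) * (f1 x)\<^sup>2 = \<omega> * w x - 2 / p * f x powr \<kappa>"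
      unfolding fi[OF x] pw(1)[OF x, symmetric] pw(3)[OF x, symmetric] by (simp add: algebra_simps)
    also have "- \<kappa> * (\<omega> * (f x powr (- \<kappa> - 1) * f x) - f x powr (- \<kappa> - 1) * f x powr (p - 1)) +
        \<kappa> * (\<kappa> + 1) * (\<omega> * w x - 2 / p * f x powr \<kappa>)
       = \<kappa>\<^sup>2 * \<omega> * w x + \<kappa> * f x powr \<kappa> * (1 - (\<kappa> + 1) * (2 / p))"
      unfolding pw(2,4)[OF x] by (simp add: power2_eq_square algebra_simps)
    also have "\<dots> = \<theta>\<^sup>2 * w x" unfolding \<kappa>(2) \<theta>_def a(2)[symmetric] by (simp add: power_mult_distrib)
    finally show ?thesis .
  qed
  \<comment> \<open>The conserved quantity of the linear equation. It factors into w1 + \<theta> w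
    and w1 - \<theta> w, and so fixes the product of the two exponential coefficients.\<close>
  have w1w: "(w1 x)\<^sup>2 - \<theta>\<^sup>2 * (w x)\<^sup>2 = - 2 * \<kappa>\<^sup>2 / p" if x: "c \<le> x" for x
  proof -
    have e: "(f x powr (- \<kappa> - 1))\<^sup>2 = f x powr (- 2 * \<kappa> - 2)" "(f x powr (- \<kappa>))\<^sup>2 = f x powr (- 2 * \<kappa>)"
      by (simp_all add: power2_eq_square flip: powr_add)
    have e2: "f x powr (- 2 * \<kappa> - 2) * (f x)\<^sup>2 = f x powr (- 2 * \<kappa>)"
    proof -
      have "f x powr (- 2 * \<kappa> - 2) * f x powr 2 = f x powr (- 2 * \<kappa>)" unfolding powr_add[symmetric] by simp
      then show ?thesis using pos[OF x] by (simp add: powr_numeral)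
    qed
    have e3: "f x powr (- 2 * \<kappa> - 2) * f x powr p = 1"
    proof -
      have "- 2 * \<kappa> - 2 + p = 0" by (simp add: \<kappa>_def field_simps)
      then show ?thesis unfolding powr_add[symmetric] using pos[OF x] by simp
    qed
    have "(w1 x)\<^sup>2 = \<kappa>\<^sup>2 * (f x powr (- 2 * \<kappa> - 2) * (f1 x)\<^sup>2)"
      unfolding w1_def power_mult_distrib e by simp
    also have "\<dots> = \<kappa>\<^sup>2 * (\<omega> * (f x powr (- 2 * \<kappa> - 2) * (f x)\<^sup>2) - 2 / p * (f x powr (- 2 * \<kappa> - 2) * f x powr p))"
      unfolding fi[OF x] by (simp add: algebra_simps)
    also have "\<dots> = \<theta>\<^sup>2 * (w x)\<^sup>2 - 2 * \<kappa>\<^sup>2 / p"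
      unfolding e2 e3 w_def e \<theta>_def power_mult_distrib a(2) by (simp add: algebra_simps)
    finally show ?thesis by simp
  qed
  have "((\<lambda>x. w1 x + \<theta> * w x) has_real_derivative \<theta> * (w1 x + \<theta> * w x)) (at x)" if "c \<le> x" for x
    using dw[OF that] dw1[OF that] by (auto intro!: derivative_eq_intros simp: power2_eq_square algebra_simps)
  then obtain C1 where C1: "\<And>x. c \<le> x \<Longrightarrow> w1 x + \<theta> * w x = C1 * exp (\<theta> * x)"
    using exp_growth_unique[of c "\<lambda>x. w1 x + \<theta> * w x" \<theta>] by blast
  have "((\<lambda>x. w1 x - \<theta> * w x) has_real_derivative - \<theta> * (w1 x - \<theta> * w x)) (at x)" if "c \<le> x" for x
    using dw[OF that] dw1[OF that] by (auto intro!: derivative_eq_intros simp: power2_eq_square algebra_simps)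
  then obtain C2 where C2: "\<And>x. c \<le> x \<Longrightarrow> w1 x - \<theta> * w x = C2 * exp (- \<theta> * x)"
    using exp_growth_unique[of c "\<lambda>x. w1 x - \<theta> * w x" "- \<theta>"] by blast
  define A B where "A = C1 / (2 * \<theta>)" and "B = - C2 / (2 * \<theta>)"
  have wAB: "w x = A * exp (\<theta> * x) + B * exp (- \<theta> * x)" if "c \<le> x" for x
    using C1[OF that] C2[OF that] \<theta> unfolding A_def B_def by (simp add: field_simps)
  have "C1 * C2 = - 2 * \<kappa>\<^sup>2 / p"
  proof -
    have "(w1 c + \<theta> * w c) * (w1 c - \<theta> * w c) = - 2 * \<kappa>\<^sup>2 / p"
      using w1w[of c] by (simp add: power2_eq_square algebra_simps)
    then show ?thesis using C1[of c] C2[of c] by (simp add: exp_minus field_simps)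
  qed
  moreover have "A * B = - (C1 * C2) / (4 * \<theta>\<^sup>2)" by (simp add: A_def B_def power2_eq_square)
  moreover have "\<theta>\<^sup>2 = \<kappa>\<^sup>2 * \<omega>" by (simp add: \<theta>_def power_mult_distrib a(2))
  ultimately have "A * B = - (- 2 * \<kappa>\<^sup>2 / p) / (4 * (\<kappa>\<^sup>2 * \<omega>))" by (simp only:)
  then have AB: "A * B = 1 / (2 * p * \<omega>)"
    using \<kappa>(1) p lam by (simp add: field_simps)
  then have ABpos: "A * B > 0" using p lam by simp
  have wc: "w c > 0" using pos[of c] by (simp add: w_def)
  \<comment> \<open>\<open>A\<close> and \<open>B\<close> have the same sign because their product
    is positive, and this sign is that of \<open>w c\<close>.\<close>
  have "A > 0"
  proof (rule ccontr)
    assume "\<not> A > 0"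
    then have "A \<le> 0" "B \<le> 0" using ABpos by (auto simp: zero_less_mult_iff)
    then have "w c \<le> 0" using wAB[of c] by (simp add: mult_nonpos_nonneg add_nonpos_nonpos)
    with wc show False by simp
  qed
  then have B: "B > 0" using ABpos by (simp add: zero_less_mult_iff)
  \<comment> \<open>This shift balances the two exponentials: A exp(\<theta> x) + B exp(-\<theta> x)
    = 2 sqrt(A B) cosh(\<theta> (x + y)).\<close>
  define y where "y = ln (A / B) / (2 * \<theta>)"
  have ey: "exp (\<theta> * y) = sqrt (A / B)"
  proof -
    have "\<theta> * y = ln (A / B) / 2" using \<theta> by (simp add: y_def)
    then show ?thesis using \<open>A > 0\<close> B by (simp add: ln_sqrt[symmetric] exp_ln)
  qed
  have sAB: "2 * sqrt (A * B) = sqrt (2 / p) / a"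
  proof -
    have "2 * sqrt (A * B) = sqrt (4 * (A * B))" by (simp add: real_sqrt_mult)
    also have "4 * (A * B) = 2 / p / \<omega>" unfolding AB using p lam by (simp add: field_simps)
    finally show ?thesis by (simp add: a_def real_sqrt_divide real_sqrt_mult)
  qed
  have "f x = prof p a (x + y)" if x: "c \<le> x" for x
  proof -
    have 1: "A = sqrt (A * B) * exp (\<theta> * y)"
      unfolding ey using \<open>A > 0\<close> B by (simp add: real_sqrt_mult real_sqrt_divide)
    have 2: "B = sqrt (A * B) * exp (- \<theta> * y)"
      using \<open>A > 0\<close> B by (simp add: exp_minus ey real_sqrt_mult real_sqrt_divide)
    have "w x = sqrt (A * B) * exp (\<theta> * y) * exp (\<theta> * x) + sqrt (A * B) * exp (- \<theta> * y) * exp (- \<theta> * x)"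
      using wAB[OF x] 1 2 by metis
    also have "\<dots> = 2 * sqrt (A * B) * cosh (\<theta> * (x + y))"
      by (simp add: cosh_def algebra_simps exp_add[symmetric])
    finally have "w x = sqrt (2 / p) / a * cosh ((p - 2) / 2 * a * (x + y))"
      unfolding sAB by (simp add: \<theta>_def \<kappa>_def)
    then have "prof p a (x + y) = w x powr (- 2 / (p - 2))" by (simp add: prof_def)
    also have "\<dots> = f x powr (- \<kappa> * (- 2 / (p - 2)))" unfolding w_def powr_powr ..
    also have "- \<kappa> * (- 2 / (p - 2)) = 1" using p by (simp add: \<kappa>_def)
    finally show ?thesis using pos[OF x] by simp
  qed
  with a that show thesis by blast
qed

text \<open>Both sides of the weak equation are second differences: with V'' = k, the sum f + V
  satisfies the midpoint identity, so it is affine and \<open>f\<close> inherits two derivatives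
  from V. The first integral is then constant, and decay of \<open>f\<close> makes it zero, which is
  the input of \<open>ode_solution_prof\<close>.\<close>

lemma weak_solution_prof:
  fixes f g :: "real \<Rightarrow> real"
  assumes p: "2 < p" and h: "h1_on {c..} f g" and pos: "\<And>x. c \<le> x \<Longrightarrow> 0 < f x"
    and weak: "\<And>m d. 0 < d \<Longrightarrow> c \<le> m - d \<Longrightarrow> 
       2 * f m - f (m - d) - f (m + d) = (LBINT x:{m - d..m + d}. (f x powr (p - 1) - \<omega> * f x) * hat m d x)"
  obtains a y where "0 < a" "a\<^sup>2 = \<omega>" "\<And>x. c \<le> x \<Longrightarrow> f x = prof p a (x + y)"
proof -
  have w: "wderiv_on {c..} f g" using h by (simp add: h1_on_def)
  have cf: "continuous_on {c..} f" by (rule wderiv_on_continuous[OF w is_interval_ci])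
  \<comment> \<open>\<open>f\<close> is continued to the left of \<open>c\<close> by the constant
    \<open>f c\<close>, so that the nonlinearity \<open>k\<close> is continuous on the whole line
    and has global antiderivatives.\<close>
  define F where "F = (\<lambda>x. f (max c x))"
  have cF: "continuous_on UNIV F"
    unfolding F_def by (rule continuous_on_compose2[OF cf]) (auto intro!: continuous_intros)
  have Fpos: "F x > 0" for x using pos[of "max c x"] by (simp add: F_def)
  define k where "k = (\<lambda>x. F x powr (p - 1) - \<omega> * F x)"
  have ck: "continuous_on UNIV k" unfolding k_def using Fpos
    by (intro continuous_intros cF) (simp add: less_imp_neq[symmetric])
  obtain K where K: "\<And>x. (K has_real_derivative k x) (at x)" using continuous_antiderivative[OF ck] by blast
  then have "continuous_on UNIV K" by (meson DERIV_isCont continuous_at_imp_continuous_on)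
  then obtain V where V: "\<And>x. (V has_real_derivative K x) (at x)" using continuous_antiderivative by blast
  then have cV: "continuous_on UNIV V" by (meson DERIV_isCont continuous_at_imp_continuous_on)
  have mid: "(f (m - d) + V (m - d)) + (f (m + d) + V (m + d)) = 2 * (f m + V m)" if "0 < d" "c \<le> m - d" for m d
  proof -
    have "(LBINT x:{m - d..m + d}. (f x powr (p - 1) - \<omega> * f x) * hat m d x) = (LBINT x:{m - d..m + d}. k x * hat m d x)"
      by (rule set_lebesgue_integral_cong) (use that in \<open>auto simp: k_def F_def max_def\<close>)
    then show ?thesis using weak[OF that] integral_hat[OF ck K V that(1)] by simp
  qed
  define \<beta> where "\<beta> = f (c + 1) + V (c + 1) - (f c + V c)"
  \<comment> \<open>\<open>\<phi>\<close> agrees with \<open>f\<close> on \<open>{c..}\<close> and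
    is differentiable on the whole line, which gives two-sided derivatives at \<open>c\<close> as
    well.\<close>
  define \<phi> where "\<phi> = (\<lambda>x. (f c + V c) + \<beta> * (x - c) - V x)"
  define \<phi>1 where "\<phi>1 = (\<lambda>x. \<beta> - K x)"
  have f\<phi>: "f x = \<phi> x" if "c \<le> x" for x
  proof -
    have "f x + V x = (f c + V c) + \<beta> * (x - c)"
      unfolding \<beta>_def
      by (rule midpoint_affine_halfline[OF _ mid that])
         (auto intro!: continuous_intros cf continuous_on_subset[OF cV])
    then show ?thesis by (simp add: \<phi>_def)
  qed
  have d\<phi>: "(\<phi> has_real_derivative \<phi>1 x) (at x)" for x
    unfolding \<phi>_def \<phi>1_def by (auto intro!: derivative_eq_intros V)
  have \<phi>pos: "0 < \<phi> x" if "c \<le> x" for x using pos f\<phi> that by metis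
  have d\<phi>1: "(\<phi>1 has_real_derivative \<omega> * \<phi> x - \<phi> x powr (p - 1)) (at x)" if "c \<le> x" for x
  proof -
    have "(\<phi>1 has_real_derivative - k x) (at x)" unfolding \<phi>1_def by (auto intro!: derivative_eq_intros K)
    moreover have "- k x = \<omega> * \<phi> x - \<phi> x powr (p - 1)" using that f\<phi>[OF that] by (simp add: k_def F_def max_def)
    ultimately show ?thesis by simp
  qed
  define h where "h = (\<lambda>x. (\<phi>1 x)\<^sup>2 - \<omega> * (\<phi> x)\<^sup>2 + 2 / p * \<phi> x powr p)"
  have "\<exists>C. \<forall>x\<in>{c..}. h x = C"
  proof (rule has_field_derivative_zero_constant)
    fix x assume "x \<in> {c..}"
    then have x: "c \<le> x" by simp
    have dP: "((\<lambda>x. \<phi> x powr p) has_real_derivative p * \<phi> x powr (p - of_nat 1) * \<phi>1 x) (at x)"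
      by (rule DERIV_fun_powr[OF d\<phi> \<phi>pos[OF x]])
    have "(h has_real_derivative (2 * \<phi>1 x * (\<omega> * \<phi> x - \<phi> x powr (p - 1)) - \<omega> * (2 * \<phi> x * \<phi>1 x)
        + 2 / p * (p * \<phi> x powr (p - 1) * \<phi>1 x))) (at x)"
      unfolding h_def
      using DERIV_add[OF DERIV_diff[OF DERIV_power[OF d\<phi>1[OF x], of 2] DERIV_cmult[OF DERIV_power[OF d\<phi>[of x], of 2], of \<omega>]] DERIV_cmult[OF dP, of "2 / p"]]
      by (simp add: mult_ac)
    also have "(2 * \<phi>1 x * (\<omega> * \<phi> x - \<phi> x powr (p - 1)) - \<omega> * (2 * \<phi> x * \<phi>1 x)
        + 2 / p * (p * \<phi> x powr (p - 1) * \<phi>1 x)) = 0" using p by (simp add: algebra_simps)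
    finally show "(h has_real_derivative 0) (at x within {c..})" by (rule has_field_derivative_at_within)
  qed simp
  then obtain C where C: "\<And>x. c \<le> x \<Longrightarrow> h x = C" by auto
  have lim: "(f \<longlongrightarrow> 0) at_top" by (rule h1_on_tendsto_0[OF assms(2)])
  \<comment> \<open>Decay of the derivative is not known beforehand. The mean value theorem gives
    points going to infinity at which it equals an increment of \<open>f\<close>, and along these
    the first integral tends to 0.\<close>
  have "\<exists>z>c + real n. z < c + real n + 1 \<and> \<phi> (c + real n + 1) - \<phi> (c + real n) = \<phi>1 z" for n
    using MVT2[of "c + real n" "c + real n + 1" \<phi> \<phi>1] d\<phi> by auto
  then obtain X where X: "\<And>n. X n > c + real n" "\<And>n. \<phi> (c + real n + 1) - \<phi> (c + real n) = \<phi>1 (X n)"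
    by metis
  have t0: "filterlim (\<lambda>n. c + real n) at_top sequentially"
    by (rule filterlim_tendsto_add_at_top[OF tendsto_const filterlim_real_sequentially])
  then have t1: "filterlim (\<lambda>n. 1 + (c + real n)) at_top sequentially"
    by (rule filterlim_tendsto_add_at_top[OF tendsto_const])
  have tX: "filterlim X at_top sequentially"
    by (rule filterlim_at_top_mono[OF t0]) (use X(1) less_imp_le in \<open>auto intro!: always_eventually\<close>)
  have fX: "(\<lambda>n. \<phi> (X n)) \<longlonglongrightarrow> 0"
  proof (rule Lim_transform_eventually[OF filterlim_compose[OF lim tX]])
    have "c \<le> X n" for n using X(1)[of n] of_nat_0_le_iff[of n, where ?'a=real] by linarith
    then show "\<forall>\<^sub>F n in sequentially. f (X n) = \<phi> (X n)" using f\<phi> by auto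
  qed
  have f1X: "(\<lambda>n. \<phi>1 (X n)) \<longlonglongrightarrow> 0"
  proof (rule Lim_transform_eventually)
    show "(\<lambda>n. f (1 + (c + real n)) - f (c + real n)) \<longlonglongrightarrow> 0"
      using tendsto_diff[OF filterlim_compose[OF lim t1] filterlim_compose[OF lim t0]] by simp
    show "\<forall>\<^sub>F n in sequentially. f (1 + (c + real n)) - f (c + real n) = \<phi>1 (X n)"
      using X(2) f\<phi> by (auto intro!: always_eventually simp: add_ac)
  qed
  have "(\<lambda>n. \<bar>\<phi> (X n)\<bar> powr p) \<longlonglongrightarrow> \<bar>0\<bar> powr p"
    using p by (intro tendsto_powr' tendsto_rabs fX tendsto_const) (auto intro!: always_eventually)
  then have t: "(\<lambda>n. \<bar>\<phi> (X n)\<bar> powr p) \<longlonglongrightarrow> 0" by simp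
  have "(\<lambda>n. \<phi> (X n) powr p) \<longlonglongrightarrow> 0"
  proof (rule Lim_transform_eventually[OF t])
    have "c \<le> X n" for n using X(1)[of n] of_nat_0_le_iff[of n, where ?'a=real] by linarith
    then show "\<forall>\<^sub>F n in sequentially. \<bar>\<phi> (X n)\<bar> powr p = \<phi> (X n) powr p" 
      using \<phi>pos by (auto intro!: always_eventually simp: less_imp_le)
  qed
  then have "(\<lambda>n. h (X n)) \<longlonglongrightarrow> 0\<^sup>2 - \<omega> * 0\<^sup>2 + 2 / p * 0"
    unfolding h_def by (intro tendsto_intros fX f1X)
  moreover have "h (X n) = C" for n using X(1)[of n] of_nat_0_le_iff[of n, where ?'a=real] by (intro C) linarith
  ultimately have "C = 0" by (simp add: LIMSEQ_const_iff)
  then have fi: "(\<phi>1 x)\<^sup>2 = \<omega> * (\<phi> x)\<^sup>2 - 2 / p * \<phi> x powr p" if "c \<le> x" for x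
    using C[OF that] by (simp add: h_def)
  obtain a y where "0 < a" "a\<^sup>2 = \<omega>" "\<And>x. c \<le> x \<Longrightarrow> \<phi> x = prof p a (x + y)"
    using ode_solution_prof[OF p \<phi>pos d\<phi> d\<phi>1 fi] by blast
  with that f\<phi> show thesis by metis
qed

section \<open>The Euler--Lagrange equation\<close>

text \<open>Convexity gives an affine bound from below. As the power enters the energy with a minus
  sign, this is the side required, and differentiation under the integral is avoided. If a + b \<le>
  0 the left-hand side is already nonpositive, since a + p b \<le> (1 - p) a.\<close>

lemma powr_tangent_le:
  fixes a b p :: real
  assumes "0 < a" "1 \<le> p"
  shows "a powr p + p * (a powr (p - 1) * b) \<le> \<bar>a + b\<bar> powr p"
proof (cases "a + b > 0")
  case True
  have "1 + p * ((a + b) / a - 1) \<le> ((a + b) / a) powr p"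
    by (rule Bernoulli_powr) (use assms True in auto)
  also have "\<dots> = (a + b) powr p / a powr p" by (rule powr_divide)
  finally have "a powr p * (1 + p * ((a + b) / a - 1)) \<le> (a + b) powr p"
    using assms by (simp add: field_simps)
  moreover have "a powr p * (1 + p * ((a + b) / a - 1)) = a powr p + p * (a powr (p - 1) * b)"
    using assms by (simp add: powr_diff field_simps)
  ultimately show ?thesis using True by simp
next
  case False
  have "a powr p = a powr (p - 1) * a" using assms by (simp add: powr_diff)
  then have "a powr p + p * (a powr (p - 1) * b) = a powr (p - 1) * (a + p * b)" by (simp add: algebra_simps)
  also have "\<dots> \<le> 0"
  proof (rule mult_nonneg_nonpos)
    have "p * b \<le> p * (- a)" using False assms by (intro mult_left_mono) auto
    also have "\<dots> \<le> 1 * (- a)" using assms by simp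
    finally show "a + p * b \<le> 0" by simp
  qed simp
  finally show ?thesis by (rule order_trans) simp
qed

text \<open>For a direction h, \<open>a1\<close>, \<open>b1\<close>, \<open>c1\<close> stand for the
  integrals of g h', f^(p-1) h and f h. The factor \<open>s\<close> restores the mass, s^2 =
  \<mu>/D(\<epsilon>), so the right-hand side becomes an explicit function G of \<epsilon> that has
  a local minimum at 0. Solving G'(0) = 0 for \<open>a1\<close> produces the multiplier (B -
  A)/\<mu>.\<close>

lemma first_variation_zero:
  fixes \<mu> p :: real
  assumes \<mu>: "0 < \<mu>" and p: "2 < p"
    and min: "\<And>s \<epsilon>. 0 < s \<Longrightarrow> s\<^sup>2 * (\<mu> + 2 * \<epsilon> * c1 + \<epsilon>\<^sup>2 * c2) = \<mu> \<Longrightarrow>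
      1/2 * A - 1/p * B \<le> 1/2 * (s\<^sup>2 * (A + 2 * \<epsilon> * a1 + \<epsilon>\<^sup>2 * a2)) - 1/p * (s powr p * (B + p * \<epsilon> * b1))"
  shows "a1 = b1 - (B - A) / \<mu> * c1"
proof -
  define D where "D = (\<lambda>\<epsilon>. \<mu> + 2 * \<epsilon> * c1 + \<epsilon>\<^sup>2 * c2)"
  define q where "q = (\<lambda>\<epsilon>. \<mu> / D \<epsilon>)"
  define G where "G = (\<lambda>\<epsilon>. 1/2 * (q \<epsilon> * (A + 2 * \<epsilon> * a1 + \<epsilon>\<^sup>2 * a2)) - 1/p * (q \<epsilon> powr (p / 2) * (B + p * \<epsilon> * b1)))"
  have D0: "D 0 = \<mu>" "q 0 = 1" using \<mu> by (auto simp: D_def q_def)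
  have dD: "(D has_real_derivative 2 * c1) (at 0)" unfolding D_def by (auto intro!: derivative_eq_intros)
  have dq: "(q has_real_derivative - (2 * c1) / \<mu>) (at 0)"
    unfolding q_def using \<mu> D0 by (auto intro!: derivative_eq_intros dD simp: field_simps power2_eq_square)
  have dqp: "((\<lambda>\<epsilon>. q \<epsilon> powr (p / 2)) has_real_derivative - (p * c1) / \<mu>) (at 0)"
    using DERIV_fun_powr[OF dq, of "p / 2"] D0 by simp
  have dG: "(G has_real_derivative (1/2 * (- (2 * c1) / \<mu> * A + 2 * a1) - 1/p * (- (p * c1) / \<mu> * B + p * b1))) (at 0)"
    unfolding G_def using D0 p by (auto intro!: derivative_eq_intros dq dqp)
  have "isCont D 0" using dD by (rule DERIV_isCont)
  then have "(D \<longlongrightarrow> D 0) (nhds 0)" unfolding isCont_def tendsto_at_iff_tendsto_nhds .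
  then have "(D \<longlongrightarrow> \<mu>) (nhds 0)" unfolding D0 .
  then have "\<forall>\<^sub>F \<epsilon> in nhds 0. 0 < D \<epsilon>" using \<mu> by (rule order_tendstoD)
  then obtain r where r: "0 < r" "\<And>\<epsilon>. \<bar>\<epsilon>\<bar> < r \<Longrightarrow> 0 < D \<epsilon>"
    unfolding eventually_nhds_metric by (auto simp: dist_real_def)
  have "1/2 * (- (2 * c1) / \<mu> * A + 2 * a1) - 1/p * (- (p * c1) / \<mu> * B + p * b1) = 0"
  proof (rule DERIV_local_min[OF dG r(1)], intro allI impI)
    fix \<epsilon> :: real assume "\<bar>0 - \<epsilon>\<bar> < r"
    then have D: "D \<epsilon> > 0" using r by simp
    then have q: "q \<epsilon> > 0" using \<mu> by (simp add: q_def)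
    have 1: "(sqrt (q \<epsilon>))\<^sup>2 = q \<epsilon>" using q by simp
    have 2: "sqrt (q \<epsilon>) powr p = q \<epsilon> powr (p / 2)" using q by (simp add: powr_half_sqrt[symmetric] powr_powr)
    have "q \<epsilon> * (\<mu> + 2 * \<epsilon> * c1 + \<epsilon>\<^sup>2 * c2) = \<mu>" using D by (simp add: q_def D_def)
    then have "1/2 * A - 1/p * B \<le> G \<epsilon>"
      using min[of "sqrt (q \<epsilon>)" \<epsilon>] q unfolding 1 2 G_def by simp
    then show "G 0 \<le> G \<epsilon>" using D0 by (simp add: G_def)
  qed
  moreover have "1/p * (- (p * c1) / \<mu> * B + p * b1) = - (c1 / \<mu> * B) + b1" using p by (simp add: field_simps)
  moreover have "1/2 * (- (2 * c1) / \<mu> * A + 2 * a1) = - (c1 / \<mu> * A) + a1" by simp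
  moreover have "(B - A) / \<mu> * c1 = c1 / \<mu> * B - c1 / \<mu> * A" by (simp add: diff_divide_distrib algebra_simps)
  ultimately show ?thesis by linarith
qed

section \<open>Tents as test functions\<close>

lemma hat_bounds: "0 \<le> d \<Longrightarrow> 0 \<le> hat m d x \<and> hat m d x \<le> d"
  by (auto simp: hat_def)

lemma hat_outside: "x \<notin> {m - d..m + d} \<Longrightarrow> hat m d x = 0" "x \<notin> {m - d..m + d} \<Longrightarrow> 0 \<le> d \<Longrightarrow> dhat m d x = 0"
  by (auto simp: hat_def dhat_def max_def abs_if)

lemma continuous_hat: "continuous_on S (hat m d)"
  unfolding hat_def by (intro continuous_intros)

lemma dhat_measurable: "dhat m d \<in> borel_measurable borel"
  unfolding dhat_def by measurable

lemma hat_deriv: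
  assumes "0 < d" "x \<notin> {m - d, m, m + d}"
  shows "(hat m d has_real_derivative dhat m d x) (at x)"
proof -
  consider "x < m - d" | "m - d < x" "x < m" | "m < x" "x < m + d" | "m + d < x"
    using assms by fastforce
  then show ?thesis
  proof cases
    case 1
    have "((\<lambda>_. 0) has_real_derivative dhat m d x) (at x)" using 1 assms by (simp add: dhat_def)
    then show ?thesis
      by (rule DERIV_cong_ev[THEN iffD1, rotated -1, OF _ refl _ refl])
         (use 1 assms eventually_nhds_in_open[of "{..<m - d}" x] in \<open>auto elim!: eventually_mono simp: hat_def\<close>)
  next
    case 2
    have "((\<lambda>x. d - (m - x)) has_real_derivative dhat m d x) (at x)" using 2 assms
      by (auto intro!: derivative_eq_intros simp: dhat_def)
    then show ?thesis
      by (rule DERIV_cong_ev[THEN iffD1, rotated -1, OF _ refl _ refl])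
         (use 2 assms eventually_nhds_in_open[of "{m - d<..<m}" x] in \<open>auto elim!: eventually_mono simp: hat_def\<close>)
  next
    case 3
    have "((\<lambda>x. d - (x - m)) has_real_derivative dhat m d x) (at x)" using 3 assms
      by (auto intro!: derivative_eq_intros simp: dhat_def)
    then show ?thesis
      by (rule DERIV_cong_ev[THEN iffD1, rotated -1, OF _ refl _ refl])
         (use 3 assms eventually_nhds_in_open[of "{m<..<m + d}" x] in \<open>auto elim!: eventually_mono simp: hat_def\<close>)
  next
    case 4
    have "((\<lambda>_. 0) has_real_derivative dhat m d x) (at x)" using 4 assms by (simp add: dhat_def)
    then show ?thesis
      by (rule DERIV_cong_ev[THEN iffD1, rotated -1, OF _ refl _ refl])
         (use 4 assms eventually_nhds_in_open[of "{m + d<..}" x] in \<open>auto elim!: eventually_mono simp: hat_def\<close>)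
  qed
qed

lemma wderiv_on_hat:
  assumes "0 < d" "is_interval I"
  shows "wderiv_on I (hat m d) (dhat m d)"
proof (rule piecewise_C1_wderiv_on[OF assms(2), of "{m - d, m, m + d}"])
  show "(hat m d has_real_derivative dhat m d x) (at x)" if "x \<in> I - {m - d, m, m + d}" for x
    using hat_deriv[OF assms(1)] that by blast
  show "\<exists>B. \<forall>x\<in>{a..b}. \<bar>dhat m d x\<bar> \<le> B" for a b
    by (rule exI[of _ 1]) (simp add: dhat_def)
qed (simp_all add: continuous_hat dhat_measurable)

lemma set_integral_vanish_outside:
  fixes h :: "real \<Rightarrow> real"
  assumes "J \<subseteq> I" "\<And>x. x \<in> I - J \<Longrightarrow> h x = 0"
  shows "set_integrable lborel I h \<longleftrightarrow> set_integrable lborel J h" "(LBINT x:I. h x) = (LBINT x:J. h x)"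
proof -
  have "(\<lambda>x. indicator I x *\<^sub>R h x) = (\<lambda>x. indicator J x *\<^sub>R h x)"
    using assms by (auto split: split_indicator simp: fun_eq_iff)
  then show "set_integrable lborel I h \<longleftrightarrow> set_integrable lborel J h" "(LBINT x:I. h x) = (LBINT x:J. h x)"
    unfolding set_integrable_def set_lebesgue_integral_def by simp_all
qed

lemma set_integrable_mult_hat:
  assumes "continuous_on {m - d..m + d} k" "{m - d..m + d} \<subseteq> I"
  shows "set_integrable lborel I (\<lambda>x. k x * hat m d x)"
  by (subst set_integral_vanish_outside[OF assms(2)])
     (auto simp: hat_outside intro!: borel_integrable_atLeastAtMost' continuous_intros continuous_hat assms)

text \<open>\<open>dhat\<close> is 1 before the peak and -1 after it, so integrating
  \<open>g\<close> against it telescopes to values of \<open>f\<close>.\<close>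

lemma dhat_integrals:
  assumes d: "0 < d" and J: "{m - d..m + d} \<subseteq> I" and w: "wderiv_on I f g"
  shows "set_integrable lborel I (\<lambda>x. g x * dhat m d x)"
    and "(LBINT x:I. g x * dhat m d x) = 2 * f m - f (m - d) - f (m + d)"
    and "set_integrable lborel I (\<lambda>x. (dhat m d x)\<^sup>2)"
proof -
  have sub: "{m - d..m} \<subseteq> I" "{m..m + d} \<subseteq> I" using J d by auto
  have i1: "set_integrable lborel {m - d..m} g" "f m - f (m - d) = (LBINT x:{m - d..m}. g x)"
    using w sub d unfolding wderiv_on_def by auto
  have i2: "set_integrable lborel {m..m + d} g" "f (m + d) - f m = (LBINT x:{m..m + d}. g x)"
    using w sub d unfolding wderiv_on_def by auto
  \<comment> \<open>The right piece is half-open because \<open>dhat\<close> takes the value 1 at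
    \<open>m\<close> itself.\<close>
  have i3: "set_integrable lborel {m<..m + d} g" by (rule set_integrable_subset[OF i2(1)]) auto
  have i3': "(LBINT x:{m<..m + d}. g x) = (LBINT x:{m..m + d}. g x)"
    by (rule set_integral_discrete_difference[of "{m}"]) (use d in auto)
  let ?h = "\<lambda>x. g x * dhat m d x"
  have j1: "set_integrable lborel {m - d..m} ?h" 
    using i1(1) by (rule set_integrable_cong[THEN iffD1, rotated -1, OF _ refl refl]) (auto simp: dhat_def)
  have j2: "set_integrable lborel {m<..m + d} ?h" 
    using set_integrable_mult_right[OF i3, of "-1"]
    by (rule set_integrable_cong[THEN iffD1, rotated -1, OF _ refl refl]) (auto simp: dhat_def)
  have v1: "(LBINT x:{m - d..m}. ?h x) = (LBINT x:{m - d..m}. g x)"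
    by (rule set_lebesgue_integral_cong) (auto simp: dhat_def)
  have v2: "(LBINT x:{m<..m + d}. ?h x) = (LBINT x:{m<..m + d}. - g x)"
    by (rule set_lebesgue_integral_cong) (auto simp: dhat_def)
  have un: "{m - d..m + d} = {m - d..m} \<union> {m<..m + d}" using d by auto
  have "set_integrable lborel {m - d..m + d} ?h"
    unfolding un by (rule set_integrable_Un[OF j1 j2]) auto
  then show "set_integrable lborel I ?h"
    by (subst set_integral_vanish_outside(1)[OF J]) (use d in \<open>auto simp: hat_outside(2)\<close>)
  have "(LBINT x:I. ?h x) = (LBINT x:{m - d..m + d}. ?h x)"
    by (rule set_integral_vanish_outside(2)[OF J]) (use d in \<open>auto simp: hat_outside(2)\<close>)
  also have "\<dots> = (LBINT x:{m - d..m}. ?h x) + (LBINT x:{m<..m + d}. ?h x)"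
    unfolding un by (rule set_integral_Un[OF _ j1 j2]) auto
  also have "\<dots> = 2 * f m - f (m - d) - f (m + d)"
    unfolding v1 v2 set_integral_uminus[OF i3] i3' using i1(2) i2(2) by simp
  finally show "(LBINT x:I. ?h x) = 2 * f m - f (m - d) - f (m + d)" .
  have "set_integrable lborel {m - d..m + d} (\<lambda>x. (dhat m d x)\<^sup>2)"
    using borel_integrable_atLeastAtMost'[OF continuous_on_const[of "{m - d..m + d}" 1]]
    by (rule set_integrable_cong[THEN iffD1, rotated -1, OF _ refl refl]) (auto simp: dhat_def)
  then show "set_integrable lborel I (\<lambda>x. (dhat m d x)\<^sup>2)"
    by (subst set_integral_vanish_outside(1)[OF J]) (use d in \<open>auto simp: hat_outside(2)\<close>)
qed

lemma set_integral_square_affine: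
  fixes f h :: "real \<Rightarrow> real"
  assumes "set_integrable lborel I (\<lambda>x. (f x)\<^sup>2)" "set_integrable lborel I (\<lambda>x. f x * h x)" "set_integrable lborel I (\<lambda>x. (h x)\<^sup>2)"
  shows "(LBINT x:I. (s * (f x + \<epsilon> * h x))\<^sup>2) =
      s\<^sup>2 * ((LBINT x:I. (f x)\<^sup>2) + 2 * \<epsilon> * (LBINT x:I. f x * h x) + \<epsilon>\<^sup>2 * (LBINT x:I. (h x)\<^sup>2))"
    and "set_integrable lborel I (\<lambda>x. (s * (f x + \<epsilon> * h x))\<^sup>2)"
proof -
  have e: "(\<lambda>x. (s * (f x + \<epsilon> * h x))\<^sup>2) = (\<lambda>x. s\<^sup>2 * ((f x)\<^sup>2 + 2 * \<epsilon> * (f x * h x) + \<epsilon>\<^sup>2 * (h x)\<^sup>2))"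
    by (simp add: fun_eq_iff power2_eq_square algebra_simps)
  have i: "set_integrable lborel I (\<lambda>x. 2 * \<epsilon> * (f x * h x))" "set_integrable lborel I (\<lambda>x. \<epsilon>\<^sup>2 * (h x)\<^sup>2)"
    using assms by auto
  have "(LBINT x:I. (f x)\<^sup>2 + 2 * \<epsilon> * (f x * h x) + \<epsilon>\<^sup>2 * (h x)\<^sup>2) =
    (LBINT x:I. (f x)\<^sup>2) + 2 * \<epsilon> * (LBINT x:I. f x * h x) + \<epsilon>\<^sup>2 * (LBINT x:I. (h x)\<^sup>2)"
    using set_integral_add(2)[OF set_integral_add(1)[OF assms(1) i(1)] i(2)] set_integral_add(2)[OF assms(1) i(1)] by simp
  then show "(LBINT x:I. (s * (f x + \<epsilon> * h x))\<^sup>2) =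
      s\<^sup>2 * ((LBINT x:I. (f x)\<^sup>2) + 2 * \<epsilon> * (LBINT x:I. f x * h x) + \<epsilon>\<^sup>2 * (LBINT x:I. (h x)\<^sup>2))"
    unfolding e by simp
  show "set_integrable lborel I (\<lambda>x. (s * (f x + \<epsilon> * h x))\<^sup>2)"
    unfolding e using set_integral_add(1)[OF set_integral_add(1)[OF assms(1) i(1)] i(2)] by (rule set_integrable_mult_right)
qed

text \<open>The numbers \<open>rM\<close>, \<open>rA\<close>, \<open>rB\<close> stand for the contributions of the edges on which the perturbation vanishes.\<close>
lemma weak_euler_lagrange:
  fixes f g :: "real \<Rightarrow> real"
  assumes p: "2 < p" and I: "closed I" "is_interval I" "\<And>x. x \<in> I \<Longrightarrow> \<exists>a. x \<in> {a..a + 1} \<and> {a..a + 1} \<subseteq> I"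
    and h: "h1_on I f g" and pos: "\<And>x. x \<in> I \<Longrightarrow> 0 < f x"
    and d: "0 < d" and J: "{m - d..m + d} \<subseteq> I"
    and \<mu>: "\<mu> = rM + (LBINT x:I. (f x)\<^sup>2)" "0 < \<mu>"
    and min: "\<And>s \<epsilon>. 0 < s \<Longrightarrow> s\<^sup>2 * rM + (LBINT x:I. (s * (f x + \<epsilon> * hat m d x))\<^sup>2) = \<mu> \<Longrightarrow>
      1/2 * (rA + (LBINT x:I. (g x)\<^sup>2)) - 1/p * (rB + (LBINT x:I. \<bar>f x\<bar> powr p)) \<le>
      1/2 * (s\<^sup>2 * rA + (LBINT x:I. (s * (g x + \<epsilon> * dhat m d x))\<^sup>2))
        - 1/p * (s powr p * rB + (LBINT x:I. \<bar>s * (f x + \<epsilon> * hat m d x)\<bar> powr p))"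
  defines "\<omega> \<equiv> ((rB + (LBINT x:I. \<bar>f x\<bar> powr p)) - (rA + (LBINT x:I. (g x)\<^sup>2))) / \<mu>"
  shows "2 * f m - f (m - d) - f (m + d) = (LBINT x:{m - d..m + d}. (f x powr (p - 1) - \<omega> * f x) * hat m d x)"
proof -
  have w: "wderiv_on I f g" and ig: "set_integrable lborel I (\<lambda>x. (g x)\<^sup>2)" and i_f: "set_integrable lborel I (\<lambda>x. (f x)\<^sup>2)"
    using h unfolding h1_on_def by auto
  have cf: "continuous_on I f" by (rule wderiv_on_continuous[OF w I(2)])
  then have cJ: "continuous_on {m - d..m + d} f" using J continuous_on_subset by blast
  have cJp: "continuous_on {m - d..m + d} (\<lambda>x. f x powr (p - 1))"
    by (intro continuous_intros cJ) (use pos J in \<open>auto simp: less_imp_neq[symmetric]\<close>)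
  have if_h: "set_integrable lborel I (\<lambda>x. f x * hat m d x)" by (rule set_integrable_mult_hat[OF cJ J])
  have ihh: "set_integrable lborel I (\<lambda>x. (hat m d x)\<^sup>2)"
    unfolding power2_eq_square by (rule set_integrable_mult_hat[OF continuous_hat J])
  have iph: "set_integrable lborel I (\<lambda>x. f x powr (p - 1) * hat m d x)" by (rule set_integrable_mult_hat[OF cJp J])
  note dh = dhat_integrals[OF d J w]
  note sq = set_integral_square_affine(1)[OF i_f if_h ihh] set_integral_square_affine(1)[OF ig dh(1,3)]
  obtain B where B: "\<And>x. x \<in> I \<Longrightarrow> \<bar>f x\<bar> \<le> B" using h1_on_bounded[OF h I(3)] by blast
  have ip: "set_integrable lborel I (\<lambda>x. \<bar>f x\<bar> powr p)" by (rule h1_on_powr_integrable[OF h B I(1,2)]) (use p in auto)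
  \<comment> \<open>The tangent bound under the integral; homogeneity of the p-th power takes out
    the factor \<open>s powr p\<close>.\<close>
  have lower: "s powr p * ((LBINT x:I. \<bar>f x\<bar> powr p) + p * \<epsilon> * (LBINT x:I. f x powr (p - 1) * hat m d x))
      \<le> (LBINT x:I. \<bar>s * (f x + \<epsilon> * hat m d x)\<bar> powr p)" if "0 < s" for s \<epsilon>
  proof -
    have hw: "h1_on I (\<lambda>x. 1 * f x + \<epsilon> * hat m d x) (\<lambda>x. 1 * g x + \<epsilon> * dhat m d x)"
      unfolding h1_on_def
      using wderiv_on_add_scaled[OF w wderiv_on_hat[OF d I(2)], of 1 \<epsilon>] set_integral_square_affine(2)[OF i_f if_h ihh, of 1 \<epsilon>]
       set_integral_square_affine(2)[OF ig dh(1,3), of 1 \<epsilon>] by simp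
    have "\<bar>1 * f x + \<epsilon> * hat m d x\<bar> \<le> B + \<bar>\<epsilon>\<bar> * d" if "x \<in> I" for x
    proof -
      have "\<bar>\<epsilon> * hat m d x\<bar> \<le> \<bar>\<epsilon>\<bar> * d" unfolding abs_mult using hat_bounds[of d m x] d by (intro mult_left_mono) auto
      then show ?thesis using B[OF that] by linarith
    qed
    from h1_on_powr_integrable[OF hw this I(1,2)] p
    have iw: "set_integrable lborel I (\<lambda>x. \<bar>f x + \<epsilon> * hat m d x\<bar> powr p)" by simp
    have ie: "set_integrable lborel I (\<lambda>x. p * \<epsilon> * (f x powr (p - 1) * hat m d x))" using iph by auto
    have "(LBINT x:I. \<bar>f x\<bar> powr p) + p * \<epsilon> * (LBINT x:I. f x powr (p - 1) * hat m d x)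
      = (LBINT x:I. \<bar>f x\<bar> powr p + p * \<epsilon> * (f x powr (p - 1) * hat m d x))"
      using set_integral_add(2)[OF ip ie] by simp
    also have "\<dots> \<le> (LBINT x:I. \<bar>f x + \<epsilon> * hat m d x\<bar> powr p)"
    proof (rule set_integral_mono[OF set_integral_add(1)[OF ip ie] iw])
      fix x assume x: "x \<in> I"
      show "\<bar>f x\<bar> powr p + p * \<epsilon> * (f x powr (p - 1) * hat m d x) \<le> \<bar>f x + \<epsilon> * hat m d x\<bar> powr p"
        using powr_tangent_le[OF pos[OF x], of p "\<epsilon> * hat m d x"] p pos[OF x] by (simp add: mult_ac)
    qed
    finally have le: "(LBINT x:I. \<bar>f x\<bar> powr p) + p * \<epsilon> * (LBINT x:I. f x powr (p - 1) * hat m d x)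
       \<le> (LBINT x:I. \<bar>f x + \<epsilon> * hat m d x\<bar> powr p)" .
    have "(LBINT x:I. \<bar>s * (f x + \<epsilon> * hat m d x)\<bar> powr p) = (LBINT x:I. s powr p * \<bar>f x + \<epsilon> * hat m d x\<bar> powr p)"
      using \<open>0 < s\<close> by (simp add: abs_mult powr_mult)
    also have "\<dots> = s powr p * (LBINT x:I. \<bar>f x + \<epsilon> * hat m d x\<bar> powr p)" by simp
    finally show ?thesis using le by (simp add: mult_left_mono)
  qed
  let ?c1 = "LBINT x:I. f x * hat m d x" and ?b1 = "LBINT x:I. f x powr (p - 1) * hat m d x"
    and ?a1 = "LBINT x:I. g x * dhat m d x"
  let ?A = "rA + (LBINT x:I. (g x)\<^sup>2)" and ?B = "rB + (LBINT x:I. \<bar>f x\<bar> powr p)"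
  have "?a1 = ?b1 - (?B - ?A) / \<mu> * ?c1"
  proof (rule first_variation_zero[OF \<mu>(2) p])
    fix s \<epsilon> :: real assume s: "0 < s"
      and eq: "s\<^sup>2 * (\<mu> + 2 * \<epsilon> * ?c1 + \<epsilon>\<^sup>2 * (LBINT x:I. (hat m d x)\<^sup>2)) = \<mu>"
    have "s\<^sup>2 * rM + (LBINT x:I. (s * (f x + \<epsilon> * hat m d x))\<^sup>2) = \<mu>"
      unfolding sq using eq unfolding \<mu>(1) by (simp add: algebra_simps)
    from min[OF s this]
    have "1/2 * ?A - 1/p * ?B \<le> 1/2 * (s\<^sup>2 * (?A + 2 * \<epsilon> * ?a1 + \<epsilon>\<^sup>2 * (LBINT x:I. (dhat m d x)\<^sup>2)))
        - 1/p * (s powr p * rB + (LBINT x:I. \<bar>s * (f x + \<epsilon> * hat m d x)\<bar> powr p))"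
      unfolding sq by (simp add: algebra_simps)
    also have "\<dots> \<le> 1/2 * (s\<^sup>2 * (?A + 2 * \<epsilon> * ?a1 + \<epsilon>\<^sup>2 * (LBINT x:I. (dhat m d x)\<^sup>2)))
        - 1/p * (s powr p * (?B + p * \<epsilon> * ?b1))"
    proof (intro diff_left_mono mult_left_mono)
      show "s powr p * (?B + p * \<epsilon> * ?b1) \<le> s powr p * rB + (LBINT x:I. \<bar>s * (f x + \<epsilon> * hat m d x)\<bar> powr p)"
        using lower[OF s, of \<epsilon>] by (simp add: algebra_simps)
    qed (use p in auto)
    finally show "1/2 * ?A - 1/p * ?B \<le> 1/2 * (s\<^sup>2 * (?A + 2 * \<epsilon> * ?a1 + \<epsilon>\<^sup>2 * (LBINT x:I. (dhat m d x)\<^sup>2)))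
        - 1/p * (s powr p * (?B + p * \<epsilon> * ?b1))" .
  qed
  then have a1: "2 * f m - f (m - d) - f (m + d) = ?b1 - \<omega> * ?c1" unfolding dh(2) \<omega>_def .
  have if_h': "set_integrable lborel I (\<lambda>x. \<omega> * (f x * hat m d x))" using if_h by auto
  have "?b1 - \<omega> * ?c1 = (LBINT x:I. f x powr (p - 1) * hat m d x - \<omega> * (f x * hat m d x))"
    using set_integral_diff(2)[OF iph if_h'] by simp
  also have "\<dots> = (LBINT x:I. (f x powr (p - 1) - \<omega> * f x) * hat m d x)" by (simp add: algebra_simps)
  also have "\<dots> = (LBINT x:{m - d..m + d}. (f x powr (p - 1) - \<omega> * f x) * hat m d x)"
    by (rule set_integral_vanish_outside(2)[OF J]) (auto simp: hat_outside)
  finally show ?thesis using a1 by simp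
qed

section \<open>Identification of \<open>phi1\<close> and of the solitons\<close>

lemma H1R_wd_iff: "H1R_wd f g \<longleftrightarrow> h1_on UNIV f g"
  unfolding H1R_wd_def h1_on_def wderiv_on_def set_integrable_def by simp

lemma energyR_eq:
  assumes "h1_on UNIV f g"
  shows "energyR p f = 1/2 * (LINT x|lborel. (g x)\<^sup>2) - 1/p * (LINT x|lborel. \<bar>f x\<bar> powr p)"
proof -
  have "h1_on UNIV f (dR f)" unfolding dR_def H1R_wd_iff by (rule someI[of "h1_on UNIV f"]) fact
  then have "(LBINT x:UNIV. (dR f x)\<^sup>2) = (LBINT x:UNIV. (g x)\<^sup>2)"
    by (intro wderiv_on_integral_square_eq) (use assms in \<open>auto simp: h1_on_def\<close>)
  then show ?thesis unfolding energyR_def by (simp add: set_lebesgue_integral_def)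
qed

lemma h1_on_add_hat:
  assumes h: "h1_on I f g" and I: "is_interval I" and d: "0 < d" and J: "{m - d..m + d} \<subseteq> I"
  shows "h1_on I (\<lambda>x. s * (f x + \<epsilon> * hat m d x)) (\<lambda>x. s * (g x + \<epsilon> * dhat m d x))"
proof -
  have w: "wderiv_on I f g" and ig: "set_integrable lborel I (\<lambda>x. (g x)\<^sup>2)" and i_f: "set_integrable lborel I (\<lambda>x. (f x)\<^sup>2)"
    using h unfolding h1_on_def by auto
  have cf: "continuous_on {m - d..m + d} f" using wderiv_on_continuous[OF w I] J continuous_on_subset by blast
  have if_h: "set_integrable lborel I (\<lambda>x. f x * hat m d x)" by (rule set_integrable_mult_hat[OF cf J])
  have ihh: "set_integrable lborel I (\<lambda>x. (hat m d x)\<^sup>2)"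
    unfolding power2_eq_square by (rule set_integrable_mult_hat[OF continuous_hat J])
  note dh = dhat_integrals[OF d J w]
  have "wderiv_on I (\<lambda>x. s * (f x + \<epsilon> * hat m d x)) (\<lambda>x. s * (g x + \<epsilon> * dhat m d x))"
    using wderiv_on_scale[OF wderiv_on_add_scaled[OF w wderiv_on_hat[OF d I, of m], of 1 \<epsilon>], of s] by simp
  then show ?thesis unfolding h1_on_def
    using set_integral_square_affine(2)[OF i_f if_h ihh] set_integral_square_affine(2)[OF ig dh(1,3)] by blast
qed

lemma prof_mass_inj:
  assumes "2 < p" "p < 6" "0 < a" "0 < b" "prof_mass p a = prof_mass p b"
  shows "a = b"
proof -
  have "a powr ((6 - p) / (p - 2)) = b powr ((6 - p) / (p - 2))"
    using assms prof_mass_scale[of p a] prof_mass_scale[of p b] prof_mass_pos[of p 1] by simp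
  then have "(a powr ((6 - p) / (p - 2))) powr ((p - 2) / (6 - p)) = (b powr ((6 - p) / (p - 2))) powr ((p - 2) / (6 - p))" by simp
  then show ?thesis unfolding powr_powr using assms by simp
qed

text \<open>This is the uniqueness that the definite description in \<open>phi1\<close> calls for.
  The Euler-Lagrange equation makes \<open>f\<close> a translated profile, evenness removes the
  translation, and the mass fixes the frequency.\<close>

lemma even_positive_minimizer_eq_prof:
  assumes p: "2 < p" "p < 6" and b: "0 < b" "prof_mass p b = 1"
    and pos: "\<And>x. 0 < f x" and even: "\<And>x. f (- x) = f x" and H: "H1R f" and m1: "massR f = 1"
    and min: "\<And>w. H1R w \<Longrightarrow> massR w = 1 \<Longrightarrow> energyR p f \<le> energyR p w"
  shows "f = prof p b"
proof -
  obtain g where h: "h1_on UNIV f g" using H unfolding H1R_def H1R_wd_iff by blast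
  \<comment> \<open>The summands 0 and the divisor 1 match the multiplier of
    \<open>weak_euler_lagrange\<close> with no further edges and total mass 1.\<close>
  define \<omega> where "\<omega> = ((0 + (LBINT x:UNIV. \<bar>f x\<bar> powr p)) - (0 + (LBINT x:UNIV. (g x)\<^sup>2))) / (1::real)"
  have weak: "2 * f m - f (m - d) - f (m + d) = (LBINT x:{m - d..m + d}. (f x powr (p - 1) - \<omega> * f x) * hat m d x)"
    if d: "0 < d" for m d
    unfolding \<omega>_def
  proof (rule weak_euler_lagrange[OF p(1) _ _ _ h pos d, where rM=0])
    show "1 = 0 + (LBINT x:UNIV. (f x)\<^sup>2)" using m1 by (simp add: massR_def set_lebesgue_integral_def)
    show "\<exists>a. x \<in> {a..a + 1} \<and> {a..a + 1} \<subseteq> UNIV" for x :: real by (rule exI[of _ x]) simp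
    fix s \<epsilon> :: real
    assume s: "0 < s" and eq: "s\<^sup>2 * 0 + (LBINT x:UNIV. (s * (f x + \<epsilon> * hat m d x))\<^sup>2) = 1"
    have hw: "h1_on UNIV (\<lambda>x. s * (f x + \<epsilon> * hat m d x)) (\<lambda>x. s * (g x + \<epsilon> * dhat m d x))"
      by (rule h1_on_add_hat[OF h _ d]) auto
    have "energyR p f \<le> energyR p (\<lambda>x. s * (f x + \<epsilon> * hat m d x))"
      by (rule min) (use hw eq in \<open>auto simp: H1R_def H1R_wd_iff massR_def set_lebesgue_integral_def\<close>)
    then show "1/2 * (0 + (LBINT x:UNIV. (g x)\<^sup>2)) - 1/p * (0 + (LBINT x:UNIV. \<bar>f x\<bar> powr p)) \<le>
      1/2 * (s\<^sup>2 * 0 + (LBINT x:UNIV. (s * (g x + \<epsilon> * dhat m d x))\<^sup>2))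
        - 1/p * (s powr p * 0 + (LBINT x:UNIV. \<bar>s * (f x + \<epsilon> * hat m d x)\<bar> powr p))"
      unfolding energyR_eq[OF h] energyR_eq[OF hw] by (simp add: set_lebesgue_integral_def)
  qed auto
  \<comment> \<open>Starting at -1 keeps both points 1 and -1 in range; equal values there give |1 +
    y| = |-1 + y|, hence y = 0.\<close>
  obtain a y where ay: "0 < a" "\<And>x. - 1 \<le> x \<Longrightarrow> f x = prof p a (x + y)"
    using weak_solution_prof[OF p(1) h1_on_subset[OF h subset_UNIV] pos weak] by (metis atLeast_borel)
  have "prof p a (1 + y) = prof p a (- 1 + y)" using ay(2)[of 1] ay(2)[of "-1"] even[of 1] by simp
  then have "\<bar>1 + y\<bar> = \<bar>- 1 + y\<bar>" using prof_eq_iff[OF p(1) ay(1)] by simp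
  then have "y = 0" by linarith
  then have fx: "f x = prof p a x" if "0 \<le> x" for x using ay(2)[of x] that by simp
  have eq: "f = prof p a"
  proof
    fix x show "f x = prof p a x"
      using fx[of x] fx[of "- x"] even[of x] prof_even[of p a x] by (cases "0 \<le> x") auto
  qed
  then have "prof_mass p a = prof_mass p b" using m1 b(2) by (simp add: massR_def prof_mass_def)
  then have "a = b" using prof_mass_inj p ay(1) b(1) by blast
  with eq show ?thesis by simp
qed

lemma phi1_eq_prof:
  assumes p: "2 < p" "p < 6" and b: "0 < b" "prof_mass p b = 1"
  shows "phi1 p = prof p b"
  unfolding phi1_def
proof (rule the_equality)
  note h = h1_on_prof[OF p(1) b(1)]
  show "(\<forall>x. 0 < prof p b x) \<and> (\<forall>x. prof p b (- x) = prof p b x) \<and> H1R (prof p b) \<and> massR (prof p b) = 1 \<and>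
    (\<forall>w. H1R w \<and> massR w = 1 \<longrightarrow> energyR p (prof p b) \<le> energyR p w)"
  proof (intro conjI allI impI)
    show "0 < prof p b x" for x by (rule prof_pos[OF p(1) b(1)])
    show "H1R (prof p b)" using h by (auto simp: H1R_def H1R_wd_iff)
    show "massR (prof p b) = 1" using b(2) by (simp add: massR_def prof_mass_def)
    fix w assume w: "H1R w \<and> massR w = 1"
    then obtain g where g: "h1_on UNIV w g" unfolding H1R_def H1R_wd_iff by blast
    have "\<bar>prof p b x\<bar> = prof p b x" for x using prof_pos[OF p(1) b(1), of x] by simp
    then show "energyR p (prof p b) \<le> energyR p w"
      unfolding energyR_eq[OF h] energyR_eq[OF g] 
      using prof_minimizer[OF p b(1) g] w b(2) by (simp add: massR_def)
  qed (rule prof_even)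
  fix f assume "(\<forall>x. 0 < f x) \<and> (\<forall>x. f (- x) = f x) \<and> H1R f \<and> massR f = 1 \<and>
         (\<forall>w. H1R w \<and> massR w = 1 \<longrightarrow> energyR p f \<le> energyR p w)"
  then show "f = prof p b" by (intro even_positive_minimizer_eq_prof[OF p b]) auto
qed

text \<open>Let \<open>b\<close> be the frequency of the profile of mass 1 and t = a/b. For m =
  t^((6-p)/(p-2)) the two powers of \<open>m\<close> in \<open>soliton\<close> are t and
  t^(2/(p-2)), which is the scaling of \<open>prof_scale\<close>.\<close>

lemma prof_eq_soliton:
  assumes p: "2 < p" "p < 6" and a: "0 < a"
  obtains m where "0 < m" "\<And>x. soliton p m x = prof p a x"
proof -
  obtain b where b: "0 < b" "prof_mass p b = 1" using prof_mass_surj[OF p, of 1] by auto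
  define t where "t = a / b"
  have t: "t > 0" using a b by (simp add: t_def)
  define m where "m = t powr ((6 - p) / (p - 2))"
  have "(6 - p) / (p - 2) * ((p - 2) / (6 - p)) = 1" "(6 - p) / (p - 2) * (2 / (6 - p)) = 2 / (p - 2)"
    using p by (simp_all add: divide_simps)
  then have "m powr ((p - 2) / (6 - p)) = t" "m powr (2 / (6 - p)) = t powr (2 / (p - 2))"
    unfolding m_def powr_powr using t by simp_all
  then have "soliton p m x = prof p a x" for x
    unfolding soliton_def phi1_eq_prof[OF p b] using prof_scale[OF p(1) t b(1), of x] b by (simp add: t_def)
  moreover have "m > 0" using t by (simp add: m_def)
  ultimately show thesis using that by blast
qed

section \<open>Ground states on a metric graph\<close>

lemma edom_cases:
  assumes "0 < len G e"
  obtains "is_halfline G e" "edom G e = {0..}" | l where "0 < l" "edom G e = {0..l}"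
proof (cases "len G e")
  case (real r)
  then have "0 < r" "edom G e = {0..r}" using assms by (auto simp: edom_def)
  then show thesis using that by blast
next
  case PInf
  then have "is_halfline G e" "edom G e = {0..}" by (auto simp: edom_def is_halfline_def)
  then show thesis using that by blast
qed (use assms in auto)

lemma edom_halfline: "is_halfline G e \<Longrightarrow> edom G e = {0..}"
  by (auto simp: edom_def is_halfline_def)

lemma edom_props:
  assumes "0 < len G e"
  shows "closed (edom G e)" "is_interval (edom G e)" "edom G e \<subseteq> {0..}" "\<And>x. x \<in> edom G e \<Longrightarrow> {0..x} \<subseteq> edom G e"
  by (rule edom_cases[OF assms]; auto simp: is_interval_ci is_interval_cc)+

lemma H1_edge_iff:
  assumes "0 < len G e"
  shows "H1_edge (edom G e) f g \<longleftrightarrow> h1_on (edom G e) f g"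
  unfolding H1_edge_def h1_on_def
  using is_wderiv_imp_wderiv_on[OF _ edom_props(3,4)[OF assms]] wderiv_on_imp_is_wderiv[OF _ edom_props(3,4)[OF assms]]
  by blast

lemma H1_dG:
  assumes "H1 G u" "e \<in> edges G" "0 < len G e"
  shows "h1_on (edom G e) (u e) (dG G u e)"
proof -
  have "\<exists>g. H1_edge (edom G e) (u e) g" using assms by (auto simp: H1_def)
  then have "H1_edge (edom G e) (u e) (dG G u e)" unfolding dG_def by (rule someI_ex)
  then show ?thesis using H1_edge_iff[OF assms(3)] by blast
qed

lemma integral_dG_square:
  assumes "h1_on (edom G e) (u e) g" "0 < len G e"
  shows "(LBINT x:edom G e. (dG G u e x)\<^sup>2) = (LBINT x:edom G e. (g x)\<^sup>2)"
proof -
  have "H1_edge (edom G e) (u e) g" using assms(1) H1_edge_iff[OF assms(2)] by simp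
  then have "H1_edge (edom G e) (u e) (dG G u e)" unfolding dG_def by (rule someI[of "H1_edge (edom G e) (u e)"])
  then have "h1_on (edom G e) (u e) (dG G u e)" using H1_edge_iff[OF assms(2)] by simp
  then show ?thesis
    by (intro wderiv_on_integral_square_eq) (use assms edom_props in \<open>auto simp: h1_on_def\<close>)
qed

lemma halfline_vpt: "is_halfline G e \<Longrightarrow> vpt G e t \<noteq> None \<longleftrightarrow> t = 0"
  by (auto simp: vpt_def is_halfline_def)

text \<open>A half-line meets the rest of the graph only at its parameter 0, so a change
  \<open>q\<close> with q(0) = 0 respects the gluing, and the other edges merely feel the common
  factor \<open>s\<close>. There are two uses: \<open>u\<close> a ground state and \<open>q\<close>
  a tent for the Euler-Lagrange equation, and \<open>u\<close> = 0 with \<open>q\<close> a truncated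
  soliton for the energy bound.\<close>

lemma perturb_halfline:
  fixes G :: "('v, 'e) mgraph" and u :: "'e \<Rightarrow> real \<Rightarrow> real"
  assumes len: "\<forall>e\<in>edges G. 0 < len G e" and fin: "finite (edges G)" and H: "H1 G u"
    and e0: "e0 \<in> edges G" "is_halfline G e0" and q: "q 0 = 0" and s: "0 < s"
    and h: "h1_on {0..} (\<lambda>x. s * (u e0 x + q x)) g'"
  defines "w \<equiv> \<lambda>e x. s * (u e x + (if e = e0 then q x else 0))"
  shows "H1 G w"
    and "mass G w = s\<^sup>2 * (\<Sum>e\<in>edges G - {e0}. LBINT x:edom G e. (u e x)\<^sup>2) + (LBINT x:{0..}. (s * (u e0 x + q x))\<^sup>2)"
    and "energy G p w = 1/2 * (s\<^sup>2 * (\<Sum>e\<in>edges G - {e0}. LBINT x:edom G e. (dG G u e x)\<^sup>2) + (LBINT x:{0..}. (g' x)\<^sup>2))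
      - 1/p * (s powr p * (\<Sum>e\<in>edges G - {e0}. LBINT x:edom G e. \<bar>u e x\<bar> powr p) + (LBINT x:{0..}. \<bar>s * (u e0 x + q x)\<bar> powr p))"
proof -
  have h0: "h1_on (edom G e0) (w e0) g'" using h by (simp add: w_def edom_halfline[OF e0(2)])
  have h1: "h1_on (edom G e) (w e) (\<lambda>x. s * dG G u e x)" if "e \<in> edges G" "e \<noteq> e0" for e
    using H1_dG[OF H that(1) len[rule_format, OF that(1)]] that wderiv_on_scale[of _ "u e" _ s]
    unfolding h1_on_def w_def by (auto simp: power_mult_distrib)
  \<comment> \<open>Distinct parameter points are identified only at vertices, and the only vertex
    of the half-line is at 0, where \<open>q\<close> vanishes.\<close>
  have jump: "(if e = e0 then q t else 0) = (if e' = e0 then q t' else 0)" if "same_pt G e t e' t'" for e t e' t'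
  proof (cases "e = e' \<and> t = t'")
    case False
    then have v: "vpt G e t \<noteq> None" "vpt G e t = vpt G e' t'" using that unfolding same_pt_def by blast+
    then have v': "vpt G e' t' \<noteq> None" by simp
    show ?thesis using halfline_vpt[OF e0(2), of t] halfline_vpt[OF e0(2), of t'] q v(1) v' by auto
  qed auto
  have "\<exists>g. H1_edge (edom G e) (w e) g" if "e \<in> edges G" for e
    using h0 h1[OF that] H1_edge_iff[OF len[rule_format, OF that]] by (cases "e = e0") auto
  moreover have "w e t = w e' t'" if "e \<in> edges G" "t \<in> edom G e" "e' \<in> edges G" "t' \<in> edom G e'" "same_pt G e t e' t'" for e t e' t'
  proof -
    have "u e t = u e' t'" using H that unfolding H1_def by blast
    then show ?thesis unfolding w_def jump[OF that(5)] by simp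
  qed
  ultimately show "H1 G w" unfolding H1_def by blast
  have split: "(\<Sum>e\<in>edges G. F e) = (\<Sum>e\<in>edges G - {e0}. F e) + F e0" for F :: "'e \<Rightarrow> real"
    using sum.remove[OF fin e0(1), of F] by simp
  show "mass G w = s\<^sup>2 * (\<Sum>e\<in>edges G - {e0}. LBINT x:edom G e. (u e x)\<^sup>2) + (LBINT x:{0..}. (s * (u e0 x + q x))\<^sup>2)"
    unfolding mass_def split by (simp add: w_def edom_halfline[OF e0(2)] sum_distrib_left power_mult_distrib)
  have "(LBINT x:edom G e0. (dG G w e0 x)\<^sup>2) = (LBINT x:{0..}. (g' x)\<^sup>2)"
    using integral_dG_square[where u=w and e=e0, OF h0 len[rule_format, OF e0(1)]] by (simp add: edom_halfline[OF e0(2)])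
  moreover have "(\<Sum>e\<in>edges G - {e0}. LBINT x:edom G e. (dG G w e x)\<^sup>2) = s\<^sup>2 * (\<Sum>e\<in>edges G - {e0}. LBINT x:edom G e. (dG G u e x)\<^sup>2)"
    unfolding sum_distrib_left
  proof (rule sum.cong[OF refl])
    fix e assume "e \<in> edges G - {e0}"
    then have e: "e \<in> edges G" "e \<noteq> e0" by auto
    show "(LBINT x:edom G e. (dG G w e x)\<^sup>2) = s\<^sup>2 * (LBINT x:edom G e. (dG G u e x)\<^sup>2)"
      using integral_dG_square[where u=w and e=e, OF h1[OF e] len[rule_format, OF e(1)]] by (simp add: power_mult_distrib)
  qed
  moreover have "(\<Sum>e\<in>edges G - {e0}. LBINT x:edom G e. \<bar>w e x\<bar> powr p) = s powr p * (\<Sum>e\<in>edges G - {e0}. LBINT x:edom G e. \<bar>u e x\<bar> powr p)"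
    unfolding sum_distrib_left
    by (rule sum.cong) (use s in \<open>auto simp: w_def abs_mult powr_mult\<close>)
  moreover have "(LBINT x:edom G e0. \<bar>w e0 x\<bar> powr p) = (LBINT x:{0..}. \<bar>s * (u e0 x + q x)\<bar> powr p)"
    by (simp add: w_def edom_halfline[OF e0(2)])
  ultimately show "energy G p w = 1/2 * (s\<^sup>2 * (\<Sum>e\<in>edges G - {e0}. LBINT x:edom G e. (dG G u e x)\<^sup>2) + (LBINT x:{0..}. (g' x)\<^sup>2))
      - 1/p * (s powr p * (\<Sum>e\<in>edges G - {e0}. LBINT x:edom G e. \<bar>u e x\<bar> powr p) + (LBINT x:{0..}. \<bar>s * (u e0 x + q x)\<bar> powr p))"
    unfolding energy_def split by simp
qed

lemma powr_integrable_edge: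
  assumes "h1_on (edom G e) f g" "0 < len G e" "2 \<le> p"
  shows "set_integrable lborel (edom G e) (\<lambda>x. \<bar>f x\<bar> powr p)"
proof -
  have "\<exists>B. \<forall>x\<in>edom G e. \<bar>f x\<bar> \<le> B"
  proof (rule edom_cases[OF assms(2)])
    assume "edom G e = {0..}"
    then have "\<exists>a. x \<in> {a..a + 1} \<and> {a..a + 1} \<subseteq> edom G e" if "x \<in> edom G e" for x
      using that by (intro exI[of _ x]) auto
    then show ?thesis by (rule h1_on_bounded[OF assms(1)])
  next
    fix l assume l: "edom G e = {0..l}"
    then have "continuous_on {0..l} f" using assms(1) wderiv_on_continuous_Icc by (auto simp: h1_on_def)
    then have "bounded (f ` {0..l})" by (intro compact_imp_bounded compact_continuous_image compact_Icc)
    then show ?thesis unfolding l bounded_iff by auto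
  qed
  then show ?thesis using h1_on_powr_integrable[OF assms(1)] edom_props[OF assms(2)] assms(3) by metis
qed

text \<open>Continuity and positivity bound \<open>f\<close> below on a short interval at 0. This is
  what makes the final energy comparison strict in the presence of a further edge.\<close>

lemma positive_integral_edge:
  assumes h: "h1_on (edom G e) f g" and l: "0 < len G e" and p: "2 \<le> p" and pos: "\<And>x. x \<in> edom G e \<Longrightarrow> 0 < f x"
  shows "0 < (LBINT x:edom G e. \<bar>f x\<bar> powr p)"
proof -
  obtain r where r: "0 < r" "{0..r} \<subseteq> edom G e"
    by (rule edom_cases[OF l]) (auto intro: that[of 1] that)
  have "continuous_on {0..r} f" 
    using h1_on_subset[OF h r(2)] wderiv_on_continuous_Icc by (auto simp: h1_on_def)
  then obtain z where z: "z \<in> {0..r}" "\<And>x. x \<in> {0..r} \<Longrightarrow> f z \<le> f x"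
    using continuous_attains_inf[of "{0..r}" f] r by auto
  have fz: "f z > 0" using z r pos by blast
  note i = powr_integrable_edge[OF h l p]
  have "0 < f z powr p * r" using fz r by simp
  also have "\<dots> = (LBINT x:{0..r}. f z powr p)" using r by (simp add: set_lebesgue_integral_def)
  also have "\<dots> \<le> (LBINT x:{0..r}. \<bar>f x\<bar> powr p)"
  proof (rule set_integral_mono)
    show "set_integrable lborel {0..r} (\<lambda>x. f z powr p)" by (rule borel_integrable_atLeastAtMost') auto
    show "set_integrable lborel {0..r} (\<lambda>x. \<bar>f x\<bar> powr p)" by (rule set_integrable_subset[OF i _ r(2)]) auto
    show "f z powr p \<le> \<bar>f x\<bar> powr p" if "x \<in> {0..r}" for x
      using z(2)[OF that] fz p by (intro powr_mono2) auto
  qed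
  also have "\<dots> \<le> (LBINT x:edom G e. \<bar>f x\<bar> powr p)"
    by (rule set_integral_mono_set[OF i r(2)]) auto
  finally show ?thesis .
qed

text \<open>Subtracting the value at \<open>R\<close> before taking the positive part keeps the
  function continuous while confining it to \<open>{- R..R}\<close>; shifted by \<open>R\<close> it
  vanishes at 0 and fits into a half-line.\<close>

definition cut_prof :: "real \<Rightarrow> real \<Rightarrow> real \<Rightarrow> real \<Rightarrow> real" where
  "cut_prof p b R x = max 0 (prof p b x - prof p b R)"

definition dcut_prof :: "real \<Rightarrow> real \<Rightarrow> real \<Rightarrow> real \<Rightarrow> real" where
  "dcut_prof p b R x = indicator {- R..R} x * dprof p b x"

context
  fixes p b :: real
  assumes p: "2 < p" and b: "0 < b"
begin

lemma cut_prof_bounds: "0 \<le> cut_prof p b R x" "cut_prof p b R x \<le> prof p b x"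
  using prof_pos[OF p b, of x] prof_pos[OF p b, of R] by (auto simp: cut_prof_def)

lemma cut_prof_eq_0: "0 \<le> R \<Longrightarrow> R \<le> \<bar>x\<bar> \<Longrightarrow> cut_prof p b R x = 0"
  using prof_le_iff[OF p b, of x R] by (auto simp: cut_prof_def)

lemma continuous_cut_prof: "continuous_on S (cut_prof p b R)"
  unfolding cut_prof_def by (intro continuous_intros continuous_prof p b)

lemma cut_prof_measurable [measurable]: "cut_prof p b R \<in> borel_measurable borel" "dcut_prof p b R \<in> borel_measurable borel"
proof -
  show "cut_prof p b R \<in> borel_measurable borel"
    by (rule borel_measurable_continuous_onI[OF continuous_cut_prof])
  have [measurable]: "dprof p b \<in> borel_measurable borel" by (rule prof_borel_measurable[OF p b])
  show "dcut_prof p b R \<in> borel_measurable borel" unfolding dcut_prof_def by measurable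
qed

lemma cut_prof_deriv:
  assumes R: "0 < R" and x: "x \<noteq> R" "x \<noteq> - R"
  shows "(cut_prof p b R has_real_derivative dcut_prof p b R x) (at x)"
proof (cases "\<bar>x\<bar> < R")
  case True
  have d: "((\<lambda>x. prof p b x - prof p b R) has_real_derivative dcut_prof p b R x) (at x)"
  proof -
    have "x \<in> {- R..R}" using True by auto
    then have "dcut_prof p b R x = dprof p b x - 0" by (simp add: dcut_prof_def)
    then show ?thesis using DERIV_diff[OF prof_deriv[OF p b, of x] DERIV_const] by simp
  qed
  have ev: "\<forall>\<^sub>F y in nhds x. cut_prof p b R y = prof p b y - prof p b R"
  proof -
    have "\<forall>\<^sub>F y in nhds x. y \<in> {-R<..<R}" using True by (intro eventually_nhds_in_open) auto
    then show ?thesis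
    proof eventually_elim
      case (elim y)
      then have "prof p b R \<le> prof p b y" using prof_le_iff[OF p b, of R y] by auto
      then show ?case by (simp add: cut_prof_def)
    qed
  qed
  show ?thesis using DERIV_cong_ev[OF refl ev refl] d by simp
next
  case False
  then have F: "\<bar>x\<bar> > R" using x by linarith
  have d: "((\<lambda>x. 0) has_real_derivative dcut_prof p b R x) (at x)"
    using F by (auto simp: dcut_prof_def split: split_indicator)
  have ev: "\<forall>\<^sub>F y in nhds x. cut_prof p b R y = 0"
  proof -
    have "open {y::real. R < \<bar>y\<bar>}" by (intro open_Collect_less continuous_intros)
    then show ?thesis using eventually_nhds_in_open[of "{y. R < \<bar>y\<bar>}" x] F R
      by (auto elim!: eventually_mono intro!: cut_prof_eq_0)
  qed
  show ?thesis using DERIV_cong_ev[OF refl ev refl] d by simp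
qed

lemma dcut_prof_abs_le: "\<bar>dcut_prof p b R x\<bar> \<le> \<bar>dprof p b x\<bar>"
  by (auto simp: dcut_prof_def split: split_indicator)

lemma integrable_cut_prof:
  shows "integrable lborel (\<lambda>x. (cut_prof p b R x)\<^sup>2)" "integrable lborel (\<lambda>x. (dcut_prof p b R x)\<^sup>2)"
    "integrable lborel (\<lambda>x. cut_prof p b R x powr p)"
proof -
  note i = integrable_prof[OF p b]
  show "integrable lborel (\<lambda>x. (cut_prof p b R x)\<^sup>2)"
    by (rule Bochner_Integration.integrable_bound[OF i(1)])
       (use cut_prof_bounds in \<open>auto intro!: power_mono\<close>)
  show "integrable lborel (\<lambda>x. (dcut_prof p b R x)\<^sup>2)"
    by (rule Bochner_Integration.integrable_bound[OF i(2)])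
       (use dcut_prof_abs_le in \<open>auto simp: abs_le_square_iff\<close>)
  show "integrable lborel (\<lambda>x. cut_prof p b R x powr p)"
    by (rule Bochner_Integration.integrable_bound[OF i(3)])
       (use cut_prof_bounds p in \<open>auto intro!: powr_mono2\<close>)
qed

text \<open>The summand 0 is the value of the zero function, the shape in which
  \<open>perturb_halfline\<close> takes its input.\<close>

lemma h1_on_shifted_cut_prof:
  assumes R: "0 < R"
  shows "h1_on {0..} (\<lambda>x. s * (0 + cut_prof p b R (x + - R))) (\<lambda>x. s * dcut_prof p b R (x + - R))"
proof -
  have "wderiv_on {0..} (\<lambda>x. cut_prof p b R (x + - R)) (\<lambda>x. dcut_prof p b R (x + - R))"
  \<comment> \<open>The shift moves the kinks from -R and R to 0 and 2 R.\<close>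
  proof (rule piecewise_C1_wderiv_on[of _ "{0, 2 * R}"])
    show "continuous_on {0..} (\<lambda>x. cut_prof p b R (x + - R))"
      by (rule continuous_on_compose2[OF continuous_cut_prof[of UNIV]]) (auto intro!: continuous_intros)
    show "((\<lambda>x. cut_prof p b R (x + - R)) has_real_derivative dcut_prof p b R (x + - R)) (at x)"
      if "x \<in> {0..} - {0, 2 * R}" for x
      using DERIV_shift[of "cut_prof p b R" _ x "- R"] cut_prof_deriv[OF R, of "x + - R"] that by auto
    show "(\<lambda>x. dcut_prof p b R (x + - R)) \<in> borel_measurable borel" by measurable
    fix c d :: real
    have "bounded (dprof p b ` {c - R..d - R})"
      by (intro compact_imp_bounded compact_continuous_image continuous_dprof p b compact_Icc)
    then obtain B where "\<forall>x\<in>{c - R..d - R}. \<bar>dprof p b x\<bar> \<le> B" unfolding bounded_iff by auto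
    then have B: "\<And>x. x \<in> {c - R..d - R} \<Longrightarrow> \<bar>dprof p b x\<bar> \<le> B" by blast
    have "\<bar>dcut_prof p b R (x + - R)\<bar> \<le> B" if "x \<in> {c..d}" for x
      by (rule order_trans[OF dcut_prof_abs_le B]) (use that in auto)
    then show "\<exists>B. \<forall>x\<in>{c..d}. \<bar>dcut_prof p b R (x + - R)\<bar> \<le> B" by blast
  qed (auto simp: is_interval_ci)
  then have w: "wderiv_on {0..} (\<lambda>x. s * (0 + cut_prof p b R (x + - R))) (\<lambda>x. s * dcut_prof p b R (x + - R))"
    using wderiv_on_scale by simp
  have shift: "set_integrable lborel {0..} (\<lambda>x. F (x + - R))" if "integrable lborel F" for F :: "real \<Rightarrow> real"
    unfolding set_integrable_def
    using integrable_mult_indicator[OF _ lborel_integrable_real_affine[OF that, of 1 "- R"], of "{0..}"] 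
    by (simp add: add.commute)
  show ?thesis unfolding h1_on_def
    using w shift[OF integrable_cut_prof(1)] shift[OF integrable_cut_prof(2)] by (simp add: power_mult_distrib)
qed

lemma shifted_cut_prof_integrals:
  assumes R: "0 < R"
  shows "(LBINT x:{0..}. (cut_prof p b R (x + - R))\<^sup>2) = (LINT x|lborel. (cut_prof p b R x)\<^sup>2)"
    "(LBINT x:{0..}. (dcut_prof p b R (x + - R))\<^sup>2) = (LINT x|lborel. (dcut_prof p b R x)\<^sup>2)"
    "(LBINT x:{0..}. cut_prof p b R (x + - R) powr p) = (LINT x|lborel. cut_prof p b R x powr p)"
proof -
  have "(LBINT x:{0..}. F (x + - R)) = (LINT x|lborel. F x)" if "\<And>x. x < - R \<Longrightarrow> F x = 0" for F :: "real \<Rightarrow> real"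
  proof -
    have "(LBINT x:{0..}. F (x + - R)) = (LBINT x:{- R..}. F x)" using set_integral_shift[of 0 F "- R"] by simp
    also have "\<dots> = (LBINT x:UNIV. F x)" by (rule set_integral_vanish_outside(2)[symmetric]) (use that in auto)
    finally show ?thesis by (simp add: set_lebesgue_integral_def)
  qed
  note * = this
  show "(LBINT x:{0..}. (cut_prof p b R (x + - R))\<^sup>2) = (LINT x|lborel. (cut_prof p b R x)\<^sup>2)"
    by (rule *) (use R cut_prof_eq_0 in auto)
  show "(LBINT x:{0..}. (dcut_prof p b R (x + - R))\<^sup>2) = (LINT x|lborel. (dcut_prof p b R x)\<^sup>2)"
    by (rule *) (auto simp: dcut_prof_def)
  show "(LBINT x:{0..}. cut_prof p b R (x + - R) powr p) = (LINT x|lborel. cut_prof p b R x powr p)"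
    by (rule *) (use R cut_prof_eq_0 in auto)
qed

text \<open>The truncations converge pointwise and are dominated by the profile and its derivative,
  so dominated convergence applies to all three integrals.\<close>

lemma cut_prof_limits:
  "(\<lambda>n. LINT x|lborel. (cut_prof p b (real n) x)\<^sup>2) \<longlonglongrightarrow> prof_mass p b"
  "(\<lambda>n. LINT x|lborel. (dcut_prof p b (real n) x)\<^sup>2) \<longlonglongrightarrow> (LINT x|lborel. (dprof p b x)\<^sup>2)"
  "(\<lambda>n. LINT x|lborel. cut_prof p b (real n) x powr p) \<longlonglongrightarrow> (LINT x|lborel. prof p b x powr p)"
proof -
  note i = integrable_prof[OF p b]
  note [measurable] = prof_borel_measurable[OF p b]
  have l: "(\<lambda>n. cut_prof p b (real n) x) \<longlonglongrightarrow> prof p b x" for x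
  proof -
    have "(\<lambda>n. prof p b (real n)) \<longlonglongrightarrow> 0"
      by (rule filterlim_compose[OF prof_tendsto_0(1)[OF p b] filterlim_real_sequentially])
    then have "(\<lambda>n. max 0 (prof p b x - prof p b (real n))) \<longlonglongrightarrow> max 0 (prof p b x - 0)"
      by (intro tendsto_intros)
    then show ?thesis using prof_pos[OF p b, of x] by (simp add: cut_prof_def)
  qed
  have ld: "(\<lambda>n. dcut_prof p b (real n) x) \<longlonglongrightarrow> dprof p b x" for x
  proof (rule tendsto_eventually)
    obtain N where N: "\<bar>x\<bar> \<le> real N" using real_arch_simple by blast
    show "\<forall>\<^sub>F n in sequentially. dcut_prof p b (real n) x = dprof p b x"
      using eventually_ge_at_top[of N]
    proof eventually_elim
      case (elim n)
      then have "x \<in> {- real n..real n}" using N by auto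
      then show ?case by (simp add: dcut_prof_def)
    qed
  qed
  show "(\<lambda>n. LINT x|lborel. (cut_prof p b (real n) x)\<^sup>2) \<longlonglongrightarrow> prof_mass p b"
    unfolding prof_mass_def
    by (rule integral_dominated_convergence[OF _ _ i(1)])
       (use cut_prof_bounds l in \<open>auto intro!: power_mono tendsto_intros\<close>)
  show "(\<lambda>n. LINT x|lborel. (dcut_prof p b (real n) x)\<^sup>2) \<longlonglongrightarrow> (LINT x|lborel. (dprof p b x)\<^sup>2)"
    by (rule integral_dominated_convergence[OF _ _ i(2)])
       (use dcut_prof_abs_le ld in \<open>auto intro!: tendsto_intros simp: abs_le_square_iff\<close>)
  show "(\<lambda>n. LINT x|lborel. cut_prof p b (real n) x powr p) \<longlonglongrightarrow> (LINT x|lborel. prof p b x powr p)"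
  proof (rule integral_dominated_convergence[OF _ _ i(3)])
    show "AE x in lborel. (\<lambda>n. cut_prof p b (real n) x powr p) \<longlonglongrightarrow> prof p b x powr p"
      using prof_pos[OF p b] by (intro AE_I2 tendsto_powr l tendsto_const) (simp add: less_imp_neq[symmetric])
    show "AE x in lborel. norm (cut_prof p b (real n) x powr p) \<le> prof p b x powr p" for n
      using cut_prof_bounds p by (auto intro!: powr_mono2)
  qed measurable
qed

end

section \<open>Energy bound, multiplier and stationary equation on the graph\<close>

lemma ground_state_energy_le:
  assumes p: "2 < p" and b: "0 < b" "prof_mass p b = \<mu>"
    and len: "\<forall>e\<in>edges G. 0 < len G e" and fin: "finite (edges G)"
    and e0: "e0 \<in> edges G" "is_halfline G e0" and gs: "ground_state G p \<mu> u"
  shows "energy G p u \<le> (LINT x|lborel. (dprof p b x)\<^sup>2) - b\<^sup>2 / 2 * \<mu>"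
proof -
  have \<mu>: "\<mu> > 0" using prof_mass_pos[OF p b(1)] b(2) by simp
  have H0: "H1 G (\<lambda>_ _. 0)"
    unfolding H1_def H1_edge_def is_wderiv_def
    by (auto simp: set_integrable_def set_lebesgue_integral_def intro!: exI[of _ "\<lambda>_. 0"])
  have dG0: "(LBINT x:edom G e. (dG G (\<lambda>_ _. 0) e x)\<^sup>2) = 0" if "e \<in> edges G" for e
  proof -
    have "h1_on (edom G e) (\<lambda>_. 0) (\<lambda>_. 0)"
      by (auto simp: h1_on_def wderiv_on_def set_integrable_def set_lebesgue_integral_def)
    then show ?thesis using integral_dG_square[of G e "\<lambda>_ _. 0" "\<lambda>_. 0"] len[rule_format, OF that] by simp
  qed
  define M A B where "M n = (LINT x|lborel. (cut_prof p b (real n) x)\<^sup>2)"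
    and "A n = (LINT x|lborel. (dcut_prof p b (real n) x)\<^sup>2)"
    and "B n = (LINT x|lborel. cut_prof p b (real n) x powr p)" for n
  note lim = cut_prof_limits[OF p b(1), folded M_def A_def B_def, unfolded b(2)]
  \<comment> \<open>Truncation loses mass; this amplitude factor restores it exactly and tends to
    1.\<close>
  define s where "s n = sqrt (\<mu> / M n)" for n
  have ls: "s \<longlonglongrightarrow> 1"
  proof -
    have "(\<lambda>n. sqrt (\<mu> / M n)) \<longlonglongrightarrow> sqrt (\<mu> / \<mu>)" using \<mu> by (intro tendsto_intros lim) simp
    then show ?thesis using \<mu> by (simp add: s_def[abs_def])
  qed
  have "\<forall>\<^sub>F n in sequentially. energy G p u \<le> 1/2 * ((s n)\<^sup>2 * A n) - 1/p * (s n powr p * B n)"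
    using order_tendstoD(1)[OF lim(1) \<mu>] eventually_gt_at_top[of 0]
  proof eventually_elim
    case (elim n)
    let ?q = "\<lambda>x. cut_prof p b (real n) (x + - real n)"
    let ?w = "\<lambda>e x. s n * (0 + (if e = e0 then ?q x else 0))"
    have n: "0 < real n" using elim by simp
    have sp: "0 < s n" using elim \<mu> by (simp add: s_def)
    have s2: "(s n)\<^sup>2 * M n = \<mu>" using elim \<mu> by (simp add: s_def)
    have q0: "?q 0 = 0" using cut_prof_eq_0[OF p b(1), of "real n" "- real n"] by simp
    note w = perturb_halfline[where u="\<lambda>_ _. 0" and q="?q" and s="s n" and g'="\<lambda>x. s n * dcut_prof p b (real n) (x + - real n)",
        OF len fin H0 e0 q0 sp h1_on_shifted_cut_prof[OF p b(1) n]]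
    note sh = shifted_cut_prof_integrals[OF p b(1) n]
    have "mass G ?w = \<mu>"
      unfolding w(2) using s2 sh(1) by (simp add: power_mult_distrib M_def)
    then have "energy G p u \<le> energy G p ?w" using gs w(1) unfolding ground_state_def by blast
    also have "energy G p ?w = 1/2 * ((s n)\<^sup>2 * A n) - 1/p * (s n powr p * B n)"
    proof -
      have "(\<Sum>e\<in>edges G - {e0}. LBINT x:edom G e. (dG G (\<lambda>_ _. 0) e x)\<^sup>2) = 0"
        using dG0 by simp
      moreover have "(LBINT x:{0..}. (s n * dcut_prof p b (real n) (x + - real n))\<^sup>2) = (s n)\<^sup>2 * A n"
        using sh(2) by (simp add: power_mult_distrib A_def)
      moreover have "(LBINT x:{0..}. \<bar>s n * (0 + ?q x)\<bar> powr p) = s n powr p * B n"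
        using sh(3) sp cut_prof_bounds(1)[OF p b(1)] by (simp add: abs_mult powr_mult B_def)
      ultimately show ?thesis unfolding w(3) by simp
    qed
    finally show ?case .
  qed
  moreover have "(\<lambda>n. 1/2 * ((s n)\<^sup>2 * A n) - 1/p * (s n powr p * B n)) \<longlonglongrightarrow>
      1/2 * (1\<^sup>2 * (LINT x|lborel. (dprof p b x)\<^sup>2)) - 1/p * (1 powr p * (LINT x|lborel. prof p b x powr p))"
    by (intro tendsto_intros ls lim) simp
  ultimately have "energy G p u \<le> 1/2 * (1\<^sup>2 * (LINT x|lborel. (dprof p b x)\<^sup>2)) - 1/p * (1 powr p * (LINT x|lborel. prof p b x powr p))"
    by (intro tendsto_lowerbound) auto
  then show ?thesis using prof_energy[OF p b(1)] b(2) by simp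
qed

text \<open>The value forced on the Lagrange multiplier by testing the stationary equation with
  \<open>u\<close> itself. The sums run over the whole graph, so all half-lines share it.\<close>

definition multiplier :: "('v, 'e) mgraph \<Rightarrow> real \<Rightarrow> real \<Rightarrow> ('e \<Rightarrow> real \<Rightarrow> real) \<Rightarrow> real" where
  "multiplier G p \<mu> u = ((\<Sum>e\<in>edges G. LBINT x:edom G e. \<bar>u e x\<bar> powr p) 
     - (\<Sum>e\<in>edges G. LBINT x:edom G e. (dG G u e x)\<^sup>2)) / \<mu>"

text \<open>Tents inside the half-line vanish at the vertex, hence are admissible. The other edges
  enter only through their scaled mass, kinetic and potential parts, the numbers \<open>rM\<close>,
  \<open>rA\<close>, \<open>rB\<close> of \<open>weak_euler_lagrange\<close>.\<close>

lemma ground_state_halfline: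
  fixes G :: "('v, 'e) mgraph" and u :: "'e \<Rightarrow> real \<Rightarrow> real"
  assumes p: "2 < p" and \<mu>: "0 < \<mu>"
    and len: "\<forall>e\<in>edges G. 0 < len G e" and fin: "finite (edges G)"
    and e0: "e0 \<in> edges G" "is_halfline G e0" and gs: "ground_state G p \<mu> u"
    and pos: "\<And>x. 0 \<le> x \<Longrightarrow> 0 < u e0 x"
  obtains a y where "0 < a" "a\<^sup>2 = multiplier G p \<mu> u" "\<And>x. 0 \<le> x \<Longrightarrow> u e0 x = prof p a (x + y)"
proof -
  have H: "H1 G u" and m: "mass G u = \<mu>"
    and min: "\<And>w. H1 G w \<Longrightarrow> mass G w = \<mu> \<Longrightarrow> energy G p u \<le> energy G p w"
    using gs by (auto simp: ground_state_def)
  have ed: "edom G e0 = {0..}" by (rule edom_halfline[OF e0(2)])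
  have split: "(\<Sum>e\<in>edges G. F e) = (\<Sum>e\<in>edges G - {e0}. F e) + F e0" for F :: "'e \<Rightarrow> real"
    using sum.remove[OF fin e0(1), of F] by simp
  have h: "h1_on {0..} (u e0) (dG G u e0)" using H1_dG[OF H e0(1) len[rule_format, OF e0(1)]] by (simp add: ed)
  let ?rM = "\<Sum>e\<in>edges G - {e0}. LBINT x:edom G e. (u e x)\<^sup>2"
  let ?rA = "\<Sum>e\<in>edges G - {e0}. LBINT x:edom G e. (dG G u e x)\<^sup>2"
  let ?rB = "\<Sum>e\<in>edges G - {e0}. LBINT x:edom G e. \<bar>u e x\<bar> powr p"
  have weak: "2 * u e0 m - u e0 (m - d) - u e0 (m + d) =
      (LBINT x:{m - d..m + d}. (u e0 x powr (p - 1) - multiplier G p \<mu> u * u e0 x) * hat m d x)"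
    if d: "0 < d" "0 \<le> m - d" for m d
    unfolding multiplier_def split ed
  proof (rule weak_euler_lagrange[OF p _ _ _ h pos d(1), where rM = ?rM])
    show J: "{m - d..m + d} \<subseteq> {0..}" using d by auto
    show "\<mu> = ?rM + (LBINT x:{0..}. (u e0 x)\<^sup>2)" using m unfolding mass_def split ed by simp
    show "\<exists>a. x \<in> {a..a + 1} \<and> {a..a + 1} \<subseteq> {0..}" if "x \<in> {0..}" for x :: real
      by (rule exI[of _ x]) (use that in auto)
    fix s \<epsilon> :: real assume s: "0 < s"
      and eq: "s\<^sup>2 * ?rM + (LBINT x:{0..}. (s * (u e0 x + \<epsilon> * hat m d x))\<^sup>2) = \<mu>"
    have q0: "\<epsilon> * hat m d 0 = 0" using d by (simp add: hat_def)
    have hw: "h1_on {0..} (\<lambda>x. s * (u e0 x + \<epsilon> * hat m d x)) (\<lambda>x. s * (dG G u e0 x + \<epsilon> * dhat m d x))"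
      by (rule h1_on_add_hat[OF h is_interval_ci d(1) J])
    note w = perturb_halfline[where u=u and q="\<lambda>x. \<epsilon> * hat m d x" and s=s and g'="\<lambda>x. s * (dG G u e0 x + \<epsilon> * dhat m d x)",
        OF len fin H e0 q0 s hw]
    have "energy G p u = 1/2 * (?rA + (LBINT x:{0..}. (dG G u e0 x)\<^sup>2)) - 1/p * (?rB + (LBINT x:{0..}. \<bar>u e0 x\<bar> powr p))"
      unfolding energy_def split ed ..
    with min[OF w(1)] w(2) eq
    show "1/2 * (?rA + (LBINT x:{0..}. (dG G u e0 x)\<^sup>2)) - 1/p * (?rB + (LBINT x:{0..}. \<bar>u e0 x\<bar> powr p)) \<le>
      1/2 * (s\<^sup>2 * ?rA + (LBINT x:{0..}. (s * (dG G u e0 x + \<epsilon> * dhat m d x))\<^sup>2))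
        - 1/p * (s powr p * ?rB + (LBINT x:{0..}. \<bar>s * (u e0 x + \<epsilon> * hat m d x)\<bar> powr p))"
      unfolding w(3) by (simp only:)
  qed (use \<mu> in \<open>auto simp: is_interval_ci\<close>)
  show thesis using weak_solution_prof[OF p h pos weak] that by blast
qed

text \<open>The definition of the multiplier eliminates the kinetic integral, so that for a given
  multiplier the energy grows with the L^p content.\<close>

lemma ground_state_energy_eq:
  assumes "ground_state G p \<mu> u" "0 < \<mu>"
  shows "energy G p u = (1/2 - 1/p) * (\<Sum>e\<in>edges G. LBINT x:edom G e. \<bar>u e x\<bar> powr p) - multiplier G p \<mu> u * \<mu> / 2"
  unfolding energy_def multiplier_def using assms by (simp add: field_simps)

text \<open>The two half-lines unfold to the two half-axes. In the contrapositive, a graph that is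
  not a line has an edge besides any two half-lines with a common vertex.\<close>

lemma two_halflines_homeomorphic_to_R:
  fixes G :: "('v, 'e) mgraph"
  assumes E: "edges G = {e1, e2}" "e1 \<noteq> e2" and hl: "is_halfline G e1" "is_halfline G e2" and src: "src G e1 = src G e2"
  shows "homeomorphic_to_R G"
  unfolding homeomorphic_to_R_def
proof (intro exI[of _ "\<lambda>e t. if e = e1 then t else - t"] conjI)
  have ed: "edom G e1 = {0..}" "edom G e2 = {0..}" using edom_halfline[OF hl(1)] edom_halfline[OF hl(2)] by auto
  have vp: "vpt G e1 t = (if t = 0 then Some (src G e1) else None)" "vpt G e2 t = (if t = 0 then Some (src G e1) else None)" for t
    using hl src by (auto simp: vpt_def is_halfline_def)
  show "\<forall>e\<in>edges G. \<forall>t\<in>edom G e. \<forall>e'\<in>edges G. \<forall>t'\<in>edom G e'.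
       ((if e = e1 then t else - t) = (if e' = e1 then t' else - t')) = same_pt G e t e' t'"
    using E(2) by (auto simp: E(1) ed same_pt_def vp)
  show "\<forall>r. \<exists>e\<in>edges G. \<exists>t\<in>edom G e. (if e = e1 then t else - t) = r"
  proof
    fix r :: real
    show "\<exists>e\<in>edges G. \<exists>t\<in>edom G e. (if e = e1 then t else - t) = r"
      by (rule bexI[of _ "if 0 \<le> r then e1 else e2"], rule bexI[of _ "\<bar>r\<bar>"]) (use E ed in auto)
  qed
  show "\<forall>S. open S \<longleftrightarrow> (\<forall>e\<in>edges G. openin (top_of_set (edom G e)) {t \<in> edom G e. (if e = e1 then t else - t) \<in> S})"
  proof (intro allI iffI)
    fix S :: "real set" assume S: "open S"
    have "openin (top_of_set {0..}) ({0::real..} \<inter> (\<lambda>t. - t) -` S)" "openin (top_of_set {0..}) ({0..} \<inter> S)"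
      using S by (auto intro!: continuous_openin_preimage_gen continuous_intros simp: openin_open_Int)
    then show "\<forall>e\<in>edges G. openin (top_of_set (edom G e)) {t \<in> edom G e. (if e = e1 then t else - t) \<in> S}"
      using E by (auto simp: ed Int_def vimage_def)
  next
    fix S :: "real set"
    assume "\<forall>e\<in>edges G. openin (top_of_set (edom G e)) {t \<in> edom G e. (if e = e1 then t else - t) \<in> S}"
    then have "openin (top_of_set {0..}) {t \<in> {0..}. t \<in> S}" "openin (top_of_set {0..}) {t \<in> {0..}. - t \<in> S}"
      using E by (auto simp: ed)
    then obtain U V where UV: "open U" "{t \<in> {0..}. t \<in> S} = {0..} \<inter> U" "open V" "{t \<in> {0..}. - t \<in> S} = {0..} \<inter> V"
      unfolding openin_open by blast
    have memU: "t \<in> S \<longleftrightarrow> t \<in> U" if "0 \<le> t" for t using UV(2) that by blast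
    have memV: "- t \<in> S \<longleftrightarrow> t \<in> V" if "0 \<le> t" for t using UV(4) that by blast
    have V': "open (uminus -` V)" using UV(3) by (intro open_vimage continuous_intros)
    show "open S"
    proof (subst open_subopen, rule ballI)
      fix x assume x: "x \<in> S"
      consider "0 < x" | "x < 0" | "x = 0" by linarith
      then show "\<exists>T. open T \<and> x \<in> T \<and> T \<subseteq> S"
      proof cases
        case 1
        then show ?thesis using UV(1) x memU by (intro exI[of _ "U \<inter> {0<..}"]) auto
      next
        case 2
        have "T \<subseteq> S" if "T = uminus -` V \<inter> {..<0}" for T
          using memV[of "- _"] that by force
        moreover have "x \<in> uminus -` V \<inter> {..<0}" using 2 x memV[of "- x"] by auto
        ultimately show ?thesis using V' by (intro exI[of _ "uminus -` V \<inter> {..<0}"]) auto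
      next
        case 3
        \<comment> \<open>At the common vertex a neighbourhood must be open along both half-lines,
          so both witnesses are intersected.\<close>
        have "U \<inter> uminus -` V \<subseteq> S"
        proof
          fix t assume t: "t \<in> U \<inter> uminus -` V"
          show "t \<in> S" using memU[of t] memV[of "- t"] t by (cases "0 \<le> t") auto
        qed
        moreover have "x \<in> U \<inter> uminus -` V" using 3 x memU[of 0] memV[of 0] by auto
        ultimately show ?thesis using V' UV(1) by (intro exI[of _ "U \<inter> uminus -` V"]) auto
      qed
    qed
  qed
qed

lemma two_halflines_shift_sum_pos:
  fixes G :: "('v, 'e) mgraph" and u :: "'e \<Rightarrow> real \<Rightarrow> real"
  assumes p: "2 < p" "p < 6" and \<mu>: "0 < \<mu>"
    and len: "\<forall>e\<in>edges G. 0 < len G e" and fin: "finite (edges G)"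
    and gs: "ground_state G p \<mu> u"
    and pos: "\<forall>e\<in>edges G. \<forall>t\<in>edom G e. 0 < u e t"
    and e1: "e1 \<in> edges G" "is_halfline G e1" and e2: "e2 \<in> edges G" "is_halfline G e2" and ne: "e1 \<noteq> e2"
    and more: "edges G \<noteq> {e1, e2}"
    and a: "0 < a" "a\<^sup>2 = multiplier G p \<mu> u"
    and y1: "\<And>x. 0 \<le> x \<Longrightarrow> u e1 x = prof p a (x + y1)" and y2: "\<And>x. 0 \<le> x \<Longrightarrow> u e2 x = prof p a (x + y2)"
  shows "0 < y1 + y2"
proof (rule ccontr)
  assume "\<not> 0 < y1 + y2"
  have H: "H1 G u" using gs by (simp add: ground_state_def)
  let ?I = "\<lambda>e. LBINT x:edom G e. \<bar>u e x\<bar> powr p"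
  let ?Q = "\<lambda>x. prof p a x powr p"
  have Ipos: "0 < ?I e" if "e \<in> edges G" for e
    by (rule positive_integral_edge[OF H1_dG[OF H that len[rule_format, OF that]] len[rule_format, OF that]]) (use p pos that in auto)
  \<comment> \<open>The further edge makes the comparison strict; two half-lines alone can carry
    exactly one full soliton, as on the line.\<close>
  obtain e3 where e3: "e3 \<in> edges G - {e1} - {e2}" using more e1 e2 by blast
  have "(\<Sum>e\<in>edges G. ?I e) = ?I e1 + (?I e2 + (\<Sum>e\<in>edges G - {e1} - {e2}. ?I e))"
    using sum.remove[OF fin e1(1), of ?I] sum.remove[of "edges G - {e1}" e2 ?I] fin e2(1) ne by simp
  moreover have "0 < (\<Sum>e\<in>edges G - {e1} - {e2}. ?I e)"
    by (rule sum_pos) (use fin e3 Ipos in auto)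
  moreover have I: "?I e = (LBINT x:{y..}. ?Q x)"
    if "is_halfline G e" "\<And>x. 0 \<le> x \<Longrightarrow> u e x = prof p a (x + y)" for e y
  proof -
    have "?I e = (LBINT x:{0..}. ?Q (x + y))"
      unfolding edom_halfline[OF that(1)] 
      by (rule set_lebesgue_integral_cong) (use that(2) prof_pos[OF p(1) a(1)] in \<open>auto simp: less_imp_le\<close>)
    also have "\<dots> = (LBINT x:{y..}. ?Q x)" using set_integral_shift[of 0 ?Q y] by simp
    finally show ?thesis .
  qed
  moreover have "(LINT x|lborel. ?Q x) \<le> (LBINT x:{y1..}. ?Q x) + (LBINT x:{y2..}. ?Q x)"
  proof -
    note i = integrable_prof(3)[OF p(1) a(1)]
    \<comment> \<open>By evenness, the part of the soliton missing from \<open>{y1..}\<close> is its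
      part over \<open>{- y1..}\<close>, which lies in \<open>{y2..}\<close> because y1 + y2 \<le>
      0.\<close>
    have "(LBINT x:{..y1}. ?Q x) = (LBINT x:{- y1..}. ?Q x)"
      using set_integral_reflect[of y1 ?Q] by (simp add: prof_even)
    also have "\<dots> \<le> (LBINT x:{y2..}. ?Q x)"
    proof (rule set_integral_mono_set)
      show "set_integrable lborel {y2..} ?Q"
        unfolding set_integrable_def by (rule integrable_mult_indicator[OF _ i]) simp
    qed (use \<open>\<not> 0 < y1 + y2\<close> in auto)
    finally show ?thesis using set_integral_split_at[OF i, of y1] by simp
  qed
  ultimately have "(LINT x|lborel. ?Q x) < (\<Sum>e\<in>edges G. ?I e)"
    using I[OF e1(2) y1] I[OF e2(2) y2] by linarith
  then have "(1/2 - 1/p) * (LINT x|lborel. ?Q x) < (1/2 - 1/p) * (\<Sum>e\<in>edges G. ?I e)"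
    using p by (intro mult_strict_left_mono) (auto simp: field_simps)
  moreover have "(1/2 - 1/p) * (LINT x|lborel. ?Q x) = (LINT x|lborel. (dprof p a x)\<^sup>2)"
    using prof_integrals(2)[OF p(1) a(1)] p by (simp add: field_simps)
  \<comment> \<open>The left-hand side is the lower bound at frequency \<open>a\<close>. It is at
    least the energy of the soliton of mass \<mu>, with frequency \<open>b\<close>, and a ground
    state cannot lie above the latter.\<close>
  ultimately have lt: "(LINT x|lborel. (dprof p a x)\<^sup>2) - a\<^sup>2 / 2 * \<mu> < energy G p u"
    unfolding ground_state_energy_eq[OF gs \<mu>] a(2)[symmetric] by simp
  obtain b where b: "0 < b" "prof_mass p b = \<mu>" using prof_mass_surj[OF p \<mu>] by blast
  have "energy G p u \<le> (LINT x|lborel. (dprof p b x)\<^sup>2) - b\<^sup>2 / 2 * \<mu>"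
    by (rule ground_state_energy_le[OF p(1) b len fin e1 gs])
  with lt prof_energy_min_frequency[OF p a(1) b(1)] show False unfolding b(2) by linarith
qed

theorem theorem2p9:
  fixes G :: "('v, 'e) mgraph" and p \<mu> :: real and u :: "'e \<Rightarrow> real \<Rightarrow> real" and v :: 'v
  assumes "wf_mgraph G" and "connected_mgraph G" and "\<not> homeomorphic_to_R G"
    and "2 < p" and "p < 6" and "0 < \<mu>"
    and "v \<in> verts G"
    and "2 \<le> card {e \<in> edges G. is_halfline G e \<and> src G e = v}"
    and "ground_state G p \<mu> u"
    and "\<forall>e\<in>edges G. \<forall>t\<in>edom G e. 0 < u e t"
  shows "\<exists>m>0. \<exists>y\<ge>0. \<forall>e\<in>{e \<in> edges G. is_halfline G e \<and> src G e = v}.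
            \<forall>x\<ge>0. u e x = soliton p m (x + y)"
proof -
  let ?N = "{e \<in> edges G. is_halfline G e \<and> src G e = v}"
  note p = \<open>2 < p\<close> \<open>p < 6\<close>
  have fin: "finite (edges G)" and len: "\<forall>e\<in>edges G. 0 < len G e"
    using assms(1) by (auto simp: wf_mgraph_def)
  have H: "H1 G u" using assms(9) by (simp add: ground_state_def)
  \<comment> \<open>Fixing \<open>a\<close> from the multiplier before any half-line is considered
    makes it common to all of them; the frequency found on each is the positive root of the same
    number.\<close>
  define a where "a = sqrt (multiplier G p \<mu> u)"
  have "\<exists>y. 0 < a \<and> a\<^sup>2 = multiplier G p \<mu> u \<and> (\<forall>x\<ge>0. u e x = prof p a (x + y))" if "e \<in> ?N" for e
  proof -
    have e: "e \<in> edges G" "is_halfline G e" using that by auto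
    have "0 < u e x" if "0 \<le> x" for x using assms(10) e that by (auto simp: edom_halfline)
    then obtain a' y where *: "0 < a'" "a'\<^sup>2 = multiplier G p \<mu> u" "\<And>x. 0 \<le> x \<Longrightarrow> u e x = prof p a' (x + y)"
      using ground_state_halfline[OF p(1) assms(6) len fin e assms(9)] by metis
    then have "a = a'" unfolding a_def by (metis real_sqrt_unique less_imp_le)
    with * show ?thesis by blast
  qed
  then obtain Y where Y: "\<And>e. e \<in> ?N \<Longrightarrow> 0 < a \<and> a\<^sup>2 = multiplier G p \<mu> u \<and> (\<forall>x\<ge>0. u e x = prof p a (x + Y e))"
    by metis
  have pair: "Y e = Y e' \<and> 0 < Y e" if e: "e \<in> ?N" "e' \<in> ?N" "e \<noteq> e'" for e e'
  proof -
    note ye = Y[OF e(1)] Y[OF e(2)]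
    have "same_pt G e 0 e' 0" using e by (auto simp: same_pt_def vpt_def)
    moreover have "0 \<in> edom G e" "0 \<in> edom G e'" using e by (auto simp: edom_halfline)
    ultimately have "u e 0 = u e' 0" using H e unfolding H1_def by blast
    then have "prof p a (Y e) = prof p a (Y e')" using ye by simp
    \<comment> \<open>Equal values at the vertex leave only the signs of the shifts open; a positive
      sum then excludes opposite signs, two negative shifts and two zero shifts.\<close>
    then have abs: "\<bar>Y e\<bar> = \<bar>Y e'\<bar>" using prof_eq_iff[OF p(1)] ye by blast
    have "edges G \<noteq> {e, e'}"
      using two_halflines_homeomorphic_to_R[of G e e'] assms(3) e by auto
    then have "0 < Y e + Y e'"
      by (intro two_halflines_shift_sum_pos[OF p assms(6) len fin assms(9,10), of e e' a]) (use e ye in auto)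
    with abs show ?thesis by linarith
  qed
  \<comment> \<open>Every half-line at \<open>v\<close> needs a partner, since the sign of a shift
    is controlled only through pairs.\<close>
  have other: "\<exists>e'\<in>?N. e' \<noteq> e" for e
  proof (rule ccontr)
    assume "\<not> ?thesis"
    then have "?N \<subseteq> {e}" by blast
    then have "card ?N \<le> card {e}" by (intro card_mono) auto
    then show False using assms(8) by simp
  qed
  obtain e0 where e0: "e0 \<in> ?N" using other by blast
  have eqY: "Y e = Y e0" if "e \<in> ?N" for e using pair[OF that e0] by (cases "e = e0") auto
  obtain e' where e': "e' \<in> ?N" "e' \<noteq> e0" using other by blast
  have "0 < Y e0" using pair[OF e0 e'(1)] e'(2) by simp
  moreover obtain m where m: "0 < m" "\<And>x. soliton p m x = prof p a x" using prof_eq_soliton[OF p, of a] Y[OF e0] by blast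
  ultimately show ?thesis
    using Y eqY by (intro exI[of _ m] conjI exI[of _ "Y e0"] ballI allI impI) (auto simp: m(2))
qed

end
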